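(* Let $\mathbb{F}$ be a field, $n\ge 2$, and $V$ a $2n$-dimensional $\mathbb{F}$-vector space with a non-degenerate alternating bilinear form $\mathsf{s}$, with hyperbolic basis $\mathcal{H}=\{e_i,f_i\}_{i=1}^n$, and let $G=\mathrm{Sp}(V)$. Let $\mathcal{A}^\pi$ be the amalgam of subgroups of $G$ consisting of the groups $S^\pi_j$ $(1\le j\le n)$, $M^\pi_i$ $(1\le i\le n-1)$, $S^\pi_{jl}=\langle S^\pi_j,S^\pi_l\rangle$ $(1\le j\neq l\le n)$, $M^\pi_{ik}=\langle M^\pi_i,M^\pi_k\rangle$ $(1\le i\ne k\le n-1)$ and $Q^\pi_{ij}=\langle M^\pi_i,S^\pi_j\rangle$ $(1\le i\le n-1,\ 1\le j\le n)$, together with the inclusion maps among them induced by $G$, where $S^\pi_j$ is the set of $g\in G$ fixing every vector of $\mathcal{H}\setminus\{e_j,f_j\}$ and stabilizing $\langle e_j,f_j\rangle$, and $M^\pi_i$ is the set of $g\in G$ fixing every vector of $\mathcal{H}\setminus\{f_i,f_{i+1}\}$ and stabilizing $\langle e_i,f_i,e_{i+1},f_{i+1}\rangle$. If $|\mathbb{F}|>2$, then $G=\mathrm{Sp}(V)$ is the universal completion of $\mathcal{A}^\pi$. Moreover, for any field $\mathbb{F}$, $\mathrm{Sp}(V)$ is the universal completion of the amalgam of maximal parabolic subgroups $P_{I\setminus\{k\}}=\mathrm{Stab}_G(C_k)$, $k\in I=\{1,\dots,2n-1\}$, for the action of $G$ on the geometry $\Gamma(V)$ with respect to the standard chamber 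$C=\{C_k\}_{k=1}^{2n-1}$.
   Context: $\mathrm{Sp}(V)$ is the group of linear automorphisms of $V$ preserving $\mathsf{s}$. A hyperbolic basis satisfies $\mathsf{s}(e_i,e_j)=\mathsf{s}(f_i,f_j)=0$, $\mathsf{s}(e_i,f_j)=\delta_{ij}$. For subspaces, $U^\perp=\{v:\mathsf{s}(u,v)=0\ \forall u\in U\}$ and $\mathrm{Rad}(U)=U\cap U^\perp$. The geometry $\Gamma(V)$: for $k\in I=\{1,\dots,2n-1\}$ the objects of type $k$ are the $k$-dimensional subspaces $U\le V$ with $\dim\mathrm{Rad}(U)\le 1$; two objects $X,Y$ are incident iff $X=Y$, or $X\subseteq Y$ and $X\cap\mathrm{Rad}(Y)=0$, or $Y\subseteq X$ and $Y\cap \mathrm{Rad}(X)=0$. Setting $h_{2i-1}=e_i$, $h_{2i}=f_i$, the standard chamber is $C_k=\langle h_1,\dots,h_k\rangle$, $1\le k\le 2n-1$. Universal completion: given a family of subgroups $\{X_a\}$ of a group $G$ (an amalgam with inclusion maps induced by $G$), its universal completion is the group generated by the elements of $\bigcup_a X_a$ subject to all relations $xy=z$ holding inside some $X_a$; "$G$ is the universal completion" means the natural map from this group to $G$ is an isomorphism. *)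

theory Defs
  imports Complex_Main "HOL-Algebra.Generated_Groups"
begin

text \<open>Letters are pairs (x, b): (x, True) stands for the generator x, (x, False) for its
  formal inverse.  The universal completion of the amalgam A (a set of subgroups of G)
  is the free group on the union of A modulo the relations [x,y] = [z] whenever
  x y = z holds inside some member of A.  ucong A w1 w2 is the congruence defining
  this quotient (on words over the union of A).\<close>

inductive ucong :: "('g, 'b) monoid_scheme \<Rightarrow> 'g set set \<Rightarrow> ('g \<times> bool) list \<Rightarrow> ('g \<times> bool) list \<Rightarrow> bool"
  for G A where
  ucong_refl: "ucong G A w w"
| ucong_sym: "ucong G A w1 w2 \<Longrightarrow> ucong G A w2 w1"
| ucong_trans: "ucong G A w1 w2 \<Longrightarrow> ucong G A w2 w3 \<Longrightarrow> ucong G A w1 w3"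
| ucong_cancel: "x \<in> \<Union>A \<Longrightarrow> ucong G A (u @ [(x, b), (x, \<not> b)] @ w) (u @ w)"
| ucong_rel: "X \<in> A \<Longrightarrow> x \<in> X \<Longrightarrow> y \<in> X \<Longrightarrow> z \<in> X \<Longrightarrow> x \<otimes>\<^bsub>G\<^esub> y = z \<Longrightarrow>
     ucong G A (u @ [(x, True), (y, True)] @ w) (u @ [(z, True)] @ w)"

fun word_eval :: "('g, 'b) monoid_scheme \<Rightarrow> ('g \<times> bool) list \<Rightarrow> 'g" where
  "word_eval G [] = \<one>\<^bsub>G\<^esub>"
| "word_eval G ((x, b) # w) =
     (if b then x else inv\<^bsub>G\<^esub> x) \<otimes>\<^bsub>G\<^esub> word_eval G w"

text \<open>G is the universal completion of A: A is a family of subgroups of G and the natural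
  homomorphism from the universal completion to G is bijective (surjective, and two words
  with the same image in G are equal in the universal completion).\<close>
definition is_universal_completion :: "('g, 'b) monoid_scheme \<Rightarrow> 'g set set \<Rightarrow> bool" where
  "is_universal_completion G A \<longleftrightarrow>
     (\<forall>X\<in>A. subgroup X G) \<and>
     (\<forall>g\<in>carrier G. \<exists>w\<in>lists (\<Union>A \<times> UNIV). word_eval G w = g) \<and>
     (\<forall>w1\<in>lists (\<Union>A \<times> UNIV). \<forall>w2\<in>lists (\<Union>A \<times> UNIV).
        word_eval G w1 = word_eval G w2 \<longrightarrow> ucong G A w1 w2)"

definition bilinear_form :: "('a::field \<Rightarrow> 'v::ab_group_add \<Rightarrow> 'v) \<Rightarrow> ('v \<Rightarrow> 'v \<Rightarrow> 'a) \<Rightarrow> bool" where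
  "bilinear_form scale s \<longleftrightarrow>
     (\<forall>u. Vector_Spaces.linear scale ((*)) (s u)) \<and> (\<forall>v. Vector_Spaces.linear scale ((*)) (\<lambda>u. s u v))"

definition alternating_form :: "('v \<Rightarrow> 'v \<Rightarrow> 'a::field) \<Rightarrow> bool" where
  "alternating_form s \<longleftrightarrow> (\<forall>v. s v v = 0)"

definition nondegenerate_form :: "('v::ab_group_add \<Rightarrow> 'v \<Rightarrow> 'a::field) \<Rightarrow> bool" where
  "nondegenerate_form s \<longleftrightarrow> (\<forall>u. (\<forall>v. s u v = 0) \<longrightarrow> u = 0)"

definition hyperbolic_basis ::
  "('a::field \<Rightarrow> 'v::ab_group_add \<Rightarrow> 'v) \<Rightarrow> ('v \<Rightarrow> 'v \<Rightarrow> 'a) \<Rightarrow> nat \<Rightarrow> (nat \<Rightarrow> 'v) \<Rightarrow> (nat \<Rightarrow> 'v) \<Rightarrow> bool" where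
  "hyperbolic_basis scale s n e f \<longleftrightarrow>
     \<not> module.dependent scale (e ` {1..n} \<union> f ` {1..n}) \<and>
     module.span scale (e ` {1..n} \<union> f ` {1..n}) = UNIV \<and>
     (\<forall>i\<in>{1..n}. \<forall>j\<in>{1..n}. s (e i) (e j) = 0 \<and> s (f i) (f j) = 0 \<and>
        s (e i) (f j) = (if i = j then 1 else 0))"

definition Sp :: "('a::field \<Rightarrow> 'v::ab_group_add \<Rightarrow> 'v) \<Rightarrow> ('v \<Rightarrow> 'v \<Rightarrow> 'a) \<Rightarrow> ('v \<Rightarrow> 'v) monoid" where
  "Sp scale s = \<lparr> carrier = {g. Vector_Spaces.linear scale scale g \<and> bij g \<and> (\<forall>u v. s (g u) (g v) = s u v)},
                  monoid.mult = (\<lambda>g h. g \<circ> h), one = id \<rparr>"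

definition hyp_set :: "nat \<Rightarrow> (nat \<Rightarrow> 'v) \<Rightarrow> (nat \<Rightarrow> 'v) \<Rightarrow> 'v set" where
  "hyp_set n e f = e ` {1..n} \<union> f ` {1..n}"

definition S_pi where
  "S_pi scale s n e f j = {g \<in> carrier (Sp scale s).
     (\<forall>v \<in> hyp_set n e f - {e j, f j}. g v = v) \<and>
     g ` module.span scale {e j, f j} = module.span scale {e j, f j}}"

definition M_pi where
  "M_pi scale s n e f i = {g \<in> carrier (Sp scale s).
     (\<forall>v \<in> hyp_set n e f - {f i, f (i+1)}. g v = v) \<and>
     g ` module.span scale {e i, f i, e (i+1), f (i+1)} = module.span scale {e i, f i, e (i+1), f (i+1)}}"

definition amalgam_pi where
  "amalgam_pi scale s n e f =
     {S_pi scale s n e f j | j. j \<in> {1..n}} \<union>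
     {M_pi scale s n e f i | i. i \<in> {1..n-1}} \<union>
     {generate (Sp scale s) (S_pi scale s n e f j \<union> S_pi scale s n e f l) | j l.
        j \<in> {1..n} \<and> l \<in> {1..n} \<and> j \<noteq> l} \<union>
     {generate (Sp scale s) (M_pi scale s n e f i \<union> M_pi scale s n e f k) | i k.
        i \<in> {1..n-1} \<and> k \<in> {1..n-1} \<and> i \<noteq> k} \<union>
     {generate (Sp scale s) (M_pi scale s n e f i \<union> S_pi scale s n e f j) | i j.
        i \<in> {1..n-1} \<and> j \<in> {1..n}}"

definition hvec :: "(nat \<Rightarrow> 'v) \<Rightarrow> (nat \<Rightarrow> 'v) \<Rightarrow> nat \<Rightarrow> 'v" where
  "hvec e f m = (if odd m then e ((m + 1) div 2) else f (m div 2))"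

definition chamber_C where
  "chamber_C scale e f k = module.span scale (hvec e f ` {1..k})"

definition max_parabolic where
  "max_parabolic scale s e f k = {g \<in> carrier (Sp scale s). g ` chamber_C scale e f k = chamber_C scale e f k}"

definition parabolic_amalgam where
  "parabolic_amalgam scale s n e f = {max_parabolic scale s e f k | k. k \<in> {1..2*n-1}}"

end

(*  A universal completion acts faithfully on its own elements, so it suffices to show:
    whenever a map phi on the union of the amalgam into a group U is multiplicative on each member
    and is a section of an action pi of U on V, then pi is injective on the subgroup generated by the
    image of phi.

    Split V = P + W with P = <e, f> a hyperbolic plane and W its orthogonal complement.  Inside U one
    finds copies L of Sp(P) and R of Sp(W), which commute, and short root elements T u v (u in P,
    v in W) satisfying the Heisenberg relations in each argument.  These relations suffice: the
    elements T e w, L (tv e c), R h form a subgroup Q on which pi is injective, and the cosets of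
    Q corresponding to the nonzero vectors of P + W are permuted by all generators, so that Q is the
    full stabiliser of e.

    For the parabolic amalgam the relations hold inside the stabilisers of C_1, C_2 and C_3.  For the
    slim amalgam one argues by downward induction on k for the subgroup fixing e_i, f_i (i < k):
    T u v is a conjugate of phi (tau e_k e_(k+1)), and the Heisenberg relation for orthogonal
    v, v' follows from the one for non-orthogonal pairs, provided the field has more than two elements. *)

theory Submission
  imports Defs "HOL-Library.Product_Plus"
begin

section \<open>Bijections as an additive group\<close>

text \<open>The obstacle is that a group over \<open>Sp(V)\<close> could have more cosets of
  \<open>Q\<close> than there are nonzero vectors, so every vector needs one fixed representative.
  Vectors with nonzero \<open>P\<close>-component are reached by \<open>L l + T f w\<close>; those
  in \<open>W\<close> need an extra element \<open>N\<close>, and the critical fact is that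
  \<open>L\<close> fixes its coset. An element acting trivially fixes \<open>e\<close>, hence lies
  in \<open>Q\<close>, where it is seen to be 0. A second obstacle in the slim case:
  \<open>T u v\<close> is a conjugate of one element, so it is well defined only if the stabiliser
  of \<open>tau e_k e_(k+1)\<close> centralises the lift. The part of that stabiliser in
  \<open>Sp(W)\<close> comes from the induction, which therefore also carries generators for the
  stabiliser of \<open>e_(k+1)\<close>, each sharing a member of the amalgam with
  \<open>tau e_k e_(k+1)\<close>. The field size matters because the member generated by
  \<open>M_k\<close> and \<open>S_(k+1)\<close> contains \<open>tau e_k v\<close> (\<open>v\<close>
  in \<open>W\<close>) only for \<open>v\<close> in one hyperbolic plane, and independent orthogonal
  pairs never lie in such a plane. The stabiliser of \<open>C_1\<close> contains all
  \<open>tau e_1 w\<close>, so the parabolic amalgam meets no such restriction.\<close>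

typedef 'x perm = "{f :: 'x \<Rightarrow> 'x. bij f}"
  morphisms app Perm by (auto intro: bij_id)

setup_lifting type_definition_perm

text \<open>Composition is written as \<open>+\<close> because \<open>group_add\<close> does not
  demand commutativity and is closed under products, so one can compute in the completion by class
  lemmas, without carrier sets.\<close>

instantiation perm :: (type) group_add
begin
lift_definition zero_perm :: "'x perm" is id by simp
lift_definition plus_perm :: "'x perm \<Rightarrow> 'x perm \<Rightarrow> 'x perm" is "\<lambda>f g. f \<circ> g" by (rule bij_comp)
lift_definition uminus_perm :: "'x perm \<Rightarrow> 'x perm" is "inv_into UNIV" by (rule bij_imp_bij_inv)
definition minus_perm :: "'x perm \<Rightarrow> 'x perm \<Rightarrow> 'x perm" where "minus_perm a b = a + - b"
instance
proof
  fix a b c :: "'x perm"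
  show "a + b + c = a + (b + c)" by transfer (simp add: comp_assoc)
  show "0 + a = a" "a + 0 = a" by (transfer, simp)+
  show "- a + a = 0" by transfer (simp add: bij_is_inj)
  show "a + - b = a - b" by (simp add: minus_perm_def)
qed
end

lemma app_Perm: "bij f \<Longrightarrow> app (Perm f) = f"
  by (simp add: Perm_inverse)

text \<open>Generators enter only on the left, so an induction treats one left translation at a
  time; this suits \<open>U_covered\<close>, where generators act on left cosets.\<close>

inductive_set sgen :: "'u::group_add set \<Rightarrow> 'u set" for S where
  sgen_zero: "0 \<in> sgen S"
| sgen_plus: "x \<in> S \<Longrightarrow> a \<in> sgen S \<Longrightarrow> x + a \<in> sgen S"
| sgen_uminus: "x \<in> S \<Longrightarrow> a \<in> sgen S \<Longrightarrow> - x + a \<in> sgen S"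

lemma sgen_base: "x \<in> S \<Longrightarrow> x \<in> sgen S"
  using sgen_plus[OF _ sgen_zero] by simp

lemma sgen_add: "a \<in> sgen S \<Longrightarrow> b \<in> sgen S \<Longrightarrow> a + b \<in> sgen S"
  by (induction rule: sgen.induct) (auto simp: add.assoc intro: sgen_plus sgen_uminus)

lemma sgen_minus: "a \<in> sgen S \<Longrightarrow> - a \<in> sgen S"
proof (induction rule: sgen.induct)
  case (sgen_plus x a)
  then show ?case
    using sgen_add[OF sgen_plus(3) sgen.sgen_uminus[OF sgen_plus(1) sgen_zero]]
    by (simp add: minus_add)
next
  case (sgen_uminus x a)
  then show ?case
    using sgen_add[OF sgen_uminus(3) sgen_base[OF sgen_uminus(1)]] by (simp add: minus_add)
qed (simp add: sgen_zero)

lemma sgen_least: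
  assumes "S \<subseteq> sgen T" shows "sgen S \<subseteq> sgen T"
proof
  fix a assume "a \<in> sgen S"
  then show "a \<in> sgen T" using assms
    by induction (auto intro: sgen_zero sgen_add sgen_minus simp: subset_iff)
qed

lemma sgen_mono: "S \<subseteq> T \<Longrightarrow> sgen S \<subseteq> sgen T"
  by (rule sgen_least) (auto intro: sgen_base)

lemma sgen_commute:
  assumes "a \<in> sgen S" and "\<And>x. x \<in> S \<Longrightarrow> x + t = t + x"
  shows "a + t = t + a"
  using assms(1)
proof (induction rule: sgen.induct)
  case (sgen_plus x a)
  then show ?case by (metis add.assoc assms(2))
next
  case (sgen_uminus x a)
  have "- x + t = t + - x" using assms(2)[OF sgen_uminus(1)]
    by (metis add.assoc add.right_inverse add_0 add.right_neutral left_minus)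
  then show ?case by (metis sgen_uminus.IH add.assoc)
qed simp

section \<open>A criterion for universal completions\<close>

lemma ucong_append_left: "ucong G A w1 w2 \<Longrightarrow> ucong G A (v @ w1) (v @ w2)"
proof (induction rule: ucong.induct)
  case (ucong_cancel x u b w)
  then show ?case using ucong.ucong_cancel[of x A G "v @ u" b w] by simp
next
  case (ucong_rel X x y z u w)
  then show ?case using ucong.ucong_rel[of X A x y z G "v @ u" w] by simp
qed (auto intro: ucong.intros)

definition ucls :: "('g, 'b) monoid_scheme \<Rightarrow> 'g set set \<Rightarrow> ('g \<times> bool) list \<Rightarrow> ('g \<times> bool) list set" where
  "ucls G A w = {w'. ucong G A w w'}"

lemma ucls_eq_iff: "ucls G A w = ucls G A w' \<longleftrightarrow> ucong G A w w'"
  unfolding ucls_def by (auto intro: ucong.intros)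

text \<open>A letter acts on a class by prefixing. Sets of words that are not classes stay fixed,
  which keeps the action a bijection of the whole type, as \<open>perm\<close> demands.\<close>

definition uact :: "('g, 'b) monoid_scheme \<Rightarrow> 'g set set \<Rightarrow> 'g \<times> bool \<Rightarrow> ('g \<times> bool) list set \<Rightarrow> ('g \<times> bool) list set" where
  "uact G A l C = (if C \<in> range (ucls G A) then ucls G A (l # (SOME w. C = ucls G A w)) else C)"

lemma uact_ucls: "uact G A l (ucls G A w) = ucls G A (l # w)"
proof -
  have "ucls G A w = ucls G A (SOME w'. ucls G A w = ucls G A w')"
    by (rule someI) simp
  then have "ucong G A (l # w) (l # (SOME w'. ucls G A w = ucls G A w'))"
    using ucong_append_left[of G A w _ "[l]"] by (simp add: ucls_eq_iff)
  then show ?thesis by (auto simp: uact_def ucls_eq_iff[symmetric])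
qed

lemma uact_uact_inverse:
  assumes "x \<in> \<Union>A" shows "uact G A (x, b) (uact G A (x, \<not> b) C) = C"
proof (cases "C \<in> range (ucls G A)")
  case True
  then obtain w where w: "C = ucls G A w" by auto
  then show ?thesis
    using ucong_cancel[OF assms, of G "[]" b w] by (simp add: uact_ucls ucls_eq_iff)
qed (simp add: uact_def)

lemma bij_uact: "x \<in> \<Union>A \<Longrightarrow> bij (uact G A (x, b))"
  using uact_uact_inverse[of x A G b] uact_uact_inverse[of x A G "\<not> b"]
  by (intro o_bij[of "uact G A (x, \<not> b)"]) auto

lemma uact_mult:
  assumes "X \<in> A" "x \<in> X" "y \<in> X" "x \<otimes>\<^bsub>G\<^esub> y \<in> X"
  shows "uact G A (x \<otimes>\<^bsub>G\<^esub> y, True) C = uact G A (x, True) (uact G A (y, True) C)"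
proof (cases "C \<in> range (ucls G A)")
  case True
  then obtain w where w: "C = ucls G A w" by auto
  then show ?thesis
    using ucong_rel[OF assms(1-4) refl, of "[]" w] by (simp add: uact_ucls ucls_eq_iff ucong_sym)
qed (simp add: uact_def)

fun phi_word :: "('g \<Rightarrow> 'u::group_add) \<Rightarrow> ('g \<times> bool) list \<Rightarrow> 'u" where
  "phi_word \<phi> [] = 0"
| "phi_word \<phi> ((x, b) # w) = (if b then \<phi> x else - \<phi> x) + phi_word \<phi> w"

lemma phi_word_sgen: "w \<in> lists (X \<times> UNIV) \<Longrightarrow> phi_word \<phi> w \<in> sgen (\<phi> ` X)"
proof (induction w)
  case (Cons l w)
  then show ?case using sgen_base[of "\<phi> (fst l)" "\<phi> ` X"] sgen_minus[OF sgen_base[of "\<phi> (fst l)" "\<phi> ` X"]]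
    by (cases l) (auto intro: sgen_add)
qed (simp add: sgen_zero)

lemma sgen_phi_word:
  assumes "a \<in> sgen (\<phi> ` X)" shows "\<exists>w\<in>lists (X \<times> UNIV). phi_word \<phi> w = a"
  using assms
proof (induction rule: sgen.induct)
  case sgen_zero
  then show ?case by (intro bexI[of _ "[]"]) auto
next
  case (sgen_plus x a)
  then obtain w y where "w \<in> lists (X \<times> UNIV)" "phi_word \<phi> w = a" "x = \<phi> y" "y \<in> X" by auto
  then show ?case by (intro bexI[of _ "(y, True) # w"]) auto
next
  case (sgen_uminus x a)
  then obtain w y where "w \<in> lists (X \<times> UNIV)" "phi_word \<phi> w = a" "x = \<phi> y" "y \<in> X" by auto
  then show ?case by (intro bexI[of _ "(y, False) # w"]) auto
qed

text \<open>The universal completion acts faithfully on its own classes of words; pairing this action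
  with the natural action of the permutation group makes the canonical projection a homomorphism
  of additive groups, so that universality of the amalgam becomes injectivity of that projection.\<close>

lemma is_universal_completionI:
  fixes G :: "('v \<Rightarrow> 'v) monoid"
  assumes G: "group G" and mult: "\<And>g h. g \<otimes>\<^bsub>G\<^esub> h = g \<circ> h" and one: "\<one>\<^bsub>G\<^esub> = id"
    and bij: "\<And>g. g \<in> carrier G \<Longrightarrow> bij g"
    and sub: "\<And>X. X \<in> A \<Longrightarrow> subgroup X G"
    and main: "\<And>\<phi> :: ('v \<Rightarrow> 'v) \<Rightarrow> 'v perm \<times> (('v \<Rightarrow> 'v) \<times> bool) list set perm.
      (\<And>X x y. X \<in> A \<Longrightarrow> x \<in> X \<Longrightarrow> y \<in> X \<Longrightarrow> \<phi> (x \<circ> y) = \<phi> x + \<phi> y) \<Longrightarrow>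
      (\<And>x. x \<in> \<Union>A \<Longrightarrow> app (fst (\<phi> x)) = x) \<Longrightarrow>
      inj_on (app \<circ> fst) (sgen (\<phi> ` \<Union>A)) \<and> carrier G \<subseteq> (app \<circ> fst) ` sgen (\<phi> ` \<Union>A)"
  shows "is_universal_completion G A"
proof -
  define \<phi> where "\<phi> = (\<lambda>x. (Perm x, Perm (uact G A (x, True))))"
  have carr: "x \<in> carrier G" if "x \<in> \<Union>A" for x
    using that sub subgroup.subset by blast
  have phi_fst: "app (fst (\<phi> x)) = x" if "x \<in> \<Union>A" for x
    using bij[OF carr[OF that]] by (simp add: \<phi>_def app_Perm)
  have phi_mult: "\<phi> (x \<circ> y) = \<phi> x + \<phi> y" if X: "X \<in> A" "x \<in> X" "y \<in> X" for X x y
  proof -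
    have xy: "x \<circ> y \<in> X" using subgroup.m_closed[OF sub[OF X(1)] X(2,3)] by (simp add: mult)
    have b: "bij x" "bij y" "bij (x \<circ> y)" using X xy carr bij by blast+
    have "Perm (x \<circ> y) = Perm x + Perm y"
      by (rule app_inject[THEN iffD1]) (simp add: app_Perm b plus_perm.rep_eq)
    moreover have "Perm (uact G A (x \<circ> y, True)) = Perm (uact G A (x, True)) + Perm (uact G A (y, True))"
    proof (rule app_inject[THEN iffD1])
      have "bij (uact G A (x, True))" "bij (uact G A (y, True))" "bij (uact G A (x \<circ> y, True))"
        using X xy by (blast intro: bij_uact)+
      then show "app (Perm (uact G A (x \<circ> y, True)))
          = app (Perm (uact G A (x, True)) + Perm (uact G A (y, True)))"
        using uact_mult[of X A x y G] X xy by (simp add: app_Perm plus_perm.rep_eq mult fun_eq_iff)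
    qed
    ultimately show ?thesis by (simp add: \<phi>_def)
  qed
  have inj: "inj_on (app \<circ> fst) (sgen (\<phi> ` \<Union>A))"
    and surj: "carrier G \<subseteq> (app \<circ> fst) ` sgen (\<phi> ` \<Union>A)"
    using main[of \<phi>] phi_mult phi_fst by blast+
  have ev: "app (fst (phi_word \<phi> w)) = word_eval G w" if "w \<in> lists (\<Union>A \<times> UNIV)" for w
    using that
  proof (induction w)
    case (Cons l w)
    obtain x b where l: "l = (x, b)" by force
    have x: "x \<in> \<Union>A" using Cons.hyps l by auto
    have "inv\<^bsub>G\<^esub> x = inv_into UNIV x"
    proof (rule group.inv_equality[OF G])
      have "inv_into UNIV x = inv\<^bsub>G\<^esub> x"
        using group.l_inv[OF G carr[OF x]] group.r_inv[OF G carr[OF x]] unfolding mult one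
        by (metis inv_unique_comp)
      then show "inv_into UNIV x \<otimes>\<^bsub>G\<^esub> x = \<one>\<^bsub>G\<^esub>" "inv_into UNIV x \<in> carrier G"
        using group.l_inv[OF G carr[OF x]] group.inv_closed[OF G carr[OF x]] by simp_all
    qed (rule carr[OF x])
    then show ?case using Cons phi_fst[OF x]
      by (auto simp: l mult plus_perm.rep_eq uminus_perm.rep_eq)
  qed (simp add: one zero_perm.rep_eq)
  \<comment> \<open>Applied to the class of the empty word, the second component returns the class
    of \<open>w\<close>; hence words with equal \<open>phi_word\<close> are congruent.\<close>
  have cls: "app (snd (phi_word \<phi> w)) (ucls G A []) = ucls G A w"
    if "w \<in> lists (\<Union>A \<times> UNIV)" for w
    using that
  proof (induction w)
    case (Cons l w)
    obtain x b where l: "l = (x, b)" by force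
    have x: "x \<in> \<Union>A" using Cons.hyps l by auto
    have i: "inv_into UNIV (uact G A (x, True)) = uact G A (x, False)"
      by (rule inv_unique_comp)
        (use uact_uact_inverse[OF x, of G True] uact_uact_inverse[OF x, of G False] in auto)
    show ?case using Cons
      by (auto simp: l plus_perm.rep_eq uminus_perm.rep_eq \<phi>_def app_Perm[OF bij_uact[OF x]] i uact_ucls)
  qed (simp add: zero_perm.rep_eq)
  have "ucong G A w1 w2" if "w1 \<in> lists (\<Union>A \<times> UNIV)" "w2 \<in> lists (\<Union>A \<times> UNIV)"
    "word_eval G w1 = word_eval G w2" for w1 w2
  proof -
    have "phi_word \<phi> w1 = phi_word \<phi> w2"
      using inj that phi_word_sgen[of _ "\<Union>A" \<phi>] by (auto simp: inj_on_def ev)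
    then show ?thesis using cls that by (metis ucls_eq_iff)
  qed
  moreover have "\<exists>w\<in>lists (\<Union>A \<times> UNIV). word_eval G w = g" if g: "g \<in> carrier G" for g
  proof -
    obtain a where a: "a \<in> sgen (\<phi> ` \<Union>A)" "app (fst a) = g"
      using subsetD[OF surj g] by auto
    obtain w where w: "w \<in> lists (\<Union>A \<times> UNIV)" "phi_word \<phi> w = a"
      using sgen_phi_word[OF a(1)] by blast
    show ?thesis using ev[OF w(1)] w a(2) by (intro bexI[OF _ w(1)]) simp
  qed
  ultimately show ?thesis using sub unfolding is_universal_completion_def by simp
qed

section \<open>Symplectic spaces\<close>

lemma vs_linear_iff:
  "Vector_Spaces.linear s1 s2 f \<longleftrightarrow> vector_space s1 \<and> vector_space s2 \<and>
     (\<forall>x y. f (x + y) = f x + f y) \<and> (\<forall>c x. f (s1 c x) = s2 c (f x))"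
  by (simp add: linear_iff_module_hom module_hom_iff module_iff_vector_space)

locale symplectic_space = vector_space scale
  for scale :: "'a::field \<Rightarrow> 'v::ab_group_add \<Rightarrow> 'v" (infixr \<open>*s\<close> 75) +
  fixes s :: "'v \<Rightarrow> 'v \<Rightarrow> 'a"
  assumes bilinear: "bilinear_form (*s) s"
    and alternating: "alternating_form s"
    and nondegenerate: "nondegenerate_form s"
begin

lemma s_add_right [simp]: "s u (v + w) = s u v + s u w"
  and s_scale_right [simp]: "s u (c *s v) = c * s u v"
  using bilinear unfolding bilinear_form_def vs_linear_iff by blast+

lemma s_add_left [simp]: "s (u + v) w = s u w + s v w"
  and s_scale_left [simp]: "s (c *s u) v = c * s u v"
  using bilinear unfolding bilinear_form_def vs_linear_iff by blast+

lemma s_self [simp]: "s v v = 0"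
  using alternating by (simp add: alternating_form_def)

lemma s_flip: "s u v = - s v u"
proof -
  have "s u (u + v) + s v (u + v) = 0" using s_add_left[of u v "u + v"] s_self[of "u + v"] by metis
  then show ?thesis by (simp add: eq_neg_iff_add_eq_0)
qed

lemma s_zero [simp]: "s 0 v = 0" "s v 0 = 0"
  using s_scale_left[of 0 0 v] s_scale_right[of v 0 0] by simp_all

lemma s_minus [simp]: "s (- u) v = - s u v" "s u (- v) = - s u v"
  using s_scale_left[of "- 1" u v] s_scale_right[of u "- 1" v] by simp_all

lemma s_diff [simp]: "s (u - v) w = s u w - s v w" "s w (u - v) = s w u - s w v"
  using s_add_left[of u "- v" w] s_add_right[of w u "- v"] by simp_all

lemma s_zero_flip: "s u v = 0 \<Longrightarrow> s v u = 0"
  using s_flip[of u v] by simp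

lemma s_nondeg: "v \<noteq> 0 \<Longrightarrow> \<exists>w. s v w \<noteq> 0"
  using nondegenerate unfolding nondegenerate_form_def by blast

abbreviation isom :: "('v \<Rightarrow> 'v) set" where "isom \<equiv> carrier (Sp (*s) s)"

lemma isom_iff: "g \<in> isom \<longleftrightarrow> Vector_Spaces.linear (*s) (*s) g \<and> bij g \<and> (\<forall>u v. s (g u) (g v) = s u v)"
  by (simp add: Sp_def)

lemma isom_add: "g \<in> isom \<Longrightarrow> g (x + y) = g x + g y"
  and isom_scale: "g \<in> isom \<Longrightarrow> g (c *s x) = c *s g x"
  and isom_s: "g \<in> isom \<Longrightarrow> s (g x) (g y) = s x y"
  and isom_bij: "g \<in> isom \<Longrightarrow> bij g"
  by (auto simp: isom_iff vs_linear_iff)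

lemma isom_zero: "g \<in> isom \<Longrightarrow> g 0 = 0"
  using isom_scale[of g 0 0] by simp

lemma isom_eq_zero: "g \<in> isom \<Longrightarrow> g x = 0 \<longleftrightarrow> x = 0"
  using isom_bij[of g] isom_zero[of g] by (metis bij_pointE)

lemma isom_uminus: "g \<in> isom \<Longrightarrow> g (- x) = - g x"
  using isom_scale[of g "- 1" x] by simp

lemma isom_diff: "g \<in> isom \<Longrightarrow> g (x - y) = g x - g y"
  using isom_add[of g x "- y"] by (simp add: isom_uminus)

lemma isomI:
  assumes "\<And>x y. g (x + y) = g x + g y" "\<And>c x. g (c *s x) = c *s g x"
    "\<And>x y. s (g x) (g y) = s x y" "\<And>x. g (h x) = x" "\<And>x. h (g x) = x"
  shows "g \<in> isom"
proof -
  have "g \<circ> h = id" "h \<circ> g = id" using assms(4,5) by auto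
  then have "bij g" by (intro o_bij)
  then show ?thesis using assms by (simp add: isom_iff vs_linear_iff vector_space_axioms)
qed

lemma isom_id: "id \<in> isom"
  by (rule isomI[of _ id]) auto

lemma isom_comp: "g \<in> isom \<Longrightarrow> h \<in> isom \<Longrightarrow> g \<circ> h \<in> isom"
  by (auto simp: isom_iff bij_comp vs_linear_iff)

lemma isom_inverse:
  assumes "g \<in> isom" obtains h where "h \<in> isom" "g \<circ> h = id" "h \<circ> g = id"
proof
  let ?h = "inv_into UNIV g"
  have b: "bij g" using assms by (rule isom_bij)
  have gh: "g (?h x) = x" "?h (g x) = x" for x
    using b by (simp_all add: bij_is_surj surj_f_inv_f bij_is_inj)
  then show "g \<circ> ?h = id" "?h \<circ> g = id" by auto
  show "?h \<in> isom"
  proof (rule isomI[of _ g])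
    show "?h (x + y) = ?h x + ?h y" for x y
      using gh isom_add[OF assms, of "?h x" "?h y"] by metis
    show "?h (c *s x) = c *s ?h x" for c x
      using gh isom_scale[OF assms, of c "?h x"] by metis
    show "s (?h x) (?h y) = s x y" for x y
      using gh isom_s[OF assms, of "?h x" "?h y"] by metis
  qed (fact gh)+
qed

lemma group_Sp: "group (Sp (*s) s)"
proof (rule groupI)
  fix x assume "x \<in> isom"
  then obtain h where "h \<in> isom" "h \<circ> x = id" by (rule isom_inverse)
  then show "\<exists>y\<in>isom. y \<otimes>\<^bsub>Sp (*s) s\<^esub> x = \<one>\<^bsub>Sp (*s) s\<^esub>"
    by (auto simp: Sp_def)
qed (use isom_comp isom_id in \<open>auto simp: Sp_def comp_assoc\<close>)

lemma Sp_mult [simp]: "g \<otimes>\<^bsub>Sp (*s) s\<^esub> h = g \<circ> h"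
  and Sp_one [simp]: "\<one>\<^bsub>Sp (*s) s\<^esub> = id"
  by (simp_all add: Sp_def)

section \<open>Transvections and short root elements\<close>

definition tv :: "'v \<Rightarrow> 'a \<Rightarrow> 'v \<Rightarrow> 'v" where
  "tv u c x = x + (c * s x u) *s u"

text \<open>For orthogonal \<open>u\<close>, \<open>v\<close> this is the short root element of the
  pair. No division occurs, so characteristic 2 needs no separate treatment.\<close>

definition tau :: "'v \<Rightarrow> 'v \<Rightarrow> 'v \<Rightarrow> 'v" where
  "tau u v x = x + s x u *s v + s x v *s u"

lemmas vec_simps = scale_left_distrib scale_right_distrib scale_left_diff_distrib
  scale_right_diff_distrib algebra_simps

lemma tv_add: "tv u a \<circ> tv u b = tv u (a + b)"
  by (auto simp: tv_def vec_simps)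

lemma tv_zero [simp]: "tv u 0 = id" "tv 0 c = id"
  by (auto simp: tv_def)

lemma tv_isom: "tv u c \<in> isom"
proof (rule isomI[of _ "tv u (- c)"])
  show "tv u c (tv u (- c) x) = x" "tv u (- c) (tv u c x) = x" for x
    using tv_add[of u c "- c"] tv_add[of u "- c" c] by (simp_all add: fun_eq_iff)
  show "s (tv u c x) (tv u c y) = s x y" for x y
    by (simp add: tv_def s_flip[of u y] algebra_simps)
qed (auto simp: tv_def vec_simps)

text \<open>Exchanging \<open>v\<close> and \<open>v'\<close> inverts the transvection, so the
  commutator is \<open>tv u (2 * s v' v)\<close>: this is the Heisenberg relation with centre the
  transvections along \<open>u\<close>.\<close>

lemma tau_add_right:
  assumes "s u v = 0" "s u v' = 0"
  shows "tau u v \<circ> tau u v' = tau u (v + v') \<circ> tv u (s v' v)"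
  using assms s_zero_flip[OF assms(1)] s_zero_flip[OF assms(2)]
  by (auto simp: tau_def tv_def vec_simps)

lemma tau_sym: "tau u v = tau v u"
  by (auto simp: tau_def algebra_simps)

lemma tau_add_left:
  assumes "s u v = 0" "s u' v = 0"
  shows "tau u v \<circ> tau u' v = tau (u + u') v \<circ> tv v (s u' u)"
  using tau_add_right[of v u u'] assms s_zero_flip by (simp add: tau_sym[of v])

lemma tau_zero [simp]: "tau u 0 = id" "tau 0 u = id"
  by (auto simp: tau_def)

lemma tau_scale: "tau (c *s u) v = tau u (c *s v)"
  by (auto simp: tau_def algebra_simps)

lemma tau_inverse:
  assumes "s u v = 0" shows "tau u v (tau u (- v) x) = x" "tau u (- v) (tau u v x) = x"
  using tau_add_right[of u v "- v"] tau_add_right[of u "- v" v] assms by (simp_all add: fun_eq_iff)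

lemma tau_isom:
  assumes "s u v = 0" shows "tau u v \<in> isom"
proof (rule isomI[of _ "tau u (- v)"])
  show "s (tau u v x) (tau u v y) = s x y" for x y
    using assms s_zero_flip[OF assms]
    by (simp add: tau_def s_flip[of u y] s_flip[of v y] algebra_simps)
qed (use tau_inverse[OF assms] in \<open>auto simp: tau_def vec_simps\<close>)

lemma isom_tv: "g \<in> isom \<Longrightarrow> g \<circ> tv u c = tv (g u) c \<circ> g"
  by (auto simp: tv_def isom_add isom_scale isom_s)

lemma isom_tau: "g \<in> isom \<Longrightarrow> g \<circ> tau u v = tau (g u) (g v) \<circ> g"
  by (auto simp: tau_def isom_add isom_scale isom_s)

section \<open>Orthogonal complements, pointwise stabilisers and their transitivity\<close>

definition perp :: "'v set \<Rightarrow> 'v set" where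
  "perp Z = {x. \<forall>z\<in>Z. s x z = 0}"

definition fixer :: "'v set \<Rightarrow> ('v \<Rightarrow> 'v) set" where
  "fixer Z = {g \<in> isom. \<forall>z\<in>Z. g z = z}"

lemma perp_closed:
  "0 \<in> perp Z" "x \<in> perp Z \<Longrightarrow> y \<in> perp Z \<Longrightarrow> x + y \<in> perp Z"
  "x \<in> perp Z \<Longrightarrow> y \<in> perp Z \<Longrightarrow> x - y \<in> perp Z"
  "x \<in> perp Z \<Longrightarrow> - x \<in> perp Z" "x \<in> perp Z \<Longrightarrow> c *s x \<in> perp Z"
  by (auto simp: perp_def)

lemma fixer_isom: "g \<in> fixer Z \<Longrightarrow> g \<in> isom"
  and fixer_fix: "g \<in> fixer Z \<Longrightarrow> z \<in> Z \<Longrightarrow> g z = z"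
  by (auto simp: fixer_def)

lemma fixer_id: "id \<in> fixer Z"
  by (simp add: fixer_def isom_id)

lemma fixer_comp: "g \<in> fixer Z \<Longrightarrow> h \<in> fixer Z \<Longrightarrow> g \<circ> h \<in> fixer Z"
  by (auto simp: fixer_def isom_comp)

lemma fixer_inverse:
  assumes "g \<in> fixer Z" obtains h where "h \<in> fixer Z" "g \<circ> h = id" "h \<circ> g = id"
proof -
  obtain h where h: "h \<in> isom" "g \<circ> h = id" "h \<circ> g = id"
    using isom_inverse[OF fixer_isom[OF assms]] .
  then have "h z = z" if "z \<in> Z" for z
    using fixer_fix[OF assms that] by (metis comp_apply id_apply)
  then show ?thesis using that h by (auto simp: fixer_def)
qed

lemma fixer_perp:
  assumes "g \<in> fixer Z" "x \<in> perp Z" shows "g x \<in> perp Z"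
proof -
  have "s (g x) z = s x z" if "z \<in> Z" for z
    using isom_s[OF fixer_isom[OF assms(1)], of x z] fixer_fix[OF assms(1) that] by simp
  then show ?thesis using assms(2) by (simp add: perp_def)
qed

lemma perp_flip: "v \<in> perp Z \<Longrightarrow> z \<in> Z \<Longrightarrow> s z v = 0"
  using s_zero_flip by (simp add: perp_def)

lemma tv_fixer: "v \<in> perp Z \<Longrightarrow> tv v c \<in> fixer Z"
  by (simp add: fixer_def tv_isom tv_def perp_flip)

lemma tau_fixer: "u \<in> perp Z \<Longrightarrow> v \<in> perp Z \<Longrightarrow> s u v = 0 \<Longrightarrow> tau u v \<in> fixer Z"
  by (simp add: fixer_def tau_isom tau_def perp_flip)

lemma tv_moves:
  assumes "s x y \<noteq> 0" shows "tv (x - y) (1 / s x y) x = y"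
  using assms by (simp add: tv_def)

text \<open>Non-orthogonal vectors are joined by one transvection along their difference. Orthogonal
  ones are joined through a \<open>z\<close> orthogonal to neither, and one of \<open>a\<close>,
  \<open>b\<close>, \<open>a + b\<close> serves as \<open>z\<close>.\<close>

lemma fixer_transitive:
  assumes nondeg: "\<And>x. x \<in> perp Z \<Longrightarrow> x \<noteq> 0 \<Longrightarrow> \<exists>y\<in>perp Z. s x y \<noteq> 0"
    and x: "x \<in> perp Z" "x \<noteq> 0" and y: "y \<in> perp Z" "y \<noteq> 0"
  shows "\<exists>g\<in>fixer Z. g x = y"
proof -
  have 1: "\<exists>g\<in>fixer Z. g x = y" if "s x y \<noteq> 0" "x \<in> perp Z" "y \<in> perp Z" for x y
    using tv_moves[OF that(1)] tv_fixer[OF perp_closed(3)[OF that(2,3)]] by blast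
  show ?thesis
  proof (cases "s x y = 0")
    case True
    obtain a b where a: "a \<in> perp Z" "s x a \<noteq> 0" and b: "b \<in> perp Z" "s y b \<noteq> 0"
      using nondeg x y by blast
    obtain z where z: "z \<in> perp Z" "s x z \<noteq> 0" "s y z \<noteq> 0"
    proof (cases "s y a = 0 \<and> s x b = 0")
      case True
      then show ?thesis using that[of "a + b"] a b by (simp add: perp_closed)
    next
      case False
      then show ?thesis using that a b by blast
    qed
    obtain g where g: "g \<in> fixer Z" "g x = z" using 1[OF z(2)] x z by blast
    have "s z y \<noteq> 0" using z(3) s_zero_flip by blast
    then obtain h where h: "h \<in> fixer Z" "h z = y" using 1[OF _ z(1) y(1)] by blast
    show ?thesis using g h by (intro bexI[of _ "h \<circ> g"]) (auto intro: fixer_comp)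
  qed (use 1 x y in blast)
qed

text \<open>Once \<open>x\<close> is in place, \<open>y\<close> is moved by a transvection along
  \<open>y - y'\<close>, which fixes \<open>x\<close> because \<open>s x y = s x y'\<close>. If
  \<open>s y y' = 0\<close>, the detour through \<open>y + x\<close> has two non-orthogonal
  steps.\<close>

lemma fixer_transitive_pairs:
  assumes nondeg: "\<And>x. x \<in> perp Z \<Longrightarrow> x \<noteq> 0 \<Longrightarrow> \<exists>y\<in>perp Z. s x y \<noteq> 0"
    and xy: "x \<in> perp Z" "y \<in> perp Z" "x' \<in> perp Z" "y' \<in> perp Z"
    and "s x y \<noteq> 0" "s x' y' = s x y"
  shows "\<exists>g\<in>fixer Z. g x = x' \<and> g y = y'"
proof -
  have 1: "\<exists>g\<in>fixer Z. g x = x \<and> g y = y'"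
    if "x \<in> perp Z" "y \<in> perp Z" "y' \<in> perp Z" "s x y' = s x y" "s y y' \<noteq> 0" for x y y'
  proof (intro bexI[of _ "tv (y - y') (1 / s y y')"] conjI)
    show "tv (y - y') (1 / s y y') y = y'" using tv_moves[OF that(5)] .
    show "tv (y - y') (1 / s y y') x = x" using that(4) by (simp add: tv_def)
    show "tv (y - y') (1 / s y y') \<in> fixer Z" using that by (auto intro: tv_fixer perp_closed)
  qed
  have 2: "\<exists>g\<in>fixer Z. g x = x \<and> g y = y'"
    if a: "x \<in> perp Z" "y \<in> perp Z" "y' \<in> perp Z" "s x y' = s x y" "s x y \<noteq> 0" for x y y'
  proof (cases "s y y' = 0")
    case True
    have "s y (y + x) \<noteq> 0" "s (y + x) y' \<noteq> 0"
      using True a(4,5) s_flip[of y x] by auto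
    then obtain g h where g: "g \<in> fixer Z" "g x = x" "g y = y + x"
      and h: "h \<in> fixer Z" "h x = x" "h (y + x) = y'"
      using 1[of x y "y + x"] 1[of x "y + x" y'] a by (auto simp: perp_closed)
    show ?thesis using g h by (intro bexI[of _ "h \<circ> g"]) (auto intro: fixer_comp)
  qed (use 1 a in blast)
  have "x \<noteq> 0" "x' \<noteq> 0" using assms by auto
  then obtain g where g: "g \<in> fixer Z" "g x = x'" using fixer_transitive[OF nondeg] xy by blast
  have "s x' (g y) = s x y" using isom_s[OF fixer_isom[OF g(1)], of x y] g(2) by simp
  then obtain h where h: "h \<in> fixer Z" "h x' = x'" "h (g y) = y'"
    using 2[of x' "g y" y'] xy g fixer_perp assms(6,7) by auto
  show ?thesis using g h by (intro bexI[of _ "h \<circ> g"]) (auto intro: fixer_comp)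
qed

end

section \<open>Splitting off a hyperbolic plane\<close>

text \<open>\<open>Z0\<close> holds the basis vectors split off before \<open>e\<close>, \<open>f\<close>, so that the space under
  consideration is \<open>perp Z0 = P + W\<close>.\<close>

locale hyperbolic_plane = symplectic_space scale s
  for scale :: "'a::field \<Rightarrow> 'v::ab_group_add \<Rightarrow> 'v" (infixr \<open>*s\<close> 75) and s +
  fixes e f :: 'v and Z0 :: "'v set"
  assumes ef [simp]: "s e f = 1" and e_perp: "e \<in> perp Z0" and f_perp: "f \<in> perp Z0"
    and nondeg: "\<And>x. x \<in> perp (insert e (insert f Z0)) \<Longrightarrow> x \<noteq> 0 \<Longrightarrow>
      \<exists>y\<in>perp (insert e (insert f Z0)). s x y \<noteq> 0"
begin

definition "W = perp (insert e (insert f Z0))"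
text \<open>The double complement, instead of a span, makes \<open>P\<close> an instance of
  \<open>perp\<close>, so the general facts on \<open>fixer\<close> specialise to it;
  \<open>P_eq_span\<close> gives the usual description.\<close>

definition "P = perp (perp {e, f})"
definition "GL = fixer (perp {e, f})"
definition "GR = fixer (insert e (insert f Z0))"
definition proj :: "'v \<Rightarrow> 'v" where "proj x = s x f *s e - s x e *s f"

lemma fe [simp]: "s f e = - 1"
  using s_flip[of f e] by simp

lemmas W_closed = perp_closed[where Z = "insert e (insert f Z0)", folded W_def]
lemmas P_closed = perp_closed[where Z = "perp {e, f}", folded P_def]
lemmas GL_comp = fixer_comp[where Z = "perp {e, f}", folded GL_def]
lemmas GR_comp = fixer_comp[where Z = "insert e (insert f Z0)", folded GR_def]
lemmas GL_inverse = fixer_inverse[where Z = "perp {e, f}", folded GL_def]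
lemmas GR_inverse = fixer_inverse[where Z = "insert e (insert f Z0)", folded GR_def]
lemmas GL_isom = fixer_isom[where Z = "perp {e, f}", folded GL_def]
lemmas GR_isom = fixer_isom[where Z = "insert e (insert f Z0)", folded GR_def]
lemmas GL_P = fixer_perp[where Z = "perp {e, f}", folded GL_def P_def]
lemmas GR_W = fixer_perp[where Z = "insert e (insert f Z0)", folded GR_def W_def]
lemmas tv_GL = tv_fixer[where Z = "perp {e, f}", folded GL_def P_def]
lemmas tv_GR = tv_fixer[where Z = "insert e (insert f Z0)", folded GR_def W_def]
lemmas GL_id = fixer_id[where Z = "perp {e, f}", folded GL_def]
lemmas GR_id = fixer_id[where Z = "insert e (insert f Z0)", folded GR_def]

lemma W_iff: "w \<in> W \<longleftrightarrow> s w e = 0 \<and> s w f = 0 \<and> w \<in> perp Z0"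
  by (auto simp: W_def perp_def)

lemma W_perp_Z0: "w \<in> W \<Longrightarrow> w \<in> perp Z0"
  and W_perp: "w \<in> W \<Longrightarrow> w \<in> perp {e, f}"
  by (auto simp: W_iff perp_def)

lemma W_s [simp]:
  assumes "w \<in> W" shows "s w e = 0" "s w f = 0" "s e w = 0" "s f w = 0"
  using assms s_flip[of e w] s_flip[of f w] by (simp_all add: W_iff)

lemma P_perp:
  assumes "u \<in> P" "w \<in> perp {e, f}" shows "s u w = 0"
  using assms unfolding P_def perp_def[of "perp {e, f}"] by blast

lemma P_W [simp]:
  assumes "u \<in> P" "w \<in> W" shows "s u w = 0" "s w u = 0"
  using P_perp[OF assms(1) W_perp[OF assms(2)]] s_flip[of w u] by simp_all

lemma P_ef [simp]: "e \<in> P" "f \<in> P"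
  unfolding P_def perp_def[of "perp {e, f}"] using perp_flip[of _ "{e, f}"] by blast+

lemma proj_P [simp]: "proj x \<in> P"
  by (simp add: proj_def P_closed)

lemma proj_perp: "x - proj x \<in> perp {e, f}"
  by (simp add: perp_def proj_def)

text \<open>The vector \<open>u - proj u\<close> lies in \<open>P\<close> and is also orthogonal to
  \<open>e\<close> and \<open>f\<close>, so it is orthogonal to both parts \<open>proj y\<close> and
  \<open>y - proj y\<close> of every \<open>y\<close>.\<close>

lemma proj_of_P:
  assumes "u \<in> P" shows "proj u = u"
proof (rule ccontr)
  assume "proj u \<noteq> u"
  then have "u - proj u \<noteq> 0" by simp
  then obtain y where y: "s (u - proj u) y \<noteq> 0" using s_nondeg by blast
  have "u - proj u \<in> P" using P_closed(3)[OF assms proj_P] .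
  then have "s (u - proj u) (y - proj y) = 0"
    using proj_perp[of y] by (rule P_perp)
  moreover have "s (u - proj u) (proj y) = 0"
    by (simp add: proj_def)
  ultimately show False using y by simp
qed

lemma P_cases:
  assumes "u \<in> P" obtains a b where "u = a *s e + b *s f"
proof (rule that)
  have "u = proj u" by (rule proj_of_P[OF assms, symmetric])
  also have "\<dots> = s u f *s e + (- s u e) *s f" by (simp add: proj_def)
  finally show "u = s u f *s e + (- s u e) *s f" .
qed

lemma P_W_zero: "w \<in> P \<Longrightarrow> w \<in> W \<Longrightarrow> w = 0"
  using proj_of_P[of w] by (simp add: proj_def)

lemma Z0_proj_W:
  assumes "x \<in> perp Z0" shows "x - proj x \<in> W"
proof -
  have "s (x - proj x) z = 0" if "z \<in> Z0" for z
    using assms that e_perp f_perp by (simp add: perp_def proj_def)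
  then have "x - proj x \<in> perp Z0" by (simp add: perp_def)
  then show ?thesis unfolding W_iff by (simp add: proj_def)
qed

lemma e_nonzero [simp]: "e \<noteq> 0" "f \<noteq> 0"
  using ef by (metis s_zero(1) zero_neq_one, metis ef s_zero(2) zero_neq_one)

lemma GL_W: "g \<in> GL \<Longrightarrow> w \<in> W \<Longrightarrow> g w = w"
  using W_perp[of w] by (auto simp: GL_def fixer_def)

lemma GL_perp: "g \<in> GL \<Longrightarrow> w \<in> perp {e, f} \<Longrightarrow> g w = w"
  by (auto simp: GL_def fixer_def)

lemma GR_P:
  assumes "h \<in> GR" "u \<in> P" shows "h u = u"
proof -
  obtain a b where "u = a *s e + b *s f" using P_cases[OF assms(2)] .
  moreover have "h e = e" "h f = f" using assms(1) by (auto simp: GR_def fixer_def)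
  ultimately show ?thesis using GR_isom[OF assms(1)] by (simp add: isom_add isom_scale)
qed

lemma Z0_GL: "GL \<subseteq> fixer Z0"
proof
  fix g assume g: "g \<in> GL"
  have "Z0 \<subseteq> perp {e, f}" using perp_flip[OF e_perp] perp_flip[OF f_perp] by (auto simp: perp_def)
  then show "g \<in> fixer Z0" using g by (auto simp: GL_def fixer_def)
qed

lemma Z0_GR: "GR \<subseteq> fixer Z0"
  by (auto simp: GR_def fixer_def)

lemma GL_eqI:
  assumes "g \<in> GL" "h \<in> GL" "g e = h e" "g f = h f" shows "g = h"
proof
  fix x
  have "k x = s x f *s k e - s x e *s k f + (x - proj x)" if "k \<in> GL" for k
  proof -
    have "k x = k (proj x) + (x - proj x)"
      using isom_add[OF GL_isom[OF that], of "proj x" "x - proj x"] GL_perp[OF that proj_perp[of x]]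
      by simp
    then show ?thesis using GL_isom[OF that] by (simp add: isom_diff isom_scale proj_def)
  qed
  from this[OF assms(1)] this[OF assms(2)] show "g x = h x" using assms by simp
qed

lemma GL_stab:
  assumes "g \<in> GL" "g e = e" shows "\<exists>c. g = tv e c"
proof -
  obtain a b where ab: "g f = a *s e + b *s f" using P_cases GL_P[OF assms(1)] by (metis P_ef(2))
  have "s e (g f) = 1" using isom_s[OF GL_isom[OF assms(1)], of e f] assms(2) by simp
  then have "b = 1" by (simp add: ab)
  then have "g = tv e (- a)"
    using assms ab by (intro GL_eqI tv_GL) (auto simp: tv_def)
  then show ?thesis ..
qed

text \<open>The data \<open>w\<close> and \<open>c\<close> are read off from \<open>g f\<close> so
  that \<open>tau e w \<circ> tv e c\<close> agrees with \<open>g\<close> at \<open>e\<close> and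
  \<open>f\<close>; what remains fixes \<open>e\<close>, \<open>f\<close> and
  \<open>Z0\<close>.\<close>

lemma stab_decomp:
  assumes g: "g \<in> fixer Z0" "g e = e"
  shows "\<exists>w\<in>W. \<exists>c. \<exists>h\<in>GR. g = tau e w \<circ> tv e c \<circ> h"
proof -
  define w where "w = - (g f - proj (g f))"
  define c where "c = - s (g f) f"
  have gf: "g f \<in> perp Z0" using fixer_perp[OF g(1) f_perp] .
  have w: "w \<in> W" unfolding w_def by (intro W_closed(4) Z0_proj_W gf)
  have "s e (g f) = 1" using isom_s[OF fixer_isom[OF g(1)], of e f] g(2) by simp
  then have "s (g f) e = - 1" using s_flip[of "g f" e] by simp
  then have gf_eq: "g f = f - w - c *s e" by (simp add: w_def c_def proj_def)
  let ?k = "tau e w \<circ> tv e c"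
  have k: "?k \<in> fixer Z0"
    using w e_perp by (intro fixer_comp tau_fixer tv_fixer) (auto intro: W_perp_Z0)
  have ke: "?k e = e" "?k f = g f"
    using w by (simp_all add: tau_def tv_def gf_eq algebra_simps)
  obtain k' where k': "k' \<in> fixer Z0" "?k \<circ> k' = id" "k' \<circ> ?k = id"
    using fixer_inverse[OF k] .
  have k'k: "k' (?k x) = x" for x using k'(3) by (metis comp_apply id_apply)
  have "k' (g e) = e" "k' (g f) = f"
    using k'k[of e] k'k[of f] unfolding ke using g(2) by simp_all
  then have "k' \<circ> g \<in> GR"
    using fixer_comp[OF k'(1) g(1)] by (auto simp: GR_def fixer_def)
  moreover have "g = ?k \<circ> (k' \<circ> g)" using k'(2) by (simp add: comp_assoc[symmetric])
  ultimately show ?thesis using w by blast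
qed

lemma GL_transitive:
  assumes "u \<in> P" "u \<noteq> 0" shows "\<exists>l\<in>GL. l e = u"
proof -
  have "\<exists>y\<in>P. s x y \<noteq> 0" if "x \<in> P" "x \<noteq> 0" for x
    using proj_of_P[OF that(1)] that(2) P_ef unfolding proj_def
    by (metis diff_self scale_zero_left)
  then show ?thesis
    using fixer_transitive[of "perp {e, f}" e u] assms by (simp add: P_def[symmetric] GL_def)
qed

lemma GR_transitive:
  assumes "x \<in> W" "x \<noteq> 0" "y \<in> W" "y \<noteq> 0" shows "\<exists>r\<in>GR. r x = y"
  using fixer_transitive[OF nondeg] assms by (simp add: W_def GR_def)

lemma GR_transitive_pairs:
  assumes "x \<in> W" "y \<in> W" "x' \<in> W" "y' \<in> W" "s x y \<noteq> 0" "s x' y' = s x y"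
  shows "\<exists>r\<in>GR. r x = x' \<and> r y = y'"
  using fixer_transitive_pairs[OF nondeg] assms by (simp add: W_def GR_def)

lemma GL_diag:
  assumes "c \<noteq> 0" obtains l where "l \<in> GL" "l e = c *s e" "l f = (1 / c) *s f"
proof -
  obtain l where l: "l \<in> GL" "l e = c *s e"
    using GL_transitive[of "c *s e"] assms by (auto simp: P_closed scale_eq_0_iff)
  obtain a b where ab: "l f = a *s e + b *s f" using P_cases GL_P[OF l(1)] by (metis P_ef(2))
  have "s (l e) (l f) = 1" using isom_s[OF GL_isom[OF l(1)], of e f] by simp
  then have b: "b = 1 / c" using assms by (simp add: ab l field_simps)
  let ?k = "tv (l e) (a / c)"
  have "?k \<circ> l \<in> GL" using l P_closed by (intro GL_comp tv_GL) auto
  moreover have "(?k \<circ> l) e = c *s e" by (simp add: tv_def l(2))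
  moreover have "(?k \<circ> l) f = (1 / c) *s f"
    using assms by (simp add: tv_def l(2) ab b scale_right_distrib field_simps)
  ultimately show ?thesis using that by blast
qed

text \<open>This is the generation of \<open>SL_2\<close> by two opposite groups of
  transvections.\<close>

lemma GL_induct:
  assumes g: "g \<in> GL" and comp: "\<And>g h. g \<in> GL \<Longrightarrow> h \<in> GL \<Longrightarrow> K g \<Longrightarrow> K h \<Longrightarrow> K (g \<circ> h)"
    and e: "\<And>c. K (tv e c)" and f: "\<And>c. K (tv f c)"
  shows "K g"
proof -
  have tvs: "tv e c \<in> GL" "tv f c \<in> GL" for c by (simp_all add: tv_GL)
  have main: "K g" if g: "g \<in> GL" "g e = a *s e + b *s f" "b \<noteq> 0" for g a b
  proof -
    \<comment> \<open>\<open>tv f b\<close> sends \<open>e\<close> to \<open>e + b f\<close>, and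
      the second transvection then changes the coefficient of \<open>e\<close> from 1 to
      \<open>a\<close>.\<close>
    define k where "k = tv e ((1 - a) / b) \<circ> tv f b"
    have k: "k \<in> GL" "K k" unfolding k_def by (auto intro: GL_comp tvs comp e f)
    have ke: "k e = g e" using g(3)
      by (simp add: k_def tv_def g(2) scale_left_diff_distrib algebra_simps diff_divide_distrib)
    obtain k' where k': "k' \<in> GL" "k \<circ> k' = id" "k' \<circ> k = id" using GL_inverse[OF k(1)] .
    have "(k' \<circ> g) e = e" using k'(3) ke by (metis comp_apply id_apply)
    then obtain c where "k' \<circ> g = tv e c" using GL_stab GL_comp k'(1) g(1) by blast
    then have "g = k \<circ> tv e c" using k'(2) by (metis comp_assoc id_comp)
    then show ?thesis using comp[OF k(1) tvs(1) k(2) e] by simp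
  qed
  obtain a b where ab: "g e = a *s e + b *s f" using P_cases GL_P[OF g] by (metis P_ef(1))
  show ?thesis
  proof (cases "b = 0")
    case True
    then have "a \<noteq> 0" using ab isom_eq_zero[OF GL_isom[OF g], of e] by auto
    \<comment> \<open>Multiplying by \<open>tv f 1\<close> creates a nonzero coefficient of
      \<open>f\<close>, so the generic case applies.\<close>
    have "(tv f 1 \<circ> g) e = a *s e + a *s f" using ab True by (simp add: tv_def)
    then have "K (tv f 1 \<circ> g)"
      by (intro main[of "tv f 1 \<circ> g" a a] GL_comp tvs g \<open>a \<noteq> 0\<close>)
    then have "K (tv f (- 1) \<circ> (tv f 1 \<circ> g))" using comp f tvs GL_comp g by blast
    then show ?thesis by (simp add: comp_assoc[symmetric] tv_add)
  qed (use main ab g in blast)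
qed

end

section \<open>The local relations force faithfulness\<close>

text \<open>\<open>L\<close> and \<open>R\<close> are kept apart because they may have different
  origins: in the slim case \<open>L\<close> is the amalgam map itself, while \<open>R\<close> is an
  inverse of \<open>\<pi>\<close> provided by the induction.\<close>

locale split_rep = hyperbolic_plane scale s e f Z0
  for scale :: "'a::field \<Rightarrow> 'v::ab_group_add \<Rightarrow> 'v" (infixr \<open>*s\<close> 75) and s and e f :: 'v and Z0 +
  fixes \<pi> :: "'u::group_add \<Rightarrow> 'v \<Rightarrow> 'v"
    and e2 f2 :: 'v and L R :: "('v \<Rightarrow> 'v) \<Rightarrow> 'u"
  assumes pi_add: "\<pi> (a + b) = \<pi> a \<circ> \<pi> b" and pi_zero: "\<pi> 0 = id"
    and e2: "e2 \<in> W" and f2: "f2 \<in> W" and e2f2: "s e2 f2 = 1"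
    and L_comp: "g \<in> GL \<Longrightarrow> h \<in> GL \<Longrightarrow> L (g \<circ> h) = L g + L h"
    and R_comp: "g \<in> GR \<Longrightarrow> h \<in> GR \<Longrightarrow> R (g \<circ> h) = R g + R h"
    and pi_L: "g \<in> GL \<Longrightarrow> \<pi> (L g) = g" and pi_R: "g \<in> GR \<Longrightarrow> \<pi> (R g) = g"
    and L_R: "g \<in> GL \<Longrightarrow> h \<in> GR \<Longrightarrow> L g + R h = R h + L g"
begin

lemma L_id [simp]: "L id = 0"
  using L_comp[OF GL_id GL_id] by (metis add.right_neutral add_left_cancel comp_id)

lemma R_id [simp]: "R id = 0"
  using R_comp[OF GR_id GR_id] by (metis add.right_neutral add_left_cancel comp_id)

lemma Le: "tv e c \<in> GL" "tv f c \<in> GL"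
  by (simp_all add: tv_GL)

lemma pi_uminus: "\<pi> a \<circ> \<pi> (- a) = id" "\<pi> (- a) \<circ> \<pi> a = id"
  using pi_add[of a "- a"] pi_add[of "- a" a] by (simp_all add: pi_zero)

end

locale heisenberg_system = split_rep scale s e f Z0 \<pi> e2 f2 L R
  for scale :: "'a::field \<Rightarrow> 'v::ab_group_add \<Rightarrow> 'v" (infixr \<open>*s\<close> 75) and s and e f :: 'v and Z0
    and \<pi> :: "'u::group_add \<Rightarrow> 'v \<Rightarrow> 'v" and e2 f2 :: 'v and L R :: "('v \<Rightarrow> 'v) \<Rightarrow> 'u" +
  fixes T :: "'v \<Rightarrow> 'v \<Rightarrow> 'u"
  assumes pi_T: "u \<in> P \<Longrightarrow> v \<in> W \<Longrightarrow> \<pi> (T u v) = tau u v"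
    and L_T: "g \<in> GL \<Longrightarrow> u \<in> P \<Longrightarrow> v \<in> W \<Longrightarrow> L g + T u v = T (g u) v + L g"
    and R_T: "h \<in> GR \<Longrightarrow> u \<in> P \<Longrightarrow> v \<in> W \<Longrightarrow> R h + T u v = T u (h v) + R h"
    and T_scale: "u \<in> P \<Longrightarrow> v \<in> W \<Longrightarrow> T (c *s u) v = T u (c *s v)"
    and T_right: "u \<in> P \<Longrightarrow> v \<in> W \<Longrightarrow> v' \<in> W \<Longrightarrow>
      T u v + T u v' = T u (v + v') + L (tv u (s v' v))"
    and T_left: "u \<in> P \<Longrightarrow> u' \<in> P \<Longrightarrow> v \<in> W \<Longrightarrow>
      T u v + T u' v = T (u + u') v + R (tv v (s u' u))"
begin

lemma T_zero [simp]: "u \<in> P \<Longrightarrow> T u 0 = 0"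
  using T_right[of u 0 0] W_closed(1) add_left_cancel[of "T u 0" "T u 0" 0] by simp

section \<open>The subgroup \<open>Q\<close> and the calculus of its cosets\<close>

definition Q :: "'u set" where
  "Q = {T e w + (L (tv e c) + R h) | w c h. w \<in> W \<and> h \<in> GR}"

lemma Q_T: "w \<in> W \<Longrightarrow> T e w \<in> Q"
  unfolding Q_def using GR_id by (intro CollectI exI[of _ w] exI[of _ 0] exI[of _ id]) simp

lemma Q_L: "L (tv e c) \<in> Q"
  unfolding Q_def using GR_id W_closed
  by (intro CollectI exI[of _ 0] exI[of _ c] exI[of _ id]) simp

lemma Q_R: "h \<in> GR \<Longrightarrow> R h \<in> Q"
  unfolding Q_def using W_closed
  by (intro CollectI exI[of _ 0] exI[of _ 0] exI[of _ h]) simp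

lemma Q_zero: "0 \<in> Q"
  using Q_R[OF GR_id] by simp

lemma Le_T: "w \<in> W \<Longrightarrow> L (tv e c) + T e w = T e w + L (tv e c)"
  using L_T[OF Le(1), of e w c] by (simp add: tv_def)

lemma Lf_T: "w \<in> W \<Longrightarrow> L (tv f c) + T f w = T f w + L (tv f c)"
  using L_T[OF Le(2), of f w c] by (simp add: tv_def)

lemma Q_add:
  assumes "a \<in> Q" "b \<in> Q" shows "a + b \<in> Q"
proof -
  obtain w c h where a: "a = T e w + (L (tv e c) + R h)" "w \<in> W" "h \<in> GR"
    using assms(1) unfolding Q_def by blast
  obtain w' c' h' where b: "b = T e w' + (L (tv e c') + R h')" "w' \<in> W" "h' \<in> GR"
    using assms(2) unfolding Q_def by blast
  have hw: "h w' \<in> W" using GR_W a b by blast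
  have "a + b = T e w + (L (tv e c) + (R h + T e w') + (L (tv e c') + R h'))"
    unfolding a b by (simp add: add.assoc)
  also have "R h + T e w' = T e (h w') + R h" using R_T a b by simp
  also have "T e w + (L (tv e c) + (T e (h w') + R h) + (L (tv e c') + R h'))
      = T e w + ((L (tv e c) + T e (h w')) + (R h + L (tv e c') + R h'))"
    by (simp add: add.assoc)
  also have "L (tv e c) + T e (h w') = T e (h w') + L (tv e c)" using Le_T hw by simp
  also have "R h + L (tv e c') = L (tv e c') + R h" using L_R[OF Le(1) a(3)] by simp
  also have "T e w + (T e (h w') + L (tv e c) + (L (tv e c') + R h + R h'))
      = (T e w + T e (h w')) + (L (tv e c) + L (tv e c') + (R h + R h'))"
    by (simp add: add.assoc)
  also have "T e w + T e (h w') = T e (w + h w') + L (tv e (s (h w') w))"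
    using T_right a hw by simp
  also have "R h + R h' = R (h \<circ> h')" using R_comp a b by simp
  also have "T e (w + h w') + L (tv e (s (h w') w)) + (L (tv e c) + L (tv e c') + R (h \<circ> h'))
      = T e (w + h w') + ((L (tv e (s (h w') w)) + L (tv e c) + L (tv e c')) + R (h \<circ> h'))"
    by (simp add: add.assoc)
  also have "L (tv e (s (h w') w)) + L (tv e c) + L (tv e c') = L (tv e (s (h w') w + c + c'))"
    using Le by (simp add: L_comp[symmetric] tv_add)
  finally show ?thesis unfolding Q_def using W_closed(2)[OF a(2) hw] GR_comp[OF a(3) b(3)]
    by (intro CollectI exI conjI)
qed

text \<open>Inclusion in a left coset of \<open>Q\<close>. Only closure of \<open>Q\<close> under
  addition has been established, so the relation is used as a preorder and some facts are stated in
  both directions, as \<open>Le_Tf\<close> and \<open>Tf_Le\<close>.\<close>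

definition sim :: "'u \<Rightarrow> 'u \<Rightarrow> bool" (infix \<open>\<approx>\<close> 50) where
  "a \<approx> b \<longleftrightarrow> (\<exists>q\<in>Q. a = b + q)"

lemma sim_refl [simp]: "a \<approx> a"
  unfolding sim_def using Q_zero by (intro bexI[of _ 0]) auto

lemma sim_trans [trans]: "a \<approx> b \<Longrightarrow> b \<approx> c \<Longrightarrow> a \<approx> c"
proof -
  assume "a \<approx> b" "b \<approx> c"
  then obtain q q' where "q \<in> Q" "q' \<in> Q" "a = c + (q' + q)"
    unfolding sim_def by (auto simp: add.assoc)
  then show ?thesis unfolding sim_def using Q_add by blast
qed

lemma sim_left: "a \<approx> b \<Longrightarrow> c + a \<approx> c + b"
  unfolding sim_def by (auto simp: add.assoc)

lemma sim_Q: "q \<in> Q \<Longrightarrow> a + q \<approx> a"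
  unfolding sim_def by auto

text \<open>Conjugation by \<open>tv e c\<close> replaces \<open>f\<close> by
  \<open>f - c e\<close>, and \<open>T_left\<close> splits the result into \<open>T f w\<close>
  followed by terms of \<open>Q\<close>.\<close>

lemma Le_Tf:
  assumes w: "w \<in> W" shows "L (tv e c) + T f w \<approx> T f w"
proof -
  have "L (tv e c) + T f w = T (f + (- c) *s e) w + L (tv e c)"
    using L_T[OF Le(1), of f w c] w by (simp add: tv_def)
  moreover have "T f w + T ((- c) *s e) w = T (f + (- c) *s e) w + R (tv w (- c))"
    using T_left[of f "(- c) *s e" w] w by (simp add: P_closed)
  then have "T (f + (- c) *s e) w = T f w + T ((- c) *s e) w + R (tv w c)"
    using R_comp[of "tv w (- c)" "tv w c"] w by (simp add: tv_GR tv_add add.assoc)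
  moreover have "T ((- c) *s e) w = T e ((- c) *s w)" using T_scale w P_ef(1) by blast
  ultimately have "L (tv e c) + T f w = T f w + (T e ((- c) *s w) + R (tv w c) + L (tv e c))"
    by (simp add: add.assoc)
  then show ?thesis
    using w by (simp only:) (intro sim_Q Q_add Q_T Q_R Q_L tv_GR W_closed)
qed

lemma Tf_Le:
  assumes w: "w \<in> W" shows "T f w \<approx> L (tv e c) + T f w"
  using sim_left[OF Le_Tf[OF w, of "- c"], of "L (tv e c)"] Le
  by (simp add: add.assoc[symmetric] L_comp[symmetric] tv_add)

text \<open>Expand \<open>T e (w + d) + T f (w + d)\<close> in two ways: by \<open>T_right\<close>
  in each summand, or first through \<open>T (e + f) (w + d)\<close>. After cancellation the
  commutator is left as a value of \<open>R\<close>.\<close>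

lemma T_T_commutator:
  assumes d: "d \<in> W" and w: "w \<in> W" and dw: "s d w = 0"
  shows "\<exists>h\<in>GR. T e d + T f w = T f w + T e d + R h"
proof -
  have wd: "s w d = 0" using dw s_zero_flip by blast
  have sum: "w + d \<in> W" using W_closed d w by blast
  have P: "e + f \<in> P" using P_closed by simp
  \<comment> \<open>\<open>k\<close> is \<open>s f e\<close>, the coefficient that
    \<open>T_left\<close> produces for the pair \<open>e\<close>, \<open>f\<close>.\<close>
  define k where "k = (- 1 :: 'a)"
  have 1: "T e (w + d) = T e w + T e d" "T f (w + d) = T f w + T f d"
    "T (e + f) (w + d) = T (e + f) w + T (e + f) d"
    using T_right[of e w d] T_right[of f w d] T_right[of "e + f" w d] d w dw P by simp_all
  have 2: "T (e + f) x = T e x + T f x + R (tv x (- k))" if "x \<in> W" for x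
    using T_left[of e f x] that R_comp[of "tv x k" "tv x (- k)"]
    by (simp add: k_def tv_GR tv_add add.assoc)
  have fix1: "R (tv w c) + T u d = T u d + R (tv w c)" if "u \<in> P" for u c
    using R_T[of "tv w c" u d] that d w dw by (simp add: tv_GR tv_def)
  have fix2: "R h + T f d = T f d + R h" if "h \<in> GR" "h d = d" for h
    using R_T[of h f d] that d by simp
  \<comment> \<open>\<open>X\<close> collects all the corrections. It fixes \<open>d\<close>, so
    \<open>R X\<close> passes \<open>T f d\<close>, which then cancels on the right.\<close>
  define X where "X = tv w (- k) \<circ> (tv d (- k) \<circ> tv (w + d) k)"
  have X: "X \<in> GR" "X d = d" using d w sum dw wd
    by (auto simp: X_def tv_def intro!: GR_comp tv_GR)
  have RX: "R X = R (tv w (- k)) + (R (tv d (- k)) + R (tv (w + d) k))"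
    using d w sum by (simp add: X_def R_comp tv_GR GR_comp)
  have "T e (w + d) + T f (w + d) = T (e + f) (w + d) + R (tv (w + d) k)"
    using T_left[of e f "w + d"] sum by (simp add: k_def)
  then have "T e w + (T e d + T f w + T f d) =
      T e w + (T f w + (R (tv w (- k)) + T e d) + T f d + (R (tv d (- k)) + R (tv (w + d) k)))"
    unfolding 1 2[OF d] 2[OF w] by (simp add: add.assoc)
  also have "R (tv w (- k)) + T e d = T e d + R (tv w (- k))" using fix1 by simp
  also have "T f w + (T e d + R (tv w (- k))) + T f d = T f w + T e d + (R (tv w (- k)) + T f d)"
    by (simp add: add.assoc)
  also have "R (tv w (- k)) + T f d = T f d + R (tv w (- k))" using fix1 by simp
  also have "T e w + (T f w + T e d + (T f d + R (tv w (- k))) + (R (tv d (- k)) + R (tv (w + d) k)))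
     = T e w + (T f w + T e d + (T f d + R X))" by (simp add: RX add.assoc)
  also have "T f d + R X = R X + T f d" using fix2 X by simp
  finally have "T e d + T f w + T f d = T f w + T e d + R X + T f d"
    by (simp add: add.assoc)
  then show ?thesis using X by auto
qed

lemma Te_Tf:
  assumes "d \<in> W" "w \<in> W" "s d w = 0" shows "T e d + T f w \<approx> T f w"
proof -
  obtain h where "h \<in> GR" "T e d + T f w = T f w + T e d + R h"
    using T_T_commutator[OF assms] by blast
  then show ?thesis using sim_Q[OF Q_add[OF Q_T Q_R], of d h "T f w"] assms by (simp add: add.assoc)
qed

text \<open>Its image sends \<open>e\<close> to \<open>e2\<close>: first \<open>tau f e2\<close>
  takes \<open>e\<close> to \<open>e + e2\<close>, then \<open>tau e (- f2)\<close> fixes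
  \<open>e\<close> and takes \<open>e2\<close> to \<open>e2 - e\<close>.\<close>

definition N :: 'u where "N = T e (- f2) + T f e2"

text \<open>Conjugation by \<open>N\<close> carries the transvections along \<open>f\<close> into \<open>R\<close>; this is why the
  coset of \<open>N\<close>, which stands for the vector \<open>e2\<close>, is fixed by \<open>L\<close>.\<close>

lemma Lf_N: "L (tv f c) + N = N + R (tv (- f2) c)"
proof -
  define b where "b = - f2"
  have b: "b \<in> W" "c *s b \<in> W" using f2 W_closed by (auto simp: b_def)
  have eb: "s e2 b = - 1" using e2f2 by (simp add: b_def)
  have ecb: "e2 - c *s b \<in> W" using W_closed e2 b by blast
  have R: "tv b k \<in> GR" for k using tv_GR b by blast
  have "L (tv f c) + T e b = T (e + c *s f) b + L (tv f c)"
    using L_T[OF Le(2), of e b c] b by (simp add: tv_def)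
  moreover have "T e b + T f (c *s b) = T (e + c *s f) b + R (tv b (- c))"
    using T_left[of e "c *s f" b] T_scale[of f b c] b by (simp add: P_closed)
  then have "T (e + c *s f) b = T e b + T f (c *s b) + R (tv b c)"
    using R_comp[of "tv b (- c)" "tv b c"] R by (simp add: tv_add add.assoc)
  ultimately have 1: "L (tv f c) + T e b = T e b + T f (c *s b) + R (tv b c) + L (tv f c)"
    by simp
  have "L (tv f c) + N = (L (tv f c) + T e b) + T f e2"
    by (simp add: N_def b_def add.assoc)
  also have "\<dots> = T e b + T f (c *s b) + R (tv b c) + (L (tv f c) + T f e2)"
    unfolding 1 by (simp add: add.assoc)
  also have "L (tv f c) + T f e2 = T f e2 + L (tv f c)" using Lf_T e2 by simp
  also have "T e b + T f (c *s b) + R (tv b c) + (T f e2 + L (tv f c))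
     = T e b + T f (c *s b) + (R (tv b c) + T f e2) + L (tv f c)" by (simp add: add.assoc)
  also have "R (tv b c) + T f e2 = T f (e2 - c *s b) + R (tv b c)"
    using R_T[OF R, of f e2 c] e2 by (simp add: tv_def eb)
  also have "T e b + T f (c *s b) + (T f (e2 - c *s b) + R (tv b c)) + L (tv f c)
     = T e b + (T f (c *s b) + T f (e2 - c *s b)) + R (tv b c) + L (tv f c)" by (simp add: add.assoc)
  also have "T f (c *s b) + T f (e2 - c *s b) = T f e2 + L (tv f (- c))"
    using T_right[of f "c *s b" "e2 - c *s b"] b ecb eb by simp
  also have "T e b + (T f e2 + L (tv f (- c))) + R (tv b c) + L (tv f c)
     = T e b + T f e2 + L (tv f (- c)) + (R (tv b c) + L (tv f c))" by (simp add: add.assoc)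
  also have "R (tv b c) + L (tv f c) = L (tv f c) + R (tv b c)"
    using L_R[OF Le(2) R] by simp
  also have "T e b + T f e2 + L (tv f (- c)) + (L (tv f c) + R (tv b c))
     = T e b + T f e2 + (L (tv f (- c)) + L (tv f c)) + R (tv b c)" by (simp add: add.assoc)
  also have "L (tv f (- c)) + L (tv f c) = 0"
    using L_comp[OF Le(2) Le(2), of "- c" c] by (simp add: tv_add)
  finally show ?thesis by (simp add: N_def b_def)
qed

lemma L_N:
  assumes "g \<in> GL" shows "L g + N \<approx> N"
  using assms
proof (rule GL_induct[where K = "\<lambda>g. L g + N \<approx> N"])
  fix g h assume 1: "g \<in> GL" "h \<in> GL" "L g + N \<approx> N" "L h + N \<approx> N"
  have "L (g \<circ> h) + N = L g + (L h + N)" using 1 by (simp add: L_comp add.assoc)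
  also have "\<dots> \<approx> L g + N" using 1 by (intro sim_left)
  also have "\<dots> \<approx> N" using 1 by simp
  finally show "L (g \<circ> h) + N \<approx> N" .
next
  fix c
  have "L (tv e c) + N = T e (- f2) + (L (tv e c) + T f e2)"
    unfolding N_def using Le_T[OF W_closed(4)[OF f2], of c] by (simp only: add.assoc[symmetric])
  also have "\<dots> \<approx> T e (- f2) + T f e2" using e2 by (intro sim_left Le_Tf)
  finally show "L (tv e c) + N \<approx> N" by (simp add: N_def)
next
  fix c
  show "L (tv f c) + N \<approx> N" unfolding Lf_N using f2 W_closed by (intro sim_Q Q_R tv_GR)
qed

lemma N_L:
  assumes "g \<in> GL" shows "N \<approx> L g + N"
proof -
  obtain h where h: "h \<in> GL" "g \<circ> h = id" using GL_inverse[OF assms] by blast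
  have "N = L g + (L h + N)" using L_comp[OF assms h(1)] h(2) by (simp add: add.assoc[symmetric])
  also have "\<dots> \<approx> L g + N" using L_N h by (intro sim_left)
  finally show ?thesis .
qed

text \<open>The two families of cosets stand for the vectors \<open>l e + w\<close> and \<open>r e2\<close>, the images of
  \<open>e\<close> under their elements; together these are all nonzero vectors of \<open>P + W\<close>.\<close>

definition covered :: "'u \<Rightarrow> bool" where
  "covered a \<longleftrightarrow> (\<exists>l\<in>GL. \<exists>w\<in>W. a \<approx> L l + T f w) \<or> (\<exists>r\<in>GR. a \<approx> R r + N)"

lemma covered_sim: "a \<approx> b \<Longrightarrow> covered b \<Longrightarrow> covered a"
  unfolding covered_def using sim_trans by blast

lemma covered_L:
  assumes g: "g \<in> GL" and a: "covered a" shows "covered (L g + a)"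
  using a unfolding covered_def
proof (elim disjE bexE)
  fix l w assume lw: "l \<in> GL" "w \<in> W" "a \<approx> L l + T f w"
  have "L g + a \<approx> L (g \<circ> l) + T f w"
    using sim_left[OF lw(3), of "L g"] g lw by (simp add: L_comp add.assoc)
  then show "(\<exists>l\<in>GL. \<exists>w\<in>W. L g + a \<approx> L l + T f w) \<or> (\<exists>r\<in>GR. L g + a \<approx> R r + N)"
    using GL_comp g lw by blast
next
  fix r assume r: "r \<in> GR" "a \<approx> R r + N"
  have "L g + a \<approx> L g + (R r + N)" using r by (intro sim_left)
  also have "\<dots> = R r + (L g + N)" using L_R g r by (metis add.assoc)
  also have "\<dots> \<approx> R r + N" using L_N g by (intro sim_left)
  finally show "(\<exists>l\<in>GL. \<exists>w\<in>W. L g + a \<approx> L l + T f w) \<or> (\<exists>r\<in>GR. L g + a \<approx> R r + N)"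
    using r by blast
qed

lemma covered_R:
  assumes h: "h \<in> GR" and a: "covered a" shows "covered (R h + a)"
  using a unfolding covered_def
proof (elim disjE bexE)
  fix l w assume lw: "l \<in> GL" "w \<in> W" "a \<approx> L l + T f w"
  have "R h + a \<approx> R h + (L l + T f w)" using lw by (intro sim_left)
  also have "\<dots> = L l + (R h + T f w)" using L_R[OF lw(1) h] by (metis add.assoc)
  also have "\<dots> = L l + T f (h w) + R h" using R_T h lw by (simp add: add.assoc)
  also have "\<dots> \<approx> L l + T f (h w)" using Q_R h by (intro sim_Q)
  finally show "(\<exists>l\<in>GL. \<exists>w\<in>W. R h + a \<approx> L l + T f w) \<or> (\<exists>r\<in>GR. R h + a \<approx> R r + N)"
    using GR_W h lw by blast
next
  fix r assume r: "r \<in> GR" "a \<approx> R r + N"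
  have "R h + a \<approx> R (h \<circ> r) + N"
    using sim_left[OF r(2), of "R h"] h r by (simp add: R_comp add.assoc)
  then show "(\<exists>l\<in>GL. \<exists>w\<in>W. R h + a \<approx> L l + T f w) \<or> (\<exists>r\<in>GR. R h + a \<approx> R r + N)"
    using GR_comp h r by blast
qed

lemma Te_Te_sim:
  assumes "d \<in> W" "d' \<in> W" "x \<in> W"
  shows "T e d + (T e d' + T f x) \<approx> T e (d + d') + T f x"
proof -
  have "T e d + (T e d' + T f x) = T e (d + d') + (L (tv e (s d' d)) + T f x)"
    using T_right[of e d d'] assms by (simp add: add.assoc[symmetric])
  also have "\<dots> \<approx> T e (d + d') + T f x" using Le_Tf assms by (intro sim_left)
  finally show ?thesis .
qed

text \<open>On vectors, \<open>tau e d\<close> sends \<open>e2\<close> to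
  \<open>e2 + s e2 d * e\<close>. Hence the coset of \<open>N\<close> should stay put if
  \<open>s e2 d = 0\<close> and otherwise move to the first family, with \<open>l e\<close> a
  multiple of \<open>e\<close>.\<close>

lemma covered_T_N:
  assumes d: "d \<in> W" shows "covered (T e d + N)"
proof (cases "s e2 d = 0")
  case True
  have mf2: "- f2 \<in> W" using f2 W_closed by blast
  \<comment> \<open>The two orders of these terms differ by twice the correction of
    \<open>T_right\<close>, a transvection along \<open>e\<close> that \<open>T f e2\<close> absorbs
    modulo \<open>Q\<close>.\<close>
  have 1: "T e d + T e (- f2) = T e (- f2) + (T e d + L (tv e (2 * s (- f2) d)))"
  proof -
    have "T e d + T e (- f2) = T e (d + - f2) + L (tv e (s (- f2) d))"
      using T_right[of e d "- f2"] d mf2 by simp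
    moreover have "T e (- f2) + T e d = T e (d + - f2) + L (tv e (- s (- f2) d))"
      using T_right[of e "- f2" d] s_flip[of d "- f2"] d mf2 by (simp add: add.commute)
    then have "T e (- f2) + T e d + L (tv e (2 * s (- f2) d)) = T e (d + - f2) + L (tv e (s (- f2) d))"
      using Le by (simp add: add.assoc L_comp[symmetric] tv_add)
    ultimately show ?thesis by (simp add: add.assoc)
  qed
  have "T e d + N = (T e d + T e (- f2)) + T f e2" by (simp add: N_def add.assoc)
  also have "\<dots> = T e (- f2) + (T e d + (L (tv e (2 * s (- f2) d)) + T f e2))"
    unfolding 1 by (simp add: add.assoc)
  also have "\<dots> \<approx> T e (- f2) + (T e d + T f e2)" using Le_Tf e2 by (intro sim_left)
  also have "\<dots> \<approx> T e (- f2) + T f e2"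
    using Te_Tf[OF d e2] True s_zero_flip by (intro sim_left) simp
  also have "\<dots> = R id + N" by (simp add: N_def)
  finally show ?thesis using GR_id unfolding covered_def by blast
next
  case False
  define c where "c = s e2 d"
  obtain l where l: "l \<in> GL" "l e = c *s e" "l f = (1 / c) *s f"
    using GL_diag[of c] False c_def by blast
  \<comment> \<open>Inserting \<open>L l\<close> in front of \<open>N\<close> is harmless by
    \<open>N_L\<close>, and moving \<open>T e d\<close> past it scales \<open>d\<close> to
    \<open>d'\<close>. The normalisation \<open>s e2 d' = 1\<close> makes \<open>d' - f2\<close>
    orthogonal to \<open>e2\<close>.\<close>
  define d' where "d' = (1 / c) *s d"
  have d': "d' \<in> W" "s e2 d' = 1" "c *s d' = d"
    using d False W_closed by (simp_all add: d'_def c_def)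
  have "T e d + N \<approx> T e d + (L l + N)" using N_L l by (intro sim_left)
  also have "T e d + (L l + N) = L l + (T e d' + N)"
    using L_T[OF l(1), of e d'] T_scale[of e d' c] d' l by (simp add: add.assoc[symmetric])
  also have "\<dots> \<approx> L l + (T e (d' + - f2) + T f e2)" unfolding N_def
    using d' f2 e2 W_closed by (intro sim_left Te_Te_sim)
  also have "\<dots> \<approx> L l + T f e2"
    using d' e2 f2 W_closed e2f2 s_flip[of d' e2] s_flip[of f2 e2] by (intro sim_left Te_Tf) auto
  finally show ?thesis using l e2 unfolding covered_def by blast
qed

text \<open>If \<open>d\<close> and \<open>w\<close> are not orthogonal, \<open>R\<close> moves
  \<open>w\<close> to \<open>e2\<close>, and the identity \<open>T f e2 = T e f2 + N\<close> brings
  the coset into the situation of \<open>covered_T_N\<close>.\<close>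

lemma covered_Te_Tf:
  assumes d: "d \<in> W" and w: "w \<in> W" shows "covered (T e d + T f w)"
proof (cases "s d w = 0")
  case True
  have "T e d + T f w \<approx> L id + T f w" using Te_Tf[OF d w True] by simp
  then show ?thesis using w GL_id unfolding covered_def by blast
next
  case False
  then have "w \<noteq> 0" "e2 \<noteq> 0" using e2f2 by auto
  then obtain r where r: "r \<in> GR" "r e2 = w" using GR_transitive e2 w by blast
  obtain r' where r': "r' \<in> GR" "r \<circ> r' = id" "r' \<circ> r = id" using GR_inverse[OF r(1)] .
  define d' where "d' = r' d"
  have d': "d' \<in> W" "r d' = d"
    using GR_W[OF r'(1) d] r'(2) by (auto simp: d'_def fun_eq_iff)
  have "T e d + T f w = T e d + T f w + R r + R r'"
    using R_comp[OF r(1) r'(1)] r'(2) by (simp add: add.assoc)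
  also have "\<dots> \<approx> T e d + T f w + R r" using Q_R r' by (intro sim_Q)
  also have "\<dots> = R r + (T e d' + T f e2)"
  proof -
    have "R r + T e d' = T e d + R r" "R r + T f e2 = T f w + R r"
      using R_T[OF r(1), of e d'] R_T[OF r(1), of f e2] d' e2 r by simp_all
    then show ?thesis by (metis add.assoc)
  qed
  also have "T f e2 = T e f2 + N"
    using T_right[of e f2 "- f2"] f2 W_closed by (simp add: N_def add.assoc[symmetric])
  also have "R r + (T e d' + (T e f2 + N)) = R r + (T e d' + T e f2 + N)" by (simp add: add.assoc)
  also have "T e d' + T e f2 = T e (d' + f2) + L (tv e (s f2 d'))" using T_right d' f2 by simp
  also have "R r + (T e (d' + f2) + L (tv e (s f2 d')) + N)
      = R r + (T e (d' + f2) + (L (tv e (s f2 d')) + N))" by (simp add: add.assoc)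
  also have "\<dots> \<approx> R r + (T e (d' + f2) + N)" by (intro sim_left L_N Le)
  finally have "T e d + T f w \<approx> R r + (T e (d' + f2) + N)" .
  then show ?thesis using covered_R[OF r(1) covered_T_N] covered_sim W_closed d' f2 by blast
qed

lemma covered_T:
  assumes d: "d \<in> W" and a: "covered a" shows "covered (T e d + a)"
  using a unfolding covered_def[of a]
proof (elim disjE bexE)
  fix r assume r: "r \<in> GR" "a \<approx> R r + N"
  obtain r' where r': "r' \<in> GR" "r \<circ> r' = id" using GR_inverse[OF r(1)] .
  define d' where "d' = r' d"
  have d': "d' \<in> W" "r d' = d"
    using GR_W[OF r'(1) d] r'(2) by (auto simp: d'_def fun_eq_iff)
  have "T e d + a \<approx> T e d + (R r + N)" using r by (intro sim_left)
  also have "\<dots> = R r + (T e d' + N)"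
    using R_T[OF r(1), of e d'] d' by (simp add: add.assoc[symmetric])
  finally show ?thesis using covered_R[OF r(1) covered_T_N] covered_sim d' by blast
next
  fix l w assume lw: "l \<in> GL" "w \<in> W" "a \<approx> L l + T f w"
  obtain l' where l': "l' \<in> GL" "l \<circ> l' = id" using GL_inverse[OF lw(1)] .
  obtain \<alpha> \<beta> where ab: "l' e = \<alpha> *s e + \<beta> *s f" using P_cases GL_P[OF l'(1)] by (metis P_ef(1))
  have lP: "l' e \<in> P" using GL_P[OF l'(1)] by simp
  have ll': "l (l' e) = e" using l'(2) by (simp add: fun_eq_iff)
  have "T e d + a \<approx> T e d + (L l + T f w)" using lw by (intro sim_left)
  also have "\<dots> = L l + (T (l' e) d + T f w)"
    using L_T[OF lw(1) lP d] ll' by (simp add: add.assoc[symmetric])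
  finally have 1: "T e d + a \<approx> L l + (T (l' e) d + T f w)" .
  have "covered (T (l' e) d + T f w)"
  proof (cases "\<beta> = 0")
    case True
    then have "T (l' e) d = T e (\<alpha> *s d)" using T_scale d by (simp add: ab)
    then show ?thesis using covered_Te_Tf d lw W_closed by simp
  next
    case False
    \<comment> \<open>Up to the factor \<open>\<beta>\<close>, which is shifted into
      \<open>d'\<close>, the vector \<open>l' e\<close> is \<open>f + \<gamma> e\<close>, the image
      of \<open>f\<close> under \<open>tv e (- \<gamma>)\<close>. Conjugating back turns the sum
      into one of two terms \<open>T f\<close>, which \<open>T_right\<close> merges.\<close>
    define \<gamma> where "\<gamma> = \<alpha> / \<beta>"
    define d' where "d' = \<beta> *s d"
    have d': "d' \<in> W" using d W_closed by (simp add: d'_def)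
    have "l' e = \<beta> *s (f + \<gamma> *s e)" using False by (simp add: ab \<gamma>_def scale_right_distrib add.commute)
    moreover have "f + \<gamma> *s e \<in> P" by (simp add: P_closed)
    ultimately have 2: "T (l' e) d = T (f + \<gamma> *s e) d'" using T_scale d by (simp add: d'_def)
    have 3: "L (tv e (- \<gamma>)) + T f d' = T (f + \<gamma> *s e) d' + L (tv e (- \<gamma>))"
      using L_T[OF Le(1), of f d' "- \<gamma>"] d' by (simp add: tv_def)
    have "T (l' e) d + T f w \<approx> T (l' e) d + (L (tv e (- \<gamma>)) + T f w)"
      using Tf_Le lw by (intro sim_left)
    also have "\<dots> = L (tv e (- \<gamma>)) + (T f d' + T f w)"
      unfolding 2 by (simp add: 3 add.assoc[symmetric])
    also have "T f d' + T f w = L (tv f (s w d')) + T f (d' + w)"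
      using T_right[of f d' w] Lf_T d' lw W_closed by simp
    also have "L (tv e (- \<gamma>)) + (L (tv f (s w d')) + T f (d' + w))
       = L (tv e (- \<gamma>) \<circ> tv f (s w d')) + T f (d' + w)"
      using Le by (simp add: L_comp add.assoc)
    finally show ?thesis unfolding covered_def using GL_comp Le W_closed d' lw by blast
  qed
  then show ?thesis using covered_sim[OF 1] covered_L lw by blast
qed

section \<open>The generated group: stabiliser of \<open>e\<close>, injectivity and image\<close>

definition U :: "'u set" where "U = sgen (L ` GL \<union> R ` GR \<union> T e ` W)"

lemma uminus_L: "g \<in> GL \<Longrightarrow> \<exists>h\<in>GL. - L g = L h"
  using GL_inverse[of g] L_comp[of g] L_id by (metis minus_unique)

lemma uminus_R: "g \<in> GR \<Longrightarrow> \<exists>h\<in>GR. - R g = R h"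
  using GR_inverse[of g] R_comp[of g] R_id by (metis minus_unique)

lemma uminus_T: "w \<in> W \<Longrightarrow> - T e w = T e (- w)"
  using T_right[of e w "- w"] W_closed by (intro minus_unique) simp

lemma U_covered: "a \<in> U \<Longrightarrow> covered a"
  unfolding U_def
proof (induction rule: sgen.induct)
  case sgen_zero
  have "0 \<approx> L id + T f 0" by simp
  then show ?case using GL_id W_closed(1) unfolding covered_def by blast
next
  case (sgen_plus x a)
  then show ?case using covered_L covered_R covered_T by blast
next
  case (sgen_uminus x a)
  from sgen_uminus(1) consider "x \<in> L ` GL" | "x \<in> R ` GR" | w where "w \<in> W" "x = T e w" by blast
  then show ?case
  proof cases
    case 3
    then show ?thesis using covered_T[of "- w"] W_closed sgen_uminus.IH by (simp add: uminus_T)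
  qed (use uminus_L uminus_R covered_L covered_R sgen_uminus.IH in \<open>auto, metis+\<close>)
qed

lemma pi_Q:
  assumes "w \<in> W" "h \<in> GR"
  shows "\<pi> (T e w + (L (tv e c) + R h)) = tau e w \<circ> tv e c \<circ> h"
  using assms by (simp add: pi_add pi_T pi_L pi_R Le comp_assoc)

lemma pi_Q_e: "q \<in> Q \<Longrightarrow> \<pi> q e = e"
  unfolding Q_def by (auto simp: pi_Q GR_P tau_def tv_def)

text \<open>The two families are told apart by the image of \<open>e\<close>:
  \<open>l e + w = e\<close> forces \<open>w = 0\<close> and \<open>l e = e\<close>, whereas an
  element of the second family sends \<open>e\<close> into \<open>W\<close>, which does not contain
  \<open>e\<close>.\<close>

lemma U_stab:
  assumes a: "a \<in> U" and ae: "\<pi> a e = e" shows "a \<in> Q"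
  using U_covered[OF a] unfolding covered_def sim_def
proof (elim disjE bexE)
  fix l w q assume q: "l \<in> GL" "w \<in> W" "q \<in> Q" "a = L l + T f w + q"
  have "e = \<pi> a e" using ae by simp
  also have "\<dots> = l (e + w)"
    using q by (simp add: pi_add pi_L pi_T pi_Q_e) (simp add: tau_def)
  also have "\<dots> = l e + w" using q by (simp add: isom_add[OF GL_isom] GL_W)
  finally have "w = e - l e" by (simp add: algebra_simps)
  then have "w \<in> P" using GL_P[OF q(1), of e] P_closed(3)[of e "l e"] by simp
  then have w: "w = 0" using P_W_zero q by blast
  then have "l e = e" using \<open>w = e - l e\<close> by simp
  then obtain c where "l = tv e c" using GL_stab q by blast
  then show "a \<in> Q" using q w Q_add[OF Q_L] by simp
next
  fix r q assume q: "r \<in> GR" "q \<in> Q" "a = R r + N + q"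
  have "\<pi> a e = r (\<pi> N e)" using q by (simp add: pi_add pi_R pi_Q_e)
  also have "\<pi> N e = e2" using e2 f2 W_closed(4)[OF f2]
    by (simp add: N_def pi_add pi_T) (simp add: tau_def e2f2)
  finally have "e = r e2" using ae by simp
  then have "e \<in> W" using GR_W[OF q(1) e2] by simp
  then have "s e f = 0" by (rule W_s)
  then show "a \<in> Q" by simp
qed

lemma U_add: "a \<in> U \<Longrightarrow> b \<in> U \<Longrightarrow> a + b \<in> U"
  and U_minus: "a \<in> U \<Longrightarrow> - a \<in> U"
  unfolding U_def by (auto intro: sgen_add sgen_minus)

lemma U_L: "g \<in> GL \<Longrightarrow> L g \<in> U"
  and U_R: "h \<in> GR \<Longrightarrow> R h \<in> U"
  and U_T: "w \<in> W \<Longrightarrow> T e w \<in> U"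
  unfolding U_def by (auto intro: sgen_base)

text \<open>An element acting trivially fixes \<open>e\<close>, so it is in \<open>Q\<close>; there
  the image \<open>f - w - c e\<close> of \<open>f\<close> shows that \<open>w\<close> and
  \<open>c\<close> vanish, and then \<open>h\<close> is the identity.\<close>

lemma inj_U: "inj_on \<pi> U"
proof (rule inj_onI)
  fix a b assume ab: "a \<in> U" "b \<in> U" "\<pi> a = \<pi> b"
  have id: "\<pi> (- b + a) = id" using ab(3) pi_uminus(2)[of b] by (simp add: pi_add)
  then have "- b + a \<in> Q" using U_stab[of "- b + a"] U_add U_minus ab by simp
  then obtain w c h where q: "- b + a = T e w + (L (tv e c) + R h)" "w \<in> W" "h \<in> GR"
    unfolding Q_def by blast
  have 1: "tau e w \<circ> tv e c \<circ> h = id" using id pi_Q q by simp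
  have "(tau e w \<circ> tv e c \<circ> h) f = f - w - c *s e"
    using q by (simp add: GR_P tau_def tv_def algebra_simps)
  then have 2: "w + c *s e = 0" using 1 by (simp add: algebra_simps)
  have "s (w + c *s e) f = c" using q by simp
  then have c: "c = 0" unfolding 2 by simp
  then have w: "w = 0" using 2 by simp
  have "h = id" using 1 by (simp add: c w)
  then have "- b + a = 0" using q by (simp add: c w)
  then show "a = b" by (metis add_0_right add_minus_cancel)
qed

lemma Tf_U:
  assumes "w \<in> W" shows "T f w \<in> U"
proof -
  obtain l where l: "l \<in> GL" "l e = f" using GL_transitive[of f] by auto
  have "T f w = L l + T e w + - L l" using L_T[OF l(1), of e w] assms l(2) by simp
  then show ?thesis by (simp only:) (intro U_add U_minus U_L U_T l assms)
qed

lemma pi_U_fixer: "a \<in> U \<Longrightarrow> \<pi> a \<in> fixer Z0"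
proof -
  have *: "\<pi> x \<in> fixer Z0" if "x \<in> L ` GL \<union> R ` GR \<union> T e ` W" for x
    using that Z0_GL Z0_GR e_perp by (auto simp: pi_L pi_R pi_T intro!: tau_fixer W_perp_Z0)
  have **: "\<pi> (- x) \<in> fixer Z0" if "x \<in> L ` GL \<union> R ` GR \<union> T e ` W" for x
    using that uminus_L uminus_R uminus_T *
    by (smt (verit, best) UnE UnI1 UnI2 W_closed(4) image_iff)
  assume "a \<in> U"
  then show ?thesis unfolding U_def
  proof (induction rule: sgen.induct)
    case sgen_zero
    show ?case unfolding pi_zero by (rule fixer_id)
  next
    case (sgen_plus x a)
    show ?case unfolding pi_add by (intro fixer_comp *[OF sgen_plus(1)] sgen_plus(3))
  next
    case (sgen_uminus x a)
    show ?case unfolding pi_add by (intro fixer_comp **[OF sgen_uminus(1)] sgen_uminus(3))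
  qed
qed

lemma pi_U: "\<pi> ` U = fixer Z0"
proof
  show "\<pi> ` U \<subseteq> fixer Z0" using pi_U_fixer by blast
  show "fixer Z0 \<subseteq> \<pi> ` U"
  proof
    fix g assume g: "g \<in> fixer Z0"
    define u w where "u = proj (g e)" and "w = g e - proj (g e)"
    have u: "u \<in> P" and w: "w \<in> W" and ge: "g e = u + w"
      using Z0_proj_W[OF fixer_perp[OF g e_perp]] by (auto simp: u_def w_def)
    \<comment> \<open>The two families of coset representatives provide an element with the same
      image of \<open>e\<close> as \<open>g\<close>; \<open>stab_decomp\<close> handles the
      quotient.\<close>
    have "\<exists>a\<in>U. \<pi> a e = g e"
    proof (cases "u = 0")
      case False
      then obtain l where l: "l \<in> GL" "l e = u" using GL_transitive u by blast
      have "\<pi> (L l + T f w) e = u + w" using l w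
        by (simp add: pi_add pi_L pi_T tau_def isom_add[OF GL_isom] GL_W)
      then show ?thesis using ge U_add U_L Tf_U l w by metis
    next
      case True
      then have "w \<noteq> 0" using ge isom_eq_zero[OF fixer_isom[OF g], of e] by simp
      moreover have "e2 \<noteq> 0" using e2f2 by auto
      ultimately obtain r where r: "r \<in> GR" "r e2 = w" using GR_transitive e2 w by blast
      have "\<pi> N e = e2" using e2 f2 W_closed(4)[OF f2]
        by (simp add: N_def pi_add pi_T) (simp add: tau_def e2f2)
      then have "\<pi> (R r + N) e = g e" using r ge True by (simp add: pi_add pi_R)
      moreover have "R r + N \<in> U" unfolding N_def
        using r e2 f2 W_closed by (intro U_add U_R U_T Tf_U)
      ultimately show ?thesis by blast
    qed
    then obtain a where a: "a \<in> U" "\<pi> a e = g e" by blast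
    have "\<pi> (- a) \<circ> g \<in> fixer Z0" using pi_U_fixer U_minus a fixer_comp g by blast
    moreover have "(\<pi> (- a) \<circ> g) e = e"
      using a(2) pi_uminus(2)[of a] by (metis comp_apply id_apply)
    ultimately obtain x c h where x: "x \<in> W" "h \<in> GR" "\<pi> (- a) \<circ> g = tau e x \<circ> tv e c \<circ> h"
      using stab_decomp by blast
    have "g = \<pi> a \<circ> (\<pi> (- a) \<circ> g)" using pi_uminus(1)[of a] by (simp add: comp_assoc[symmetric])
    also have "\<dots> = \<pi> (a + (T e x + (L (tv e c) + R h)))"
      unfolding x(3) pi_Q[OF x(1,2), symmetric] by (simp add: pi_add)
    finally show "g \<in> \<pi> ` U" using a x by (auto intro!: imageI U_add U_T U_L U_R Le)
  qed
qed

end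

section \<open>Short root elements as conjugates\<close>

text \<open>\<open>T0\<close> lifts a single short root element. \<open>T0_comm\<close> says that
  the elements of \<open>GL\<close> times \<open>GR\<close> stabilising this root element centralise
  the lift, which is what makes all conjugates of \<open>T0\<close> well defined.\<close>

locale conj_system = split_rep scale s e f Z0 \<pi> e2 f2 L R
  for scale :: "'a::field \<Rightarrow> 'v::ab_group_add \<Rightarrow> 'v" (infixr \<open>*s\<close> 75) and s and e f :: 'v and Z0
    and \<pi> :: "'u::group_add \<Rightarrow> 'v \<Rightarrow> 'v" and e2 f2 :: 'v and L R :: "('v \<Rightarrow> 'v) \<Rightarrow> 'u" +
  fixes T0 :: 'u
  assumes pi_T0: "\<pi> T0 = tau e e2"
    and T0_comm: "g \<in> GL \<Longrightarrow> h \<in> GR \<Longrightarrow> tau (g e) (h e2) = tau e e2 \<Longrightarrow>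
      L g + R h + T0 = T0 + (L g + R h)"
begin

lemma e2_nonzero [simp]: "e2 \<noteq> 0"
  using e2f2 by auto

text \<open>Conjugation reaches only nonzero vectors, so zero arguments are set apart. The choice
  made by \<open>SOME\<close> is immaterial by \<open>T_conj\<close>.\<close>

definition T :: "'v \<Rightarrow> 'v \<Rightarrow> 'u" where
  "T u v = (if u = 0 \<or> v = 0 then 0 else
     (SOME x. \<exists>g\<in>GL. \<exists>h\<in>GR. g e = u \<and> h e2 = v \<and> x = (L g + R h) + T0 + - (L g + R h)))"

text \<open>Two conjugators with the same target differ by a pair \<open>k\<close>, \<open>m\<close>
  stabilising \<open>tau e e2\<close>, and such a pair commutes with \<open>T0\<close> by
  \<open>T0_comm\<close>.\<close>

lemma conj_unique:
  assumes g: "g \<in> GL" "g' \<in> GL" and h: "h \<in> GR" "h' \<in> GR"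
    and eq: "tau (g e) (h e2) = tau (g' e) (h' e2)"
  shows "(L g + R h) + T0 + - (L g + R h) = (L g' + R h') + T0 + - (L g' + R h')"
proof -
  obtain gi where gi: "gi \<in> GL" "g' \<circ> gi = id" "gi \<circ> g' = id" using GL_inverse[OF g(2)] .
  obtain hi where hi: "hi \<in> GR" "h' \<circ> hi = id" "hi \<circ> h' = id" using GR_inverse[OF h(2)] .
  define k m where "k = gi \<circ> g" and "m = hi \<circ> h"
  have km: "k \<in> GL" "m \<in> GR" "g = g' \<circ> k" "h = h' \<circ> m"
    using gi hi g h by (simp_all add: k_def m_def GL_comp GR_comp comp_assoc[symmetric])
  have ke: "k e \<in> P" and me: "m e2 \<in> W" using km e2 GL_P GR_W by simp_all
  define b where "b = h' \<circ> g'"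
  have b: "b \<in> isom" unfolding b_def using g h GL_isom GR_isom isom_comp by blast
  have bP: "b u = g' u" if "u \<in> P" for u using that g h by (simp add: b_def GR_P GL_P)
  have bW: "b v = h' v" if "v \<in> W" for v using that g h by (simp add: b_def GL_W)
  have "b \<circ> tau (k e) (m e2) = tau (g e) (h e2) \<circ> b"
    using isom_tau[OF b, of "k e" "m e2"] ke me by (simp add: bP bW km(3,4))
  also have "\<dots> = b \<circ> tau e e2"
    using isom_tau[OF b, of e e2] e2 by (simp add: eq bP bW)
  finally have "tau (k e) (m e2) = tau e e2"
    using isom_bij[OF b] by (auto simp: fun_eq_iff bij_def inj_eq)
  then have 1: "L k + R m + T0 = T0 + (L k + R m)" using T0_comm km by simp
  have 2: "L g + R h = L g' + R h' + (L k + R m)"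
  proof -
    have "L g + R h = L g' + (L k + R h') + R m"
      using km g h by (simp add: L_comp R_comp add.assoc)
    also have "L k + R h' = R h' + L k" using L_R km h by simp
    finally show ?thesis by (simp add: add.assoc)
  qed
  have "L g + R h + T0 = L g' + R h' + (L k + R m + T0)" unfolding 2 by (simp only: add.assoc)
  also have "\<dots> = (L g' + R h' + T0) + (L k + R m)" unfolding 1 by (simp only: add.assoc)
  finally have "L g + R h + T0 + - (L g + R h)
     = (L g' + R h' + T0) + ((L k + R m) + - (L g' + R h' + (L k + R m)))"
    unfolding 2 by (simp only: add.assoc)
  also have "(L k + R m) + - (L g' + R h' + (L k + R m)) = - (L g' + R h')"
    by (simp only: minus_add add.assoc add_minus_cancel)
  finally show ?thesis by simp
qed

lemma T_conj:
  assumes "g \<in> GL" "h \<in> GR" "g e = u" "h e2 = v"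
  shows "T u v = (L g + R h) + T0 + - (L g + R h)"
proof -
  have "u \<noteq> 0" "v \<noteq> 0" using assms isom_eq_zero[OF GL_isom, of g e] isom_eq_zero[OF GR_isom, of h e2]
    by auto
  moreover have "(SOME x. \<exists>g\<in>GL. \<exists>h\<in>GR. g e = u \<and> h e2 = v \<and> x = (L g + R h) + T0 + - (L g + R h))
    = (L g + R h) + T0 + - (L g + R h)"
  proof (rule some_equality)
    fix x assume "\<exists>g\<in>GL. \<exists>h\<in>GR. g e = u \<and> h e2 = v \<and> x = (L g + R h) + T0 + - (L g + R h)"
    then show "x = (L g + R h) + T0 + - (L g + R h)" using conj_unique assms by metis
  qed (use assms in blast)
  ultimately show ?thesis by (simp add: T_def)
qed

lemma T_zero [simp]: "T 0 v = 0" "T u 0 = 0"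
  by (simp_all add: T_def)

lemma T_e_conj:
  assumes "h \<in> GR" "h e2 = v" shows "T e v = R h + T0 + - R h"
  using T_conj[OF GL_id assms(1)] assms(2) by simp

lemma T_e2_conj:
  assumes "g \<in> GL" "g e = u" shows "T u e2 = L g + T0 + - L g"
  using T_conj[OF assms(1) GR_id] assms(2) by simp

text \<open>On nonzero arguments \<open>T u v\<close> depends only on the isometry
  \<open>tau u v\<close>; this yields \<open>T_scale\<close>.\<close>

lemma T_cong:
  assumes "u \<in> P" "u' \<in> P" "v \<in> W" "v' \<in> W" "u \<noteq> 0" "u' \<noteq> 0" "v \<noteq> 0" "v' \<noteq> 0"
    "tau u v = tau u' v'"
  shows "T u v = T u' v'"
proof -
  obtain g g' h h' where "g \<in> GL" "g e = u" "g' \<in> GL" "g' e = u'"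
    "h \<in> GR" "h e2 = v" "h' \<in> GR" "h' e2 = v'"
    using GL_transitive GR_transitive e2 e2_nonzero assms by metis
  then show ?thesis using T_conj conj_unique assms(9) by metis
qed

lemma T_scale:
  assumes "u \<in> P" "v \<in> W" shows "T (c *s u) v = T u (c *s v)"
proof (cases "c = 0 \<or> u = 0 \<or> v = 0")
  case False
  then show ?thesis using assms P_closed W_closed by (intro T_cong) (auto simp: tau_scale)
qed auto

lemma pi_T:
  assumes "u \<in> P" "v \<in> W" shows "\<pi> (T u v) = tau u v"
proof (cases "u = 0 \<or> v = 0")
  case False
  then obtain g h where gh: "g \<in> GL" "g e = u" "h \<in> GR" "h e2 = v"
    using GL_transitive GR_transitive e2 e2_nonzero assms by metis
  have b: "g \<circ> h \<in> isom" using gh GL_isom GR_isom isom_comp by blast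
  have pi: "\<pi> (L g + R h) = g \<circ> h" using gh by (simp add: pi_add pi_L pi_R)
  have "\<pi> (T u v) = (g \<circ> h) \<circ> tau e e2 \<circ> \<pi> (- (L g + R h))"
    unfolding T_conj[OF gh(1,3,2,4)] by (simp only: pi_add pi_T0 pi_L[OF gh(1)] pi_R[OF gh(3)])
  also have "(g \<circ> h) \<circ> tau e e2 = tau u v \<circ> (g \<circ> h)"
    using isom_tau[OF b, of e e2] gh assms by (simp add: GR_P GL_W)
  also have "tau u v \<circ> (g \<circ> h) \<circ> \<pi> (- (L g + R h)) = tau u v"
    using pi_uminus(1)[of "L g + R h"] by (simp only: pi comp_assoc comp_id)
  finally show ?thesis .
qed (auto simp: pi_zero)

lemma L_T:
  assumes "g \<in> GL" "u \<in> P" "v \<in> W" shows "L g + T u v = T (g u) v + L g"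
proof (cases "u = 0 \<or> v = 0")
  case False
  then obtain k h where gh: "k \<in> GL" "k e = u" "h \<in> GR" "h e2 = v"
    using GL_transitive GR_transitive e2 e2_nonzero assms by metis
  have "T (g u) v = L g + T u v + - L g"
    using T_conj[OF gh(1,3,2,4)] T_conj[OF GL_comp[OF assms(1) gh(1)] gh(3) _ gh(4), of "g u"] gh assms
    by (simp add: L_comp add.assoc minus_add del: add_uminus_conv_diff)
  then show ?thesis by simp
qed (use isom_zero[OF GL_isom[OF assms(1)]] in auto)

lemma R_T:
  assumes "g \<in> GR" "u \<in> P" "v \<in> W" shows "R g + T u v = T u (g v) + R g"
proof (cases "u = 0 \<or> v = 0")
  case False
  then obtain k h where gh: "k \<in> GL" "k e = u" "h \<in> GR" "h e2 = v"
    using GL_transitive GR_transitive e2 e2_nonzero assms by metis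
  have eq: "L k + R (g \<circ> h) = R g + (L k + R h)"
    using L_R[OF gh(1) assms(1)] R_comp assms gh by (simp add: add.assoc[symmetric])
  have "T u (g v) = R g + T u v + - R g"
    using T_conj[OF gh(1,3,2,4)] T_conj[OF gh(1) GR_comp[OF assms(1) gh(3)] gh(2), of "g v"] gh assms
    by (simp add: eq add.assoc minus_add del: add_uminus_conv_diff)
  then show ?thesis by simp
qed (use isom_zero[OF GR_isom[OF assms(1)]] in auto)

section \<open>Heisenberg relations for the conjugates\<close>

definition additive_pair :: "'v \<Rightarrow> 'v \<Rightarrow> bool" where
  "additive_pair v v' \<longleftrightarrow> T e v + T e v' = T e (v + v') + L (tv e (s v' v))"

lemma Le_T: "w \<in> W \<Longrightarrow> L (tv e c) + T e w = T e w + L (tv e c)"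
  using L_T[OF Le(1), of e w c] by (simp add: tv_def)

text \<open>Since \<open>GL\<close> and \<open>GR\<close> are transitive on nonzero vectors and act
  on \<open>T\<close> by conjugation, each relation may be checked at the base vector,
  \<open>e\<close> or \<open>e2\<close>, of the argument that stays constant.\<close>

lemma heisenberg_systemI:
  assumes right: "\<And>v v'. v \<in> W \<Longrightarrow> v' \<in> W \<Longrightarrow> additive_pair v v'"
    and left: "\<And>u u'. u \<in> P \<Longrightarrow> u' \<in> P \<Longrightarrow> T u e2 + T u' e2 = T (u + u') e2 + R (tv e2 (s u' u))"
  shows "heisenberg_system (*s) s e f Z0 \<pi> e2 f2 L R T"
proof unfold_locales
  fix u v v' assume u: "u \<in> P" and v: "v \<in> W" "v' \<in> W"
  show "T u v + T u v' = T u (v + v') + L (tv u (s v' v))"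
  proof (cases "u = 0")
    case False
    then obtain l where l: "l \<in> GL" "l e = u" using GL_transitive u by blast
    have 1: "T u x + L l = L l + T e x" if "x \<in> W" for x
      using L_T[OF l(1), of e x] that l(2) by simp
    have 2: "L (tv u c) + L l = L l + L (tv e c)" for c
      using isom_tv[OF GL_isom[OF l(1)], of e c] l u Le by (simp add: L_comp[symmetric] tv_GL)
    have "T u v + T u v' + L l = T u v + (T u v' + L l)" by (simp only: add.assoc)
    also have "\<dots> = (T u v + L l) + T e v'" unfolding 1[OF v(2)] by (simp only: add.assoc)
    also have "\<dots> = L l + (T e v + T e v')" unfolding 1[OF v(1)] by (simp only: add.assoc)
    also have "\<dots> = L l + (T e (v + v') + L (tv e (s v' v)))"
      using right[OF v] by (simp add: additive_pair_def)
    also have "\<dots> = T u (v + v') + L (tv u (s v' v)) + L l"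
      unfolding add.assoc 2 by (simp add: add.assoc[symmetric] 1[OF W_closed(2)[OF v]])
    finally show ?thesis by simp
  qed simp
next
  fix u u' v assume u: "u \<in> P" "u' \<in> P" and v: "v \<in> W"
  show "T u v + T u' v = T (u + u') v + R (tv v (s u' u))"
  proof (cases "v = 0")
    case False
    then obtain r where r: "r \<in> GR" "r e2 = v" using GR_transitive e2 v by fastforce
    have 1: "T x v + R r = R r + T x e2" if "x \<in> P" for x
      using R_T[OF r(1) that e2] r(2) by simp
    have 2: "R (tv v c) + R r = R r + R (tv e2 c)" for c
      using isom_tv[OF GR_isom[OF r(1)], of e2 c] r v e2 by (simp add: R_comp[symmetric] tv_GR)
    have "T u v + T u' v + R r = T u v + (T u' v + R r)" by (simp only: add.assoc)
    also have "\<dots> = (T u v + R r) + T u' e2" unfolding 1[OF u(2)] by (simp only: add.assoc)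
    also have "\<dots> = R r + (T u e2 + T u' e2)" unfolding 1[OF u(1)] by (simp only: add.assoc)
    also have "\<dots> = R r + (T (u + u') e2 + R (tv e2 (s u' u)))"
      using left[OF u] by simp
    also have "\<dots> = T (u + u') v + R (tv v (s u' u)) + R r"
      unfolding add.assoc 2 by (simp add: add.assoc[symmetric] 1[OF P_closed(2)[OF u]])
    finally show ?thesis by simp
  qed simp
qed (fact pi_T L_T R_T T_scale)+

lemma additive_pair_R:
  assumes h: "h \<in> GR" and v: "v \<in> W" "v' \<in> W" and "additive_pair v v'"
  shows "additive_pair (h v) (h v')"
proof -
  have 1: "T e (h x) + R h = R h + T e x" if "x \<in> W" for x
    using R_T[OF h, of e x] that by simp
  have "T e (h v) + T e (h v') + R h = T e (h v) + (T e (h v') + R h)" by (simp only: add.assoc)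
  also have "\<dots> = (T e (h v) + R h) + T e v'" unfolding 1[OF v(2)] by (simp only: add.assoc)
  also have "\<dots> = R h + (T e v + T e v')" unfolding 1[OF v(1)] by (simp only: add.assoc)
  also have "\<dots> = R h + T e (v + v') + L (tv e (s v' v))"
    using assms(4) by (simp add: additive_pair_def add.assoc)
  also have "\<dots> = T e (h v + h v') + (R h + L (tv e (s v' v)))"
    using 1[OF W_closed(2)[OF v]] isom_add[OF GR_isom[OF h]] by (simp add: add.assoc[symmetric])
  also have "\<dots> = T e (h v + h v') + L (tv e (s v' v)) + R h"
    unfolding L_R[OF Le(1) h, symmetric] by (simp only: add.assoc)
  finally show ?thesis using isom_s[OF GR_isom[OF h]] by (simp add: additive_pair_def)
qed

text \<open>Without such a \<open>w\<close>, the kernel of \<open>s v'\<close> on \<open>W\<close>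
  lies in that of \<open>s v\<close>; the two functionals are then proportional, and nondegeneracy
  makes \<open>v\<close> a multiple of \<open>v'\<close>.\<close>

lemma separating_vector:
  assumes v: "v \<in> W" "v' \<in> W" and ind: "\<And>c. v \<noteq> c *s v'"
  shows "\<exists>w\<in>W. s v w = 1 \<and> s v' w = 0"
proof (rule ccontr)
  assume no: "\<not> (\<exists>w\<in>W. s v w = 1 \<and> s v' w = 0)"
  have *: "s v y = 0" if "y \<in> W" "s v' y = 0" for y
  proof (rule ccontr)
    assume "s v y \<noteq> 0"
    then show False using no that W_closed(5)[of y "1 / s v y"] by auto
  qed
  have "\<exists>c. v = c *s v'"
  proof (cases "v' = 0")
    case True
    then have "v = 0" using * nondeg[of v] v by (auto simp: W_def)
    then show ?thesis using True by auto
  next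
    case False
    then obtain y0 where y0: "y0 \<in> W" "s v' y0 \<noteq> 0" using nondeg[of v'] v by (auto simp: W_def)
    define c where "c = s v y0 / s v' y0"
    have "s (v - c *s v') y = 0" if "y \<in> W" for y
    proof -
      have "s v (y - (s v' y / s v' y0) *s y0) = 0" using that y0 W_closed by (intro *) auto
      then show ?thesis by (simp add: c_def field_simps)
    qed
    then have "v - c *s v' = 0" using nondeg[of "v - c *s v'"] v W_closed by (auto simp: W_def)
    then show ?thesis by auto
  qed
  then show False using ind by blast
qed

text \<open>For orthogonal \<open>v\<close>, \<open>v'\<close> one passes through a third vector \<open>w\<close> such that \<open>(v, v' - w)\<close>,
  \<open>(v + v' - w, w)\<close> and \<open>(v' - w, w)\<close> are non-orthogonal; such a \<open>w\<close> exists as the field has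
  an element different from \<open>0\<close> and \<open>-1\<close>.\<close>

lemma additive_pair_all:
  assumes F: "\<not> (finite (UNIV :: 'a set) \<and> card (UNIV :: 'a set) \<le> 2)"
    and loc: "\<And>a b c d. additive_pair (a *s e2 + b *s f2) (c *s e2 + d *s f2)"
    and v: "v \<in> W" "v' \<in> W"
  shows "additive_pair v v'"
proof -
  \<comment> \<open>\<open>GR\<close> is transitive on pairs with a given nonzero value of
    \<open>s\<close>, so every non-orthogonal pair is conjugate to \<open>e2\<close> and a multiple
    of \<open>f2\<close>, where \<open>loc\<close> applies.\<close>
  have nonorth: "additive_pair v v'" if v: "v \<in> W" "v' \<in> W" "s v v' \<noteq> 0" for v v'
  proof -
    have "s v v' *s f2 \<in> W" "s e2 (s v v' *s f2) = s v v'" using f2 e2f2 W_closed by auto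
    then obtain h where h: "h \<in> GR" "h e2 = v" "h (s v v' *s f2) = v'"
      using GR_transitive_pairs[of e2 "s v v' *s f2" v v'] e2 v by auto
    have "additive_pair e2 (s v v' *s f2)" using loc[of 1 0 0 "s v v'"] by simp
    then show ?thesis using additive_pair_R[OF h(1) e2 \<open>s v v' *s f2 \<in> W\<close>] h by simp
  qed
  have dep: "additive_pair v (c *s v)" if v: "v \<in> W" for v c
  proof (cases "v = 0")
    case True
    then show ?thesis by (simp add: additive_pair_def)
  next
    case False
    then obtain h where h: "h \<in> GR" "h e2 = v" using GR_transitive e2 v by fastforce
    have "additive_pair e2 (c *s e2)" using loc[of 1 0 c 0] by simp
    then show ?thesis using additive_pair_R[OF h(1) e2, of "c *s e2"] e2 W_closed h
      by (simp add: isom_scale[OF GR_isom])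
  qed
  show ?thesis
  proof (cases "s v v' = 0")
    case orth: True
    show ?thesis
    proof (cases "(\<exists>c. v' = c *s v) \<or> v = 0")
      case True
      then show ?thesis using dep v by (auto simp: additive_pair_def)
    next
      case False
      have "v \<noteq> c *s v'" for c
      proof
        assume a: "v = c *s v'"
        then have "c \<noteq> 0" using False by auto
        then have "v' = (1 / c) *s v" using a by simp
        then show False using False by blast
      qed
      then obtain w1 where w1: "w1 \<in> W" "s v w1 = 1" "s v' w1 = 0"
        using separating_vector v by blast
      obtain w2 where w2: "w2 \<in> W" "s v' w2 = 1" "s v w2 = 0"
        using separating_vector[OF v(2,1)] False by blast
      obtain \<beta> :: 'a where \<beta>: "\<beta> \<noteq> 0" "\<beta> \<noteq> - 1"
      proof -
        have "\<not> UNIV \<subseteq> {0, - 1 :: 'a}"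
        proof
          assume sub: "UNIV \<subseteq> {0, - 1 :: 'a}"
          then have "card (UNIV :: 'a set) \<le> card {0, - 1 :: 'a}" "finite (UNIV :: 'a set)"
            using card_mono[OF _ sub] finite_subset[OF sub] by simp_all
          moreover have "card {0, - 1 :: 'a} \<le> 2" by (simp add: card_insert_if)
          ultimately show False using F by simp
        qed
        then show ?thesis using that by blast
      qed
      define w where "w = w1 + \<beta> *s w2"
      have w: "w \<in> W" "s v w = 1" "s v' w = \<beta>" using w1 w2 W_closed by (auto simp: w_def)
      have 1: "T e (v' - w) + T e w = T e v' + L (tv e (s w v'))"
        using nonorth[of "v' - w" w] w v \<beta> W_closed by (simp add: additive_pair_def)
      have 2: "T e v + T e (v' - w) = T e (v + v' - w) + L (tv e (- s w v))"
        using nonorth[of v "v' - w"] w v orth W_closed s_flip[of v' v]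
        by (simp add: additive_pair_def add_diff_eq)
      have "s (v + v' - w) w \<noteq> 0" using w \<beta> by (simp add: add_eq_0_iff)
      then have 3: "T e (v + v' - w) + T e w = T e (v + v') + L (tv e (s w v + s w v'))"
        using nonorth[of "v + v' - w" w] w v W_closed by (simp add: additive_pair_def)
      have "T e v + T e v' + L (tv e (s w v')) = T e v + (T e (v' - w) + T e w)"
        unfolding 1 by (simp add: add.assoc)
      also have "\<dots> = T e (v + v' - w) + (L (tv e (- s w v)) + T e w)"
        using 2 by (simp add: add.assoc[symmetric])
      also have "\<dots> = (T e (v + v' - w) + T e w) + L (tv e (- s w v))"
        using Le_T w by (simp add: add.assoc)
      also have "\<dots> = T e (v + v') + (L (tv e (s w v + s w v')) + L (tv e (- s w v)))"
        unfolding 3 by (simp add: add.assoc)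
      also have "L (tv e (s w v + s w v')) + L (tv e (- s w v)) = L (tv e (s w v'))"
        using Le by (simp add: L_comp[symmetric] tv_add)
      finally show ?thesis using orth s_flip[of v' v] by (simp add: additive_pair_def)
    qed
  qed (use nonorth v in blast)
qed

end

section \<open>Stabilisers of subspaces, and centralisers in a hyperbolic splitting\<close>

context symplectic_space
begin

lemma isom_span:
  assumes "g \<in> isom" shows "g ` span S = span (g ` S)"
proof -
  have "module_hom (*s) (*s) g" using assms by (simp add: isom_iff linear_iff_module_hom)
  then show ?thesis by (rule module_hom.span_image[symmetric])
qed

lemma isom_image_eqI:
  assumes "h \<circ> g = id" "g \<circ> h = id" "\<And>x. x \<in> C \<Longrightarrow> g x \<in> C" "\<And>x. x \<in> C \<Longrightarrow> h x \<in> C"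
  shows "g ` C = C"
proof
  show "C \<subseteq> g ` C"
  proof
    fix x assume "x \<in> C"
    then have "h x \<in> C" "x = g (h x)" using assms(2,4) by (simp_all add: fun_eq_iff)
    then show "x \<in> g ` C" by blast
  qed
qed (use assms in blast)

lemma fix_stab_subgroup:
  "subgroup {g \<in> isom. (\<forall>v\<in>F. g v = v) \<and> g ` C = C} (Sp (*s) s)" (is "subgroup ?H _")
proof (rule group.subgroupI[OF group_Sp])
  show "?H \<subseteq> isom" by blast
  have "id \<in> ?H" using isom_id by simp
  then show "?H \<noteq> {}" by blast
next
  fix g assume g: "g \<in> ?H"
  obtain h where h: "h \<in> isom" "g \<circ> h = id" "h \<circ> g = id" using isom_inverse g by blast
  have "inv\<^bsub>Sp (*s) s\<^esub> g = h"
    using h g by (intro group.inv_equality[OF group_Sp]) simp_all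
  moreover have "h ` C = C"
  proof -
    have "h ` C = h ` (g ` C)" using g by simp
    also have "\<dots> = (h \<circ> g) ` C" by (rule image_comp)
    finally show ?thesis by (simp add: h(3))
  qed
  moreover have "h v = v" if "v \<in> F" for v
    using that g h(3) by (metis (mono_tags, lifting) comp_apply id_apply mem_Collect_eq)
  ultimately show "inv\<^bsub>Sp (*s) s\<^esub> g \<in> ?H" using h by simp
next
  fix g h assume gh: "g \<in> ?H" "h \<in> ?H"
  have "(g \<circ> h) ` C = g ` (h ` C)" by (rule image_comp[symmetric])
  also have "\<dots> = C" using gh by simp
  finally show "g \<otimes>\<^bsub>Sp (*s) s\<^esub> h \<in> ?H" using gh isom_comp[of g h] by simp
qed

lemma tv_image:
  assumes "subspace C" "u \<in> C" shows "tv u c ` C = C"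
proof (rule isom_image_eqI[of "tv u (- c)"])
  have "tv u c x \<in> C" if "x \<in> C" for x c
    unfolding tv_def using that assms by (simp add: subspace_add subspace_scale)
  then show "tv u c x \<in> C" "tv u (- c) x \<in> C" if "x \<in> C" for x using that by blast+
qed (simp_all add: tv_add)

lemma tau_image:
  assumes "subspace C" "u \<in> C" "v \<in> C" "s u v = 0" shows "tau u v ` C = C"
proof (rule isom_image_eqI[of "tau u (- v)"])
  have "tau u v x \<in> C" if "x \<in> C" "u \<in> C" "v \<in> C" for x u v
    unfolding tau_def using that assms(1) by (simp add: subspace_add subspace_scale)
  then show "tau u v x \<in> C" "tau u (- v) x \<in> C" if "x \<in> C" for x
    using that assms subspace_neg by blast+
qed (use tau_inverse[OF assms(4)] in auto)

end

context hyperbolic_plane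
begin

lemma P_eq_span: "P = span {e, f}"
proof
  show "span {e, f} \<subseteq> P"
    by (rule span_minimal) (auto simp: subspace_def P_closed)
  show "P \<subseteq> span {e, f}"
  proof
    fix u assume "u \<in> P"
    then obtain a b where "u = a *s e + b *s f" using P_cases by blast
    then show "u \<in> span {e, f}" by (auto intro: span_add span_scale span_base)
  qed
qed

text \<open>Evaluation at \<open>f\<close> recovers \<open>v\<close>, and evaluation at the partner
  \<open>y\<close> of \<open>x\<close> recovers \<open>u\<close>, up to mutually inverse
  scalars.\<close>

lemma tau_eqD:
  assumes u: "u \<in> P" and v: "v \<in> W" and x: "x \<in> W" "y \<in> W" "s x y = 1"
    and eq: "tau u v = tau e x"
  shows "\<exists>c. c \<noteq> 0 \<and> u = c *s e \<and> v = (1 / c) *s x"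
proof -
  define c where "c = - s f u"
  have 1: "c *s v = x" using fun_cong[OF eq, of f] v x by (simp add: tau_def c_def)
  then have c: "c \<noteq> 0" using x(3) by auto
  then have v: "v = (1 / c) *s x" using 1 by auto
  have "s y x = - 1" using x(3) s_flip[of y x] by simp
  then have "(1 / c) *s u = e" using fun_cong[OF eq, of y] u x by (simp add: tau_def v)
  then have "u = c *s e" using c by auto
  then show ?thesis using c v by blast
qed

text \<open>\<open>h\<close> is the identity on \<open>P\<close>, which \<open>g\<close> preserves,
  and \<open>g\<close> is the identity on the complement of \<open>P\<close>, which \<open>h\<close>
  preserves.\<close>

lemma GL_commute:
  assumes "g \<in> GL" "h \<in> isom" "h e = e" "h f = f" shows "g \<circ> h = h \<circ> g"
proof
  fix x
  have hP: "h u = u" if "u \<in> P" for u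
    using P_cases[OF that] assms by (metis isom_add isom_scale)
  have h: "h x = proj x + h (x - proj x)"
    using isom_add[OF assms(2), of "proj x" "x - proj x"] hP[of "proj x"] by simp
  have "s (h (x - proj x)) e = 0" "s (h (x - proj x)) f = 0"
    using isom_s[OF assms(2), of "x - proj x" e] isom_s[OF assms(2), of "x - proj x" f]
      proj_perp[of x] assms by (auto simp: perp_def)
  then have "h (x - proj x) \<in> perp {e, f}" by (simp add: perp_def)
  then have "g (h x) = g (proj x) + h (x - proj x)"
    unfolding h isom_add[OF GL_isom[OF assms(1)]] using GL_perp assms(1) by simp
  moreover have "g x = g (proj x) + (x - proj x)"
    using isom_add[OF GL_isom[OF assms(1)], of "proj x" "x - proj x"] GL_perp[OF assms(1) proj_perp[of x]]
    by simp
  then have "h (g x) = g (proj x) + h (x - proj x)"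
    using isom_add[OF assms(2), of "g (proj x)" "x - proj x"] hP GL_P[OF assms(1)] by simp
  ultimately show "(g \<circ> h) x = (h \<circ> g) x" by simp
qed

end

section \<open>Hyperbolic bases\<close>

locale hyperbolic_space = symplectic_space scale s
  for scale :: "'a::field \<Rightarrow> 'v::ab_group_add \<Rightarrow> 'v" (infixr \<open>*s\<close> 75) and s +
  fixes n :: nat and e f :: "nat \<Rightarrow> 'v"
  assumes n: "n \<ge> 2" and basis: "hyperbolic_basis (*s) s n e f"
begin

lemma basis_s [simp]:
  assumes "i \<in> {1..n}" "j \<in> {1..n}"
  shows "s (e i) (e j) = 0" "s (f i) (f j) = 0" "s (e i) (f j) = (if i = j then 1 else 0)"
    "s (f i) (e j) = (if i = j then - 1 else 0)"
proof -
  show "s (e i) (e j) = 0" "s (f i) (f j) = 0" "s (e i) (f j) = (if i = j then 1 else 0)"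
    using basis assms unfolding hyperbolic_basis_def by blast+
  have "s (e j) (f i) = (if j = i then 1 else 0)"
    using basis assms unfolding hyperbolic_basis_def by blast
  then show "s (f i) (e j) = (if i = j then - 1 else 0)" using s_flip[of "f i" "e j"] by simp
qed

lemma basis_span: "x \<in> span (e ` {1..n} \<union> f ` {1..n})"
  using basis unfolding hyperbolic_basis_def by blast

lemma basis_test:
  assumes "\<And>j. j \<in> {1..n} \<Longrightarrow> s x (e j) = 0" "\<And>j. j \<in> {1..n} \<Longrightarrow> s x (f j) = 0"
  shows "x = 0"
proof -
  have "s x y = 0" for y
    using basis_span[of y]
    by (induction rule: span_induct_alt) (use assms in auto)
  then show ?thesis using s_nondeg by blast
qed

lemma isom_eqI:
  assumes "g \<in> isom" "h \<in> isom"
    "\<And>j. j \<in> {1..n} \<Longrightarrow> g (e j) = h (e j)" "\<And>j. j \<in> {1..n} \<Longrightarrow> g (f j) = h (f j)"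
  shows "g = h"
proof
  fix x show "g x = h x"
    using basis_span[of x]
    by (induction rule: span_induct_alt)
       (use assms in \<open>auto simp: isom_zero isom_add isom_scale\<close>)
qed

text \<open>The range stops before \<open>k\<close>: \<open>Z 1\<close> is empty, and for
  \<open>1 <= k <= n\<close> the planes with index at least \<open>k\<close> span
  \<open>perp (Z k)\<close>.\<close>

definition Z :: "nat \<Rightarrow> 'v set" where "Z k = e ` {1..<k} \<union> f ` {1..<k}"

lemma Z_Suc: "1 \<le> k \<Longrightarrow> Z (Suc k) = insert (e k) (insert (f k) (Z k))"
  unfolding Z_def by (auto simp: less_Suc_eq)

lemma ef_perp_Z:
  assumes "j \<in> {k..n}" "1 \<le> k" shows "e j \<in> perp (Z k)" "f j \<in> perp (Z k)"
  using assms by (auto simp: perp_def Z_def)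

lemma nondeg_Z:
  assumes x: "x \<in> perp (Z k)" "x \<noteq> 0" and k: "1 \<le> k" shows "\<exists>y\<in>perp (Z k). s x y \<noteq> 0"
proof -
  obtain j where j: "j \<in> {1..n}" "s x (e j) \<noteq> 0 \<or> s x (f j) \<noteq> 0"
    using basis_test[of x] x by blast
  have "k \<le> j"
  proof (rule ccontr)
    assume "\<not> k \<le> j"
    then have "e j \<in> Z k" "f j \<in> Z k" using j by (auto simp: Z_def)
    then show False using j x by (auto simp: perp_def)
  qed
  then show ?thesis using j ef_perp_Z[of j k] k by auto
qed

lemma plane: "k \<in> {1..n} \<Longrightarrow> hyperbolic_plane (*s) s (e k) (f k) (Z k)"
  using nondeg_Z[of _ "Suc k"] ef_perp_Z[of k k] by unfold_locales (auto simp: Z_Suc)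

end

section \<open>The amalgam of maximal parabolics\<close>

context hyperbolic_space
begin

declare One_nat_def [simp del]

lemma hvec_simps: "hvec e f 1 = e 1" "hvec e f 2 = f 1" "hvec e f 3 = e 2"
  by (simp_all add: hvec_def)

abbreviation C :: "nat \<Rightarrow> 'v set" where "C \<equiv> chamber_C (*s) e f"
abbreviation Par :: "nat \<Rightarrow> ('v \<Rightarrow> 'v) set" where "Par \<equiv> max_parabolic (*s) s e f"

lemma C_subspace: "subspace (C k)"
  by (simp add: chamber_C_def)

lemma C_simps: "C 1 = span {e 1}" "C 2 = span {e 1, f 1}" "C 3 = span {e 1, f 1, e 2}"
proof -
  have i: "{1..1::nat} = {1}" "{1..2::nat} = {1, 2}" "{1..3::nat} = {1, 2, 3}" by auto
  show "C 1 = span {e 1}" "C 2 = span {e 1, f 1}" "C 3 = span {e 1, f 1, e 2}"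
    unfolding chamber_C_def i by (simp_all only: image_insert image_empty hvec_simps)
qed

lemma Par_iff: "g \<in> Par k \<longleftrightarrow> g \<in> isom \<and> g ` C k = C k"
  by (simp add: max_parabolic_def)

lemma Par_subgroup: "subgroup (Par k) (Sp (*s) s)"
  using fix_stab_subgroup[of "{}" "C k"] by (simp add: max_parabolic_def)

lemma Par_comp: "g \<in> Par k \<Longrightarrow> h \<in> Par k \<Longrightarrow> g \<circ> h \<in> Par k"
  using subgroup.m_closed[OF Par_subgroup] by simp

lemma Par_1:
  assumes "g \<in> isom" "g (e 1) = c *s e 1" shows "g \<in> Par 1"
proof -
  have "s (e 1) (f 1) = 1" using n by simp
  then have "e 1 \<noteq> 0" by auto
  then have "c \<noteq> 0" using assms isom_eq_zero[of g "e 1"] by auto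
  have "g ` C 1 = span {c *s e 1}" using isom_span[OF assms(1)] assms(2) by (simp add: C_simps)
  also have "\<dots> = C 1"
    unfolding C_simps
  proof (rule span_eq[THEN iffD2], intro conjI)
    have "e 1 = (1 / c) *s (c *s e 1)" using \<open>c \<noteq> 0\<close> by simp
    then show "{e 1} \<subseteq> span {c *s e 1}" by (metis empty_subsetI insert_subset span_base span_scale singletonI)
    show "{c *s e 1} \<subseteq> span {e 1}" by (simp add: span_base span_scale)
  qed
  finally show ?thesis using assms by (simp add: Par_iff)
qed

lemma Par_1D:
  assumes "g \<in> Par 1" shows "\<exists>c. g (e 1) = c *s e 1"
proof -
  have "e 1 \<in> C 1" by (simp add: C_simps span_base)
  then have "g (e 1) \<in> span {e 1}" using assms unfolding Par_iff C_simps[symmetric] by blast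
  then show ?thesis by (auto simp: span_singleton)
qed

interpretation pl: hyperbolic_plane "(*s)" s "e 1" "f 1" "Z 1"
  using plane[of 1] n by simp

lemma Z_1: "Z 1 = {}"
  by (simp add: Z_def)

lemma W_ef: "j \<in> {2..n} \<Longrightarrow> e j \<in> pl.W" "j \<in> {2..n} \<Longrightarrow> f j \<in> pl.W"
  unfolding pl.W_iff by (auto simp: Z_1 perp_def)

lemma hvec_W:
  assumes "i \<in> {3..2 * n - 1}" shows "hvec e f i \<in> pl.W"
proof (cases "odd i")
  case True
  then have "(i + 1) div 2 \<in> {2..n}" using assms by (auto elim!: oddE)
  then show ?thesis using W_ef True by (simp add: hvec_def)
next
  case False
  then have "i div 2 \<in> {2..n}" using assms by (auto elim!: evenE)
  then show ?thesis using W_ef False by (simp add: hvec_def)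
qed

lemma C_mono: "k \<le> l \<Longrightarrow> C k \<subseteq> C l"
  unfolding chamber_C_def by (intro span_mono image_mono) auto

text \<open>From index 2 on, \<open>C k\<close> contains the whole plane \<open>P\<close>, and its
  further spanning vectors lie in \<open>W\<close>, where \<open>GL\<close> acts trivially.\<close>

lemma GL_Par:
  assumes g: "g \<in> pl.GL" and k: "2 \<le> k" "k \<le> 2 * n - 1" shows "g \<in> Par k"
proof -
  have P: "pl.P \<subseteq> C k" using C_mono[OF k(1)] by (simp add: pl.P_eq_span C_simps)
  have *: "g ` C k \<subseteq> C k" if g: "g \<in> pl.GL" for g
  proof -
    have "g (hvec e f i) \<in> C k" if i: "i \<in> {1..k}" for i
    proof (cases "i \<ge> 3")
      case True
      then have "g (hvec e f i) = hvec e f i" using i k hvec_W pl.GL_W[OF g] by simp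
      then show ?thesis using i unfolding chamber_C_def by (auto intro: span_base)
    next
      case False
      then have "i = 1 \<or> i = 2" using i by auto
      then have "hvec e f i \<in> pl.P" using hvec_simps by fastforce
      then show ?thesis using P pl.GL_P[OF g] by blast
    qed
    then have "g ` hvec e f ` {1..k} \<subseteq> C k" by blast
    then have "span (g ` hvec e f ` {1..k}) \<subseteq> C k" using C_subspace by (rule span_minimal)
    then show ?thesis using isom_span[OF pl.GL_isom[OF g]] by (simp add: chamber_C_def)
  qed
  obtain h where h: "h \<in> pl.GL" "g \<circ> h = id" "h \<circ> g = id" using pl.GL_inverse[OF g] .
  have "g ` C k = C k" using *[OF g] *[OF h(1)] h by (intro isom_image_eqI[of h]) auto
  then show ?thesis using pl.GL_isom[OF g] by (simp add: Par_iff)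
qed

lemma GR_Par:
  assumes g: "g \<in> pl.GR" and k: "k = 1 \<or> k = 2" shows "g \<in> Par k"
proof -
  have "g (e 1) = e 1" "g (f 1) = f 1" using pl.GR_P[OF g] by simp_all
  then have "g ` C k = C k" using k isom_span[OF pl.GR_isom[OF g]] by (elim disjE) (simp_all add: C_simps)
  then show ?thesis using pl.GR_isom[OF g] by (simp add: Par_iff)
qed

theorem parabolic_completion:
  "is_universal_completion (Sp (*s) s) (parabolic_amalgam (*s) s n e f)"
proof (rule is_universal_completionI[OF group_Sp])
  let ?A = "parabolic_amalgam (*s) s n e f"
  fix X assume "X \<in> ?A"
  then show "subgroup X (Sp (*s) s)" using Par_subgroup by (auto simp: parabolic_amalgam_def)
next
  let ?A = "parabolic_amalgam (*s) s n e f"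
  fix \<phi> :: "('v \<Rightarrow> 'v) \<Rightarrow> 'v perm \<times> (('v \<Rightarrow> 'v) \<times> bool) list set perm"
  assume hom: "\<And>X x y. X \<in> ?A \<Longrightarrow> x \<in> X \<Longrightarrow> y \<in> X \<Longrightarrow> \<phi> (x \<circ> y) = \<phi> x + \<phi> y"
    and sec: "\<And>x. x \<in> \<Union>?A \<Longrightarrow> app (fst (\<phi> x)) = x"
  define \<pi> :: "'v perm \<times> (('v \<Rightarrow> 'v) \<times> bool) list set perm \<Rightarrow> 'v \<Rightarrow> 'v" where "\<pi> = app \<circ> fst"
  have A: "Par k \<in> ?A" if "k \<in> {1..2 * n - 1}" for k using that by (auto simp: parabolic_amalgam_def)
  have hom: "\<phi> (x \<circ> y) = \<phi> x + \<phi> y" if "x \<in> Par k" "y \<in> Par k" "k \<in> {1..2 * n - 1}" for x y k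
    using hom[OF A] that by blast
  have sec: "\<pi> (\<phi> x) = x" if "x \<in> Par k" "k \<in> {1..2 * n - 1}" for x k
    using sec A that unfolding \<pi>_def by auto
  have k: "1 \<in> {1..2 * n - 1}" "2 \<in> {1..2 * n - 1}" "3 \<in> {1..2 * n - 1}"
    "1 \<le> 2 * n - 1" "2 \<le> 2 * n - 1" "3 \<le> 2 * n - 1" using n by auto
  have GL: "g \<in> Par k" if "g \<in> pl.GL" "k \<in> {2..2 * n - 1}" for g k using that GL_Par by simp
  have GR: "g \<in> Par 1" "g \<in> Par 2" if "g \<in> pl.GR" for g using that GR_Par by simp_all
  have e2: "e 2 \<in> pl.W" "f 2 \<in> pl.W" "s (e 2) (f 2) = 1" using W_ef n by simp_all
  have tau1: "tau (e 1) w \<in> Par 1" if "w \<in> pl.W" for w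
    using that by (intro Par_1[of _ 1] tau_isom) (simp_all add: tau_def)
  have tv1: "tv (e 1) c \<in> Par 1" for c
    by (intro Par_1[of _ 1] tv_isom) (simp_all add: tv_def)
  \<comment> \<open>\<open>Par 2\<close> contains both \<open>GL\<close> and \<open>GR\<close>, so
    their commuting is a relation of the amalgam; here \<open>L\<close> and \<open>R\<close> are
    both \<open>\<phi>\<close>.\<close>
  interpret sr: split_rep "(*s)" s "e 1" "f 1" "Z 1" \<pi> "e 2" "f 2" \<phi> \<phi>
  proof unfold_locales
    fix g h
    show "\<phi> (g \<circ> h) = \<phi> g + \<phi> h" if "g \<in> pl.GL" "h \<in> pl.GL"
      using that hom[OF GL GL, of g 2 h] n by simp
    show "\<phi> (g \<circ> h) = \<phi> g + \<phi> h" if "g \<in> pl.GR" "h \<in> pl.GR"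
      using that hom[OF GR(1) GR(1), of g h] k by simp
    show "\<pi> (\<phi> g) = g" if "g \<in> pl.GL" using that sec[OF GL, of g 2] k by simp
    show "\<pi> (\<phi> g) = g" if "g \<in> pl.GR" using that sec[OF GR(1)] k by simp
    show "\<phi> g + \<phi> h = \<phi> h + \<phi> g" if g: "g \<in> pl.GL" "h \<in> pl.GR"
    proof -
      have "g \<circ> h = h \<circ> g"
        by (rule pl.GL_commute) (simp_all add: g pl.GR_isom pl.GR_P)
      moreover have "g \<in> Par 2" "h \<in> Par 2" using GL GR g n by simp_all
      ultimately show ?thesis using hom[of g 2 h] hom[of h 2 g] k by simp
    qed
  qed (use e2 in \<open>simp_all add: \<pi>_def plus_perm.rep_eq zero_perm.rep_eq\<close>)
  have comm1: "\<phi> g + \<phi> t = \<phi> t' + \<phi> g"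
    if "g \<in> Par k" "t \<in> Par k" "t' \<in> Par k" "g \<circ> t = t' \<circ> g" "k \<in> {1..2 * n - 1}" for g t t' k
    using hom[of g k t] hom[of t' k g] that by simp
  interpret cs: conj_system "(*s)" s "e 1" "f 1" "Z 1" \<pi> "e 2" "f 2" \<phi> \<phi> "\<phi> (tau (e 1) (e 2))"
  proof unfold_locales
    show "\<pi> (\<phi> (tau (e 1) (e 2))) = tau (e 1) (e 2)" using sec tau1 e2 k by blast
    fix g h assume gh: "g \<in> pl.GL" "h \<in> pl.GR" "tau (g (e 1)) (h (e 2)) = tau (e 1) (e 2)"
    \<comment> \<open>Stabilising the short root element forces \<open>g\<close> to scale
      \<open>e 1\<close>, so the whole stabiliser lies in \<open>Par 1\<close> together with
      \<open>tau (e 1) (e 2)\<close>.\<close>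
    then obtain c where "g (e 1) = c *s e 1"
      using pl.tau_eqD[OF pl.GL_P[OF gh(1) pl.P_ef(1)] pl.GR_W[OF gh(2) e2(1)] e2 gh(3)] by blast
    then have g1: "g \<in> Par 1" using Par_1 pl.GL_isom gh by blast
    have h1: "h \<in> Par 1" using GR gh by simp
    have "(g \<circ> h) \<circ> tau (e 1) (e 2) = tau (e 1) (e 2) \<circ> (g \<circ> h)"
      using isom_tau[of "g \<circ> h" "e 1" "e 2"] isom_comp pl.GL_isom pl.GR_isom gh e2
        pl.GR_P[OF gh(2)] pl.GL_W[OF gh(1) pl.GR_W[OF gh(2)]] by simp
    then have "\<phi> (g \<circ> h) + \<phi> (tau (e 1) (e 2)) = \<phi> (tau (e 1) (e 2)) + \<phi> (g \<circ> h)"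
      using comm1[OF Par_comp[OF g1 h1]] tau1 e2 k by blast
    then show "\<phi> g + \<phi> h + \<phi> (tau (e 1) (e 2)) = \<phi> (tau (e 1) (e 2)) + (\<phi> g + \<phi> h)"
      using hom[OF g1 h1] k by simp
  qed
  \<comment> \<open>\<open>Par 1\<close> contains \<open>GR\<close> and every
    \<open>tau (e 1) w\<close>, so the conjugation defining \<open>T\<close> takes place inside it
    and \<open>T_right\<close> becomes a relation of \<open>Par 1\<close>.\<close>
  have T1: "cs.T (e 1) w = \<phi> (tau (e 1) w)" if w: "w \<in> pl.W" for w
  proof (cases "w = 0")
    case False
    then obtain h where h: "h \<in> pl.GR" "h (e 2) = w"
      using pl.GR_transitive e2 w cs.e2_nonzero by blast
    have "\<phi> h + \<phi> (tau (e 1) (e 2)) = \<phi> (tau (e 1) w) + \<phi> h"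
      using isom_tau[OF pl.GR_isom[OF h(1)], of "e 1" "e 2"] h w e2 k
      by (intro comm1[of _ 1] GR tau1) (simp_all add: pl.GR_P)
    then show ?thesis using cs.T_e_conj[OF h] by simp
  qed simp
  have C3: "e 2 \<in> C 3" "u \<in> pl.P \<Longrightarrow> u \<in> C 3" for u
    using C_mono[of 2 3] by (auto simp: C_simps pl.P_eq_span span_base)
  \<comment> \<open>\<open>Par 3\<close>, present because \<open>n \<ge> 2\<close>, plays the same
    role for \<open>T_left\<close>: \<open>C 3\<close> contains the plane and
    \<open>e 2\<close>.\<close>
  have tau3: "tau u (e 2) \<in> Par 3" if "u \<in> pl.P" for u
    using that C3 e2 C_subspace by (simp add: Par_iff tau_isom tau_image)
  have tv3: "tv (e 2) c \<in> Par 3" for c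
    using C3 C_subspace by (simp add: Par_iff tv_isom tv_image)
  have T3: "cs.T u (e 2) = \<phi> (tau u (e 2))" if u: "u \<in> pl.P" for u
  proof (cases "u = 0")
    case False
    then obtain h where h: "h \<in> pl.GL" "h (e 1) = u" using pl.GL_transitive u by blast
    have "\<phi> h + \<phi> (tau (e 1) (e 2)) = \<phi> (tau u (e 2)) + \<phi> h"
      using isom_tau[OF pl.GL_isom[OF h(1)], of "e 1" "e 2"] h u e2 k
      by (intro comm1[of _ 3] GL tau3) (simp_all add: pl.GL_W)
    then show ?thesis using cs.T_e2_conj[OF h] by simp
  qed simp
  have "heisenberg_system (*s) s (e 1) (f 1) (Z 1) \<pi> (e 2) (f 2) \<phi> \<phi> cs.T"
  proof (rule cs.heisenberg_systemI)
    show "cs.additive_pair v v'" if "v \<in> pl.W" "v' \<in> pl.W" for v v'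
      using that hom[of "tau (e 1) v" 1 "tau (e 1) v'"]
        hom[of "tau (e 1) (v + v')" 1 "tv (e 1) (s v' v)"] tau_add_right[of "e 1" v v']
      by (simp add: cs.additive_pair_def T1 pl.W_closed tau1 tv1 k)
    show "cs.T u (e 2) + cs.T u' (e 2) = cs.T (u + u') (e 2) + \<phi> (tv (e 2) (s u' u))"
      if "u \<in> pl.P" "u' \<in> pl.P" for u u'
      using that hom[of "tau u (e 2)" 3 "tau u' (e 2)"] e2
        hom[of "tau (u + u') (e 2)" 3 "tv (e 2) (s u' u)"] tau_add_left[of u "e 2" u']
      by (simp add: T3 pl.P_closed tau3 tv3 k)
  qed
  then interpret hs: heisenberg_system "(*s)" s "e 1" "f 1" "Z 1" \<pi> "e 2" "f 2" \<phi> \<phi> cs.T .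
  \<comment> \<open>An element of \<open>Par 1\<close> is an element of \<open>GL\<close> scaling
    \<open>e 1\<close> times an element fixing \<open>e 1\<close>, to which
    \<open>stab_decomp\<close> applies; all factors stay in \<open>Par 1\<close>.\<close>
  have U1: "\<phi> g \<in> hs.U" if g: "g \<in> Par 1" for g
  proof -
    obtain c where c: "g (e 1) = c *s e 1" using Par_1D g by blast
    have gi: "g \<in> isom" using g by (simp add: Par_iff)
    have "c \<noteq> 0" using c isom_eq_zero[OF gi, of "e 1"] pl.e_nonzero by auto
    then obtain d where d: "d \<in> pl.GL" "d (e 1) = c *s e 1" using pl.GL_diag by blast
    obtain d' where d': "d' \<in> pl.GL" "d \<circ> d' = id" "d' \<circ> d = id" using pl.GL_inverse[OF d(1)] .
    have "(d' \<circ> g) (e 1) = e 1" using d'(3) c d(2) by (metis comp_apply id_apply)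
    moreover have "d' \<circ> g \<in> fixer (Z 1)"
      using isom_comp[OF pl.GL_isom[OF d'(1)] gi] by (simp add: Z_1 fixer_def)
    ultimately obtain w a h where w: "w \<in> pl.W" "h \<in> pl.GR" "d' \<circ> g = tau (e 1) w \<circ> tv (e 1) a \<circ> h"
      using pl.stab_decomp by blast
    have d1: "d \<in> Par 1" using Par_1 d pl.GL_isom by blast
    have "g = d \<circ> (tau (e 1) w \<circ> tv (e 1) a \<circ> h)"
      using w(3) d'(2) by (metis comp_assoc id_comp)
    then have "\<phi> g = \<phi> d + (cs.T (e 1) w + \<phi> (tv (e 1) a) + \<phi> h)"
      using hom[OF d1, of "tau (e 1) w \<circ> tv (e 1) a \<circ> h"] hom[of "tau (e 1) w \<circ> tv (e 1) a" 1 h]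
        hom[of "tau (e 1) w" 1 "tv (e 1) a"] Par_comp[of _ 1] tau1 tv1 GR(1) k w
      by (simp add: T1)
    also have "\<dots> \<in> hs.U" using d w by (intro hs.U_add hs.U_L hs.U_T hs.U_R pl.tv_GL pl.P_ef)
    finally show ?thesis .
  qed
  have UL: "\<phi> g \<in> hs.U" if g: "g \<in> pl.GL" for g using hs.U_L g .
  have transfer: "\<phi> g \<in> hs.U" if "x \<in> Par k" "g \<in> Par k" "\<phi> x \<in> hs.U" "k \<in> {1..2 * n - 1}"
    "\<phi> (x \<circ> g) \<in> hs.U" for x g k
  proof -
    have "\<phi> g = - \<phi> x + \<phi> (x \<circ> g)" using hom[of x k g] that by simp
    then show ?thesis using hs.U_add hs.U_minus that by metis
  qed
  \<comment> \<open>The aim is to multiply \<open>g\<close> by elements of \<open>Par m\<close>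
    already known to lie in \<open>U\<close> until the product fixes \<open>e 1\<close> and so
    belongs to \<open>Par 1\<close>.\<close>
  have Uk: "\<phi> g \<in> hs.U" if g: "g \<in> Par m" and m: "m \<in> {2..2 * n - 1}" for g m
  proof -
    have m': "m \<in> {1..2 * n - 1}" using m by simp
    have ef: "e 1 \<in> C m" "f 1 \<in> C m" using C_mono[of 2 m] m by (auto simp: C_simps span_base)
    have proj: "pl.proj x \<in> C m" for x
      unfolding pl.proj_def using ef C_subspace by (simp add: subspace_diff subspace_scale)
    have W: "x - pl.proj x \<in> pl.W" for x by (rule pl.Z0_proj_W) (simp add: Z_1 perp_def)
    have Cg: "g x \<in> C m" if "g \<in> Par m" "x \<in> C m" for g x using that by (auto simp: Par_iff)
    have CW: "x - pl.proj x \<in> C m" if "x \<in> C m" for x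
      using that proj C_subspace by (simp add: subspace_diff)
    have tauU: "tau (e 1) w \<in> Par m \<and> \<phi> (tau (e 1) w) \<in> hs.U" if "w \<in> pl.W" "w \<in> C m" for w
      using that ef U1 tau1 C_subspace by (simp add: Par_iff tau_isom tau_image)
    \<comment> \<open>For nonzero \<open>w\<close> the isometry \<open>tau (f 1) w\<close> is not in
      \<open>Par 1\<close>; it is reached inside \<open>Par m\<close> as a conjugate of
      \<open>tau (e 1) w\<close>.\<close>
    obtain j where j: "j \<in> pl.GL" "j (e 1) = f 1" using pl.GL_transitive[of "f 1"] by auto
    have taufU: "tau (f 1) w \<in> Par m \<and> \<phi> (tau (f 1) w) \<in> hs.U" if w: "w \<in> pl.W" "w \<in> C m" for w
    proof
      show *: "tau (f 1) w \<in> Par m" using w ef C_subspace by (simp add: Par_iff tau_isom tau_image)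
      have "j \<circ> tau (e 1) w = tau (f 1) w \<circ> j"
        using isom_tau[OF pl.GL_isom[OF j(1)], of "e 1" w] j w by (simp add: pl.GL_W)
      then have "\<phi> (tau (f 1) w) = \<phi> j + \<phi> (tau (e 1) w) + - \<phi> j"
        using comm1[of j m "tau (e 1) w" "tau (f 1) w"] * tauU[OF w] GL[OF j(1) m] m' by simp
      then show "\<phi> (tau (f 1) w) \<in> hs.U"
        using hs.U_add hs.U_minus tauU[OF w] UL j by metis
    qed
    have main: "\<phi> g \<in> hs.U" if g: "g \<in> Par m" and nz: "pl.proj (g (e 1)) \<noteq> 0" for g
    proof -
      define w where "w = g (e 1) - pl.proj (g (e 1))"
      have w: "w \<in> pl.W" "w \<in> C m" unfolding w_def using W CW Cg[OF g] ef by blast+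
      obtain l where l: "l \<in> pl.GL" "l (e 1) = pl.proj (g (e 1))" using pl.GL_transitive[OF pl.proj_P nz] by blast
      obtain l' where l': "l' \<in> pl.GL" "l \<circ> l' = id" "l' \<circ> l = id" using pl.GL_inverse[OF l(1)] .
      have "g (e 1) = l (e 1) + w" by (simp add: w_def l)
      then have "l' (g (e 1)) = l' (l (e 1)) + l' w"
        using isom_add[OF pl.GL_isom[OF l'(1)]] by simp
      also have "\<dots> = e 1 + w" using l'(3) l'(1) w by (simp add: fun_eq_iff pl.GL_W)
      finally have "(tau (f 1) (- w) \<circ> (l' \<circ> g)) (e 1) = 1 *s e 1"
        using w by (simp add: tau_def pl.W_closed)
      moreover have mw: "- w \<in> pl.W" "- w \<in> C m" using w pl.W_closed C_subspace by (auto simp: subspace_neg)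
      have i: "l' \<circ> g \<in> Par m" using Par_comp GL l' m g by blast
      have "tau (f 1) (- w) \<circ> (l' \<circ> g) \<in> Par m" using Par_comp i taufU[OF mw] by blast
      then have "tau (f 1) (- w) \<circ> (l' \<circ> g) \<in> isom" by (simp add: Par_iff)
      ultimately have "\<phi> (tau (f 1) (- w) \<circ> (l' \<circ> g)) \<in> hs.U" using U1 Par_1 by blast
      then have "\<phi> (l' \<circ> g) \<in> hs.U" using transfer[OF _ i _ m'] taufU[OF mw] by blast
      then show ?thesis using transfer[OF GL[OF l'(1) m] g _ m'] UL l' by blast
    qed
    show ?thesis
    proof (cases "pl.proj (g (e 1)) = 0")
      case True
      have gi: "g \<in> isom" using g by (simp add: Par_iff)
      \<comment> \<open>Here \<open>g (e 1)\<close> lies in \<open>W\<close>. Its product with the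
        \<open>W\<close>-part \<open>b\<close> of \<open>g (f 1)\<close> is 1, so
        \<open>tau (e 1) b\<close> adds \<open>e 1\<close> to it and gives a nonzero
        \<open>P\<close>-component.\<close>
      define b where "b = g (f 1) - pl.proj (g (f 1))"
      have b: "b \<in> pl.W" "b \<in> C m" unfolding b_def using W CW Cg[OF g] ef by blast+
      have gW: "g (e 1) \<in> pl.W" using W[of "g (e 1)"] True by simp
      have "s (g (e 1)) b = s (g (e 1)) (g (f 1))" using gW by (simp add: b_def)
      also have "\<dots> = 1" using isom_s[OF gi] by simp
      finally have "(tau (e 1) b \<circ> g) (e 1) = g (e 1) + e 1"
        using gW by (simp add: tau_def)
      then have "pl.proj ((tau (e 1) b \<circ> g) (e 1)) \<noteq> 0"
        using gW by (simp add: pl.proj_def)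
      then have "\<phi> (tau (e 1) b \<circ> g) \<in> hs.U" using main Par_comp tauU[OF b] g by blast
      then show ?thesis using transfer[OF _ g _ m'] tauU[OF b] by blast
    qed (use main g in blast)
  qed
  have sub: "\<phi> ` \<Union>?A \<subseteq> hs.U"
  proof (intro image_subsetI, elim UnionE)
    fix g X assume "X \<in> ?A" "g \<in> X"
    then obtain m where m: "g \<in> Par m" "m \<in> {1..2 * n - 1}" by (auto simp: parabolic_amalgam_def)
    show "\<phi> g \<in> hs.U"
    proof (cases "m = 1")
      case False
      then have "m \<in> {2..2 * n - 1}" using m by auto
      then show ?thesis using Uk m by blast
    qed (use U1 m in blast)
  qed
  have "sgen (\<phi> ` \<Union>?A) \<subseteq> hs.U" using sub unfolding hs.U_def by (rule sgen_least)
  then have "inj_on \<pi> (sgen (\<phi> ` \<Union>?A))" using hs.inj_U by (rule inj_on_subset[rotated])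
  moreover have "hs.U \<subseteq> sgen (\<phi> ` \<Union>?A)"
    unfolding hs.U_def
  proof (rule sgen_least, intro Un_least image_subsetI)
    have *: "\<phi> x \<in> sgen (\<phi> ` \<Union>?A)" if "x \<in> Par k" "k \<in> {1..2 * n - 1}" for x k
      using that A by (intro sgen_base imageI) blast
    show "\<phi> x \<in> sgen (\<phi> ` \<Union>?A)" if "x \<in> pl.GL" for x using * GL[OF that, of 2] k by auto
    show "\<phi> x \<in> sgen (\<phi> ` \<Union>?A)" if "x \<in> pl.GR" for x using * GR[OF that] k by auto
    show "cs.T (e 1) x \<in> sgen (\<phi> ` \<Union>?A)" if "x \<in> pl.W" for x using * tau1[OF that] T1[OF that] k by auto
  qed
  then have "\<pi> ` hs.U \<subseteq> \<pi> ` sgen (\<phi> ` \<Union>?A)" by (rule image_mono)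
  then have "isom \<subseteq> \<pi> ` sgen (\<phi> ` \<Union>?A)" unfolding hs.pi_U by (simp add: Z_1 fixer_def)
  ultimately show "inj_on (app \<circ> fst) (sgen (\<phi> ` \<Union>?A)) \<and> isom \<subseteq> (app \<circ> fst) ` sgen (\<phi> ` \<Union>?A)"
    by (simp add: \<pi>_def)
qed (simp_all add: isom_bij)

end

section \<open>The amalgam of slim parabolics\<close>

context hyperbolic_space
begin

abbreviation S :: "nat \<Rightarrow> ('v \<Rightarrow> 'v) set" where "S \<equiv> S_pi (*s) s n e f"
abbreviation M :: "nat \<Rightarrow> ('v \<Rightarrow> 'v) set" where "M \<equiv> M_pi (*s) s n e f"

text \<open>An element of \<open>S k\<close> preserves the plane and hence its complement, and it
  keeps products with the other basis vectors. So for \<open>x\<close> in the complement,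
  \<open>g x - x\<close> is orthogonal to the whole basis.\<close>

lemma S_eq:
  assumes k: "k \<in> {1..n}" shows "S k = fixer (perp {e k, f k})"
proof -
  interpret pl: hyperbolic_plane "(*s)" s "e k" "f k" "Z k" using plane k .
  have P: "span {e k, f k} = pl.P" by (simp add: pl.P_eq_span)
  show ?thesis
  proof (intro subset_antisym subsetI)
    fix g assume g: "g \<in> fixer (perp {e k, f k})"
    then have GL: "g \<in> pl.GL" by (simp add: pl.GL_def)
    obtain h where h: "h \<in> pl.GL" "g \<circ> h = id" "h \<circ> g = id" using pl.GL_inverse[OF GL] .
    have "g ` pl.P = pl.P" using GL h pl.GL_P by (intro isom_image_eqI[of h]) auto
    moreover have "g v = v" if v: "v \<in> hyp_set n e f - {e k, f k}" for v
    proof -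
      obtain j where "j \<in> {1..n}" "v = e j \<or> v = f j" using v by (auto simp: hyp_set_def)
      moreover from this have "j \<noteq> k" using v by auto
      ultimately have "v \<in> perp {e k, f k}" using k by (auto simp: perp_def)
      then show ?thesis using fixer_fix[OF g] by blast
    qed
    ultimately show "g \<in> S k" using fixer_isom[OF g] by (simp add: S_pi_def P)
  next
    fix g assume "g \<in> S k"
    then have g: "g \<in> isom" "g ` pl.P = pl.P" "\<And>v. v \<in> hyp_set n e f - {e k, f k} \<Longrightarrow> g v = v"
      by (auto simp: S_pi_def P)
    have "g x = x" if x: "x \<in> perp {e k, f k}" for x
    proof -
      have P0: "s (g x) u = 0" if u: "u \<in> pl.P" for u
      proof -
        obtain u' where u': "u' \<in> pl.P" "u = g u'" using u g(2) by blast
        then have "s (g x) u = s x u'" using isom_s[OF g(1)] by simp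
        then show ?thesis using pl.P_perp[OF u'(1) x] s_flip[of x u'] by simp
      qed
      have "s (g x - x) y = 0" if y: "y \<in> hyp_set n e f" for y
      proof (cases "y \<in> {e k, f k}")
        case True
        then show ?thesis using P0[of y] x by (auto simp: perp_def)
      next
        case False
        then have "g y = y" using g(3) y by blast
        then show ?thesis using isom_s[OF g(1), of x y] by simp
      qed
      then have "g x - x = 0" by (intro basis_test) (auto simp: hyp_set_def)
      then show ?thesis by simp
    qed
    then show "g \<in> fixer (perp {e k, f k})" using g by (simp add: fixer_def)
  qed
qed

lemma S_Z:
  assumes "k \<in> {1..n}" "j \<in> {k..n}" shows "S j \<subseteq> fixer (Z k)"
proof -
  have "Z k \<subseteq> perp {e j, f j}" using assms by (auto simp: Z_def perp_def)
  then show ?thesis using assms by (auto simp: S_eq fixer_def)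
qed

text \<open>At the last index \<open>W\<close> is zero and \<open>perp (Z n)\<close> is just the
  plane, so the remaining isometries form one \<open>S n\<close>; this is the base of the
  induction.\<close>

lemma fixer_Z_n: "fixer (Z n) = S n"
proof (intro subset_antisym subsetI)
  have n1: "n \<in> {1..n}" using n by simp
  interpret pl: hyperbolic_plane "(*s)" s "e n" "f n" "Z n" using plane n1 .
  fix g assume g: "g \<in> fixer (Z n)"
  have W0: "w = 0" if "w \<in> pl.W" for w
  proof (rule basis_test)
    fix j assume "j \<in> {1..n}"
    then have "e j \<in> insert (e n) (insert (f n) (Z n))" "f j \<in> insert (e n) (insert (f n) (Z n))"
      unfolding Z_def by (cases "j = n"; auto)+
    then show "s w (e j) = 0" "s w (f j) = 0" using that unfolding pl.W_def perp_def by blast+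
  qed
  have P: "x \<in> pl.P" if "x \<in> perp (Z n)" for x
    using W0[OF pl.Z0_proj_W[OF that]] pl.proj_P[of x] by simp
  obtain h where h: "h \<in> fixer (Z n)" "g \<circ> h = id" using fixer_inverse[OF g] .
  have "g x = x" if x: "x \<in> perp {e n, f n}" for x
  proof -
    have "s (g x - x) y = 0" if y: "y \<in> perp (Z n)" for y
    proof -
      have "g (h y) = y" using h(2) by (simp add: fun_eq_iff)
      then have "s (g x) y = s x (h y)" using isom_s[OF fixer_isom[OF g], of x "h y"] by simp
      moreover have "s x u = 0" if "u \<in> perp (Z n)" for u
        using pl.P_perp[OF P[OF that] x] s_flip[of x u] by simp
      ultimately show ?thesis using y fixer_perp[OF h(1) y] by simp
    qed
    moreover have "s (g x - x) z = 0" if "z \<in> Z n" for z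
      using isom_s[OF fixer_isom[OF g], of x z] fixer_fix[OF g that] by simp
    moreover have "e j \<in> perp (Z n) \<or> e j \<in> Z n" "f j \<in> perp (Z n) \<or> f j \<in> Z n" if "j \<in> {1..n}" for j
      using that n1 ef_perp_Z[of n n] by (cases "j = n"; auto simp: Z_def)+
    ultimately have "g x - x = 0" by (intro basis_test) blast+
    then show ?thesis by simp
  qed
  then show "g \<in> S n" using g n1 by (simp add: S_eq fixer_def)
qed (use S_Z[of n n] n in auto)

text \<open>\<open>M_pi\<close> removes two vectors from a set, so distinctness is what guarantees
  that the \<open>e j\<close> and the other \<open>f j\<close> remain among the fixed ones.\<close>

lemma ef_distinct:
  assumes "i \<in> {1..n}" "j \<in> {1..n}" shows "e i \<noteq> f j" "f i = f j \<longleftrightarrow> i = j"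
proof -
  show "e i \<noteq> f j" using basis_s(1,3)[of i j] basis_s(2)[of j j] basis_s(3)[of i i] basis_s(2)[of j i] assms
    by (metis one_neq_zero)
  show "f i = f j \<longleftrightarrow> i = j" using basis_s(3)[of i i] basis_s(3)[of i j] assms by (metis one_neq_zero)
qed

lemma M_iff: "g \<in> M i \<longleftrightarrow> g \<in> isom \<and> (\<forall>v\<in>hyp_set n e f - {f i, f (Suc i)}. g v = v) \<and>
    g ` span {e i, f i, e (Suc i), f (Suc i)} = span {e i, f i, e (Suc i), f (Suc i)}"
  by (simp add: M_pi_def Suc_eq_plus1 del: One_nat_def)

lemma M_fix:
  assumes g: "g \<in> M i" and i: "i \<in> {1..<n}" and j: "j \<in> {1..n}"
  shows "g (e j) = e j" "j \<noteq> i \<Longrightarrow> j \<noteq> Suc i \<Longrightarrow> g (f j) = f j"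
proof -
  have i': "i \<in> {1..n}" "Suc i \<in> {1..n}" using i by auto
  have fx: "g v = v" if "v \<in> hyp_set n e f" "v \<noteq> f i" "v \<noteq> f (Suc i)" for v
    using g that by (simp add: M_iff)
  show "g (e j) = e j" using j ef_distinct i' by (intro fx) (auto simp: hyp_set_def)
  show "g (f j) = f j" if "j \<noteq> i" "j \<noteq> Suc i"
    using j ef_distinct(2)[OF j] i' that by (intro fx) (auto simp: hyp_set_def)
qed

lemma M_isom: "g \<in> M i \<Longrightarrow> g \<in> isom"
  by (simp add: M_pi_def Suc_eq_plus1 del: One_nat_def)

lemma S_isom: "g \<in> S i \<Longrightarrow> g \<in> isom"
  by (simp add: S_pi_def)

lemma M_mem:
  assumes i: "i \<in> {1..<n}"
  shows "tv (e i) c \<in> M i" "tv (e (Suc i)) c \<in> M i" "tau (e i) (c *s e (Suc i)) \<in> M i"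
proof -
  have i': "i \<in> {1..n}" "Suc i \<in> {1..n}" using i by auto
  let ?D = "span {e i, f i, e (Suc i), f (Suc i)}"
  have D: "e i \<in> ?D" "e (Suc i) \<in> ?D" "c *s e (Suc i) \<in> ?D"
    by (auto intro: span_base span_scale)
  have fx: "s v (e i) = 0" "s v (e (Suc i)) = 0" if v: "v \<in> hyp_set n e f - {f i, f (Suc i)}" for v
  proof -
    have "\<exists>j\<in>{1..n}. v = e j \<or> (v = f j \<and> j \<noteq> i \<and> j \<noteq> Suc i)"
      using v by (auto simp: hyp_set_def)
    then show "s v (e i) = 0" "s v (e (Suc i)) = 0" using i' by auto
  qed
  have o: "s (e i) (c *s e (Suc i)) = 0" using i' by simp
  have "tv (e i) c v = v" "tv (e (Suc i)) c v = v" "tau (e i) (c *s e (Suc i)) v = v"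
    if "v \<in> hyp_set n e f - {f i, f (Suc i)}" for v
    using fx[OF that] by (simp_all add: tv_def tau_def)
  then show "tv (e i) c \<in> M i" "tv (e (Suc i)) c \<in> M i" "tau (e i) (c *s e (Suc i)) \<in> M i"
    unfolding M_iff using tv_isom tau_isom[OF o] tv_image[OF subspace_span] D
      tau_image[OF subspace_span D(1,3) o] by blast+
qed

text \<open>\<open>M i\<close> corresponds to the symmetric 2 by 2 matrices, recording the changes
  of \<open>f i\<close> and \<open>f (i + 1)\<close>: the transvections give the diagonal entries
  and \<open>tau\<close> the off-diagonal one.\<close>

lemma M_decomp:
  assumes g: "g \<in> M i" and i: "i \<in> {1..<n}"
  shows "\<exists>a b c. g = tv (e i) a \<circ> tau (e i) (b *s e (Suc i)) \<circ> tv (e (Suc i)) c"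
proof -
  have i': "i \<in> {1..n}" "Suc i \<in> {1..n}" using i by auto
  have gi: "g \<in> isom" using g by (rule M_isom)
  define d where "d j = g (f j) - f j" for j
  have gf: "g (f j) = f j + d j" for j by (simp add: d_def)
  have d: "d j = s (d j) (f i) *s e i + s (d j) (f (Suc i)) *s e (Suc i)" (is "_ = ?r j")
    if j: "j \<in> {i, Suc i}" for j
  proof -
    have j': "j \<in> {1..n}" using j i' by auto
    have "s (d j) (e k) = 0" if "k \<in> {1..n}" for k
      using isom_s[OF gi, of "f j" "e k"] M_fix(1)[OF g i that] by (simp add: d_def)
    moreover have "s (d j) (f k) = 0" if "k \<in> {1..n}" "k \<noteq> i" "k \<noteq> Suc i" for k
      using isom_s[OF gi, of "f j" "f k"] M_fix(2)[OF g i that] by (simp add: d_def)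
    ultimately have "d j - ?r j = 0"
      using i' by (intro basis_test) auto
    then show ?thesis by simp
  qed
  define A B A' C where "A = s (d i) (f i)" "B = s (d i) (f (Suc i))"
    "A' = s (d (Suc i)) (f i)" "C = s (d (Suc i)) (f (Suc i))"
  have fi: "g (f i) = f i + (A *s e i + B *s e (Suc i))"
    unfolding gf[of i] using d[of i] by (simp add: A_B_A'_C_def)
  have fs: "g (f (Suc i)) = f (Suc i) + (A' *s e i + C *s e (Suc i))"
    unfolding gf[of "Suc i"] using d[of "Suc i"] by (simp add: A_B_A'_C_def)
  have "s (g (f i)) (g (f (Suc i))) = s (f i) (f (Suc i))" by (rule isom_s[OF gi])
  \<comment> \<open>This symmetry lets a single \<open>tau\<close> account for both off-diagonal
    entries.\<close>
  then have A': "A' = B" unfolding fi fs using i' by simp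
  \<comment> \<open>The signs come from \<open>s (f i) (e i) = - 1\<close>.\<close>
  let ?h = "tv (e i) (- A) \<circ> tau (e i) ((- B) *s e (Suc i)) \<circ> tv (e (Suc i)) (- C)"
  have "?h \<in> isom" using i' by (intro isom_comp tv_isom tau_isom) simp
  then have "g = ?h"
  proof (rule isom_eqI[OF gi])
    fix j assume j: "j \<in> {1..n}"
    show "g (e j) = ?h (e j)" using M_fix(1)[OF g i j] j i' by (simp add: tv_def tau_def)
    show "g (f j) = ?h (f j)"
    proof (cases "j = i \<or> j = Suc i")
      case True
      then show ?thesis using i' by (auto simp: fi fs A' tv_def tau_def)
    next
      case False
      then show ?thesis using M_fix(2)[OF g i j] j i' by (simp add: tv_def tau_def)
    qed
  qed
  then show ?thesis by blast
qed

section \<open>The members of the slim amalgam\<close>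

abbreviation A_pi :: "('v \<Rightarrow> 'v) set set" where "A_pi \<equiv> amalgam_pi (*s) s n e f"
abbreviation gen :: "('v \<Rightarrow> 'v) set \<Rightarrow> ('v \<Rightarrow> 'v) set" where "gen \<equiv> generate (Sp (*s) s)"

lemma S_subgroup: "subgroup (S j) (Sp (*s) s)"
  unfolding S_pi_def by (rule fix_stab_subgroup)

lemma M_subgroup: "subgroup (M i) (Sp (*s) s)"
  unfolding M_pi_def by (rule fix_stab_subgroup)

lemma gen_subgroup: "H \<subseteq> isom \<Longrightarrow> subgroup (gen H) (Sp (*s) s)"
  by (rule group.generate_is_subgroup[OF group_Sp])

lemma A_subgroup: "X \<in> A_pi \<Longrightarrow> subgroup X (Sp (*s) s)"
  unfolding amalgam_pi_def
  by (elim UnE CollectE exE conjE; hypsubst; intro S_subgroup M_subgroup gen_subgroup)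
     (blast dest: S_isom M_isom)+

lemma gen_incl: "x \<in> H \<Longrightarrow> x \<in> gen H"
  by (rule generate.incl)

lemma A_S: "j \<in> {1..n} \<Longrightarrow> S j \<in> A_pi"
  and A_M: "i \<in> {1..<n} \<Longrightarrow> M i \<in> A_pi"
  and A_SS: "j \<in> {1..n} \<Longrightarrow> l \<in> {1..n} \<Longrightarrow> j \<noteq> l \<Longrightarrow> gen (S j \<union> S l) \<in> A_pi"
  and A_MM: "i \<in> {1..<n} \<Longrightarrow> k \<in> {1..<n} \<Longrightarrow> i \<noteq> k \<Longrightarrow> gen (M i \<union> M k) \<in> A_pi"
  and A_MS: "i \<in> {1..<n} \<Longrightarrow> j \<in> {1..n} \<Longrightarrow> gen (M i \<union> S j) \<in> A_pi"
proof -
  have *: "i \<in> {1..n - 1}" if "i \<in> {1..<n}" for i using that by auto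
  show "j \<in> {1..n} \<Longrightarrow> S j \<in> A_pi" unfolding amalgam_pi_def
    by (rule UnI1, rule UnI1, rule UnI1, rule UnI1) auto
  show "i \<in> {1..<n} \<Longrightarrow> M i \<in> A_pi" unfolding amalgam_pi_def
    by (rule UnI1, rule UnI1, rule UnI1, rule UnI2) (use * in auto)
  show "j \<in> {1..n} \<Longrightarrow> l \<in> {1..n} \<Longrightarrow> j \<noteq> l \<Longrightarrow> gen (S j \<union> S l) \<in> A_pi"
    unfolding amalgam_pi_def by (rule UnI1, rule UnI1, rule UnI2) auto
  show "i \<in> {1..<n} \<Longrightarrow> k \<in> {1..<n} \<Longrightarrow> i \<noteq> k \<Longrightarrow> gen (M i \<union> M k) \<in> A_pi"
    unfolding amalgam_pi_def by (rule UnI1, rule UnI2) (use *[of i] *[of k] in auto)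
  show "i \<in> {1..<n} \<Longrightarrow> j \<in> {1..n} \<Longrightarrow> gen (M i \<union> S j) \<in> A_pi"
    unfolding amalgam_pi_def by (rule UnI2) (use *[of i] in auto)
qed

end

locale amalgam_map = hyperbolic_space scale s n e f
  for scale :: "'a::field \<Rightarrow> 'v::ab_group_add \<Rightarrow> 'v" (infixr \<open>*s\<close> 75) and s and n and e f :: "nat \<Rightarrow> 'v" +
  fixes \<pi> :: "'u::group_add \<Rightarrow> 'v \<Rightarrow> 'v" and \<phi> :: "('v \<Rightarrow> 'v) \<Rightarrow> 'u"
  assumes pi_add: "\<pi> (a + b) = \<pi> a \<circ> \<pi> b" and pi_zero: "\<pi> 0 = id"
    and hom: "X \<in> A_pi \<Longrightarrow> x \<in> X \<Longrightarrow> y \<in> X \<Longrightarrow> \<phi> (x \<circ> y) = \<phi> x + \<phi> y"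
    and sec: "X \<in> A_pi \<Longrightarrow> x \<in> X \<Longrightarrow> \<pi> (\<phi> x) = x"
    and large_field: "\<not> (finite (UNIV :: 'a set) \<and> card (UNIV :: 'a set) \<le> 2)"
begin

lemma A_comp: "X \<in> A_pi \<Longrightarrow> x \<in> X \<Longrightarrow> y \<in> X \<Longrightarrow> x \<circ> y \<in> X"
  using subgroup.m_closed[OF A_subgroup] by simp

lemma A_id: "X \<in> A_pi \<Longrightarrow> id \<in> X"
  using subgroup.one_closed[OF A_subgroup] by simp

lemma A_inv:
  assumes X: "X \<in> A_pi" and x: "x \<in> X" obtains y where "y \<in> X" "x \<circ> y = id" "y \<circ> x = id"
proof
  let ?y = "inv\<^bsub>Sp (*s) s\<^esub> x"
  show "?y \<in> X" using subgroup.m_inv_closed[OF A_subgroup[OF X] x] .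
  have "x \<in> isom" using subgroup.subset[OF A_subgroup[OF X]] x by blast
  then show "x \<circ> ?y = id" "?y \<circ> x = id"
    using group.r_inv[OF group_Sp, of x] group.l_inv[OF group_Sp, of x] by simp_all
qed

lemma phi_id [simp]: "\<phi> id = 0"
proof -
  have "S 1 \<in> A_pi" using A_S n by simp
  then show ?thesis using hom[of "S 1" id id] A_id by (metis add.right_neutral add_left_cancel comp_id)
qed

lemma phi_commute:
  assumes "X \<in> A_pi" "x \<in> X" "y \<in> X" "x \<circ> y = y \<circ> x" shows "\<phi> x + \<phi> y = \<phi> y + \<phi> x"
  using hom[OF assms(1-3)] hom[OF assms(1,3,2)] assms(4) by simp

text \<open>The conjugate \<open>t'\<close> lies in \<open>X\<close> by itself, so a conjugation
  identity between isometries lifts as soon as \<open>x\<close> and \<open>t\<close> share a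
  member.\<close>

lemma phi_conj:
  assumes "X \<in> A_pi" "x \<in> X" "t \<in> X" "x \<circ> t = t' \<circ> x"
  shows "t' \<in> X" "\<phi> x + \<phi> t = \<phi> t' + \<phi> x"
proof -
  obtain y where y: "y \<in> X" "x \<circ> y = id" using A_inv assms by blast
  have "x \<circ> t \<circ> y = t'" using assms(4) y(2) by (simp add: comp_assoc)
  then show t': "t' \<in> X" using A_comp[OF assms(1)] assms y by metis
  show "\<phi> x + \<phi> t = \<phi> t' + \<phi> x" using hom assms t' by metis
qed

lemma S_S:
  assumes "j \<in> {1..n}" "l \<in> {1..n}" shows "\<exists>X\<in>A_pi. S j \<subseteq> X \<and> S l \<subseteq> X"
proof (cases "j = l")
  case True
  then show ?thesis using A_S[OF assms(1)] by (intro bexI[of _ "S j"]) auto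
next
  case False
  show ?thesis by (rule bexI[OF _ A_SS[OF assms False]]) (auto intro: gen_incl)
qed

lemma M_M:
  assumes "i \<in> {1..<n}" "k \<in> {1..<n}" shows "\<exists>X\<in>A_pi. M i \<subseteq> X \<and> M k \<subseteq> X"
proof (cases "i = k")
  case True
  then show ?thesis using A_M[OF assms(1)] by (intro bexI[of _ "M i"]) auto
next
  case False
  show ?thesis by (rule bexI[OF _ A_MM[OF assms False]]) (auto intro: gen_incl)
qed

lemma M_S:
  assumes "i \<in> {1..<n}" "j \<in> {1..n}" shows "\<exists>X\<in>A_pi. M i \<subseteq> X \<and> S j \<subseteq> X"
  by (rule bexI[OF _ A_MS[OF assms]]) (auto intro: gen_incl)

lemma sgen_phi:
  assumes "X \<in> A_pi" "a \<in> sgen (\<phi> ` X)" shows "\<exists>x\<in>X. a = \<phi> x"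
  using assms(2)
proof (induction rule: sgen.induct)
  case sgen_zero
  show ?case using A_id[OF assms(1)] phi_id by metis
next
  case (sgen_plus b a)
  then obtain x y where "b = \<phi> x" "x \<in> X" "a = \<phi> y" "y \<in> X" by blast
  then show ?case using hom A_comp assms(1) by metis
next
  case (sgen_uminus b a)
  then obtain x y where xy: "b = \<phi> x" "x \<in> X" "a = \<phi> y" "y \<in> X" by blast
  obtain x' where x': "x' \<in> X" "x \<circ> x' = id" using A_inv assms(1) xy by blast
  have "\<phi> x + \<phi> x' = 0" using hom[OF assms(1) xy(2) x'(1)] x'(2) by simp
  then have "- b + a = \<phi> (x' \<circ> y)" using hom[OF assms(1) x'(1) xy(4)] xy by (simp add: minus_unique)
  then show ?case using A_comp assms(1) x' xy by blast
qed

section \<open>Downward induction on the planes\<close>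

definition Y :: "nat \<Rightarrow> 'u set" where
  "Y k = \<phi> ` ((\<Union>j\<in>{k..n}. S j) \<union> (\<Union>i\<in>{k..<n}. M i))"

text \<open>Generators for the stabiliser of \<open>e k\<close>, chosen so that for
  \<open>k > 1\<close> each shares a member of the amalgam with \<open>M (k - 1)\<close>, which
  contains \<open>tau (e (k - 1)) (e k)\<close>.\<close>

definition Y' :: "nat \<Rightarrow> 'u set" where
  "Y' k = \<phi> ` (range (tv (e k)) \<union> (\<Union>j\<in>{Suc k..n}. S j) \<union> (\<Union>i\<in>{k..<n}. M i))"

text \<open>The last clause strengthens the induction: it makes the stabiliser of \<open>e k\<close>
  centralise the lift of \<open>tau (e (k - 1)) (e k)\<close> at the next level.\<close>

definition faithful :: "nat \<Rightarrow> bool" where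
  "faithful k \<longleftrightarrow> inj_on \<pi> (sgen (Y k)) \<and> \<pi> ` sgen (Y k) = fixer (Z k) \<and>
     (\<forall>a\<in>sgen (Y k). \<pi> a (e k) = e k \<longrightarrow> a \<in> sgen (Y' k))"

lemma faithful_n: "faithful n"
proof -
  have n1: "n \<in> {1..n}" using n by simp
  interpret pl: hyperbolic_plane "(*s)" s "e n" "f n" "Z n" using plane n1 .
  have Sn: "S n \<in> A_pi" using A_S n1 .
  have GL: "pl.GL = S n" using S_eq[OF n1] by (simp add: pl.GL_def)
  have Yn: "Y n = \<phi> ` S n" by (simp add: Y_def)
  have sgen: "sgen (Y n) = \<phi> ` S n"
    using sgen_phi[OF Sn] unfolding Yn by (auto intro: sgen_base)
  have "inj_on \<pi> (\<phi> ` S n)" using sec[OF Sn] by (auto intro: inj_onI)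
  moreover have "\<pi> ` \<phi> ` S n = fixer (Z n)" using sec[OF Sn] by (force simp: fixer_Z_n)
  moreover have "\<phi> g \<in> sgen (Y' n)" if g: "g \<in> S n" "\<pi> (\<phi> g) (e n) = e n" for g
  proof -
    have ge: "g (e n) = e n" using g sec[OF Sn] by simp
    obtain c where "g = tv (e n) c" using pl.GL_stab[of g, unfolded GL, OF g(1) ge] by blast
    then show ?thesis unfolding Y'_def by (intro sgen_base imageI) blast
  qed
  ultimately show ?thesis unfolding faithful_def sgen by blast
qed

lemma faithful_step:
  assumes k: "k \<in> {1..<n}" and IH: "faithful (Suc k)" shows "faithful k"
proof -
  let ?t = "tau (e k) (e (Suc k))"
  have k1: "k \<in> {1..n}" "Suc k \<in> {1..n}" using k by auto
  interpret pl: hyperbolic_plane "(*s)" s "e k" "f k" "Z k" using plane k1 by blast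
  interpret p2: hyperbolic_plane "(*s)" s "e (Suc k)" "f (Suc k)" "Z (Suc k)" using plane k1 by blast
  have Zk: "insert (e k) (insert (f k) (Z k)) = Z (Suc k)" using Z_Suc[of k] k by simp
  have GL: "pl.GL = S k" and GL2: "p2.GL = S (Suc k)"
    using S_eq k1 by (simp_all add: pl.GL_def p2.GL_def)
  have GR: "pl.GR = fixer (Z (Suc k))" and W: "pl.W = perp (Z (Suc k))"
    by (simp_all add: pl.GR_def pl.W_def Zk)
  \<comment> \<open>By the induction hypothesis \<open>\<pi>\<close> is a bijection from this
    subgroup onto \<open>GR\<close>, so its inverse is a homomorphism.\<close>
  define R where "R = inv_into (sgen (Y (Suc k))) \<pi>"
  have inj: "inj_on \<pi> (sgen (Y (Suc k)))" and im: "\<pi> ` sgen (Y (Suc k)) = pl.GR"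
    and stab: "\<And>a. a \<in> sgen (Y (Suc k)) \<Longrightarrow> \<pi> a (e (Suc k)) = e (Suc k) \<Longrightarrow> a \<in> sgen (Y' (Suc k))"
    using IH unfolding faithful_def GR by blast+
  have R_mem: "R g \<in> sgen (Y (Suc k))" "\<pi> (R g) = g" if "g \<in> pl.GR" for g
    using that unfolding R_def im[symmetric] by (auto intro: inv_into_into f_inv_into_f)
  have R_eq: "R (\<pi> a) = a" if "a \<in> sgen (Y (Suc k))" for a
    unfolding R_def by (rule inv_into_f_f[OF inj that])
  have Sphi: "\<phi> g \<in> sgen (Y (Suc k))" if "g \<in> S j" "j \<in> {Suc k..n}" for g j
    using that unfolding Y_def by (intro sgen_base imageI) blast
  have Mphi: "\<phi> g \<in> sgen (Y (Suc k))" if "g \<in> M i" "i \<in> {Suc k..<n}" for g i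
    using that unfolding Y_def by (intro sgen_base imageI) blast
  have RS: "R g = \<phi> g" if "g \<in> S (Suc k)" for g
    using R_eq[OF Sphi[OF that]] sec[OF A_S that] k1 by simp
  have e2: "e (Suc k) \<in> pl.W" "f (Suc k) \<in> pl.W" "s (e (Suc k)) (f (Suc k)) = 1"
    unfolding W using ef_perp_Z[of "Suc k" "Suc k"] k1 by simp_all
  have tvS: "tv (e k) c \<in> S k" "tv (e (Suc k)) c \<in> S (Suc k)" for c
    using pl.tv_GL p2.tv_GL by (simp_all add: GL[symmetric] GL2[symmetric])
  have tM: "?t \<in> M k" using M_mem(3)[OF k, of 1] by simp
  \<comment> \<open>It is enough to treat generators. Each fixes \<open>e k\<close> and
    \<open>f k\<close>, hence commutes with \<open>g\<close>, and it lies with \<open>S k\<close> in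
    a common member.\<close>
  have S_R: "\<phi> g + a = a + \<phi> g" if g: "g \<in> S k" and a: "a \<in> sgen (Y (Suc k))" for g a
  proof (rule sgen_commute[OF a, symmetric])
    fix x assume "x \<in> Y (Suc k)"
    then consider j h where "j \<in> {Suc k..n}" "h \<in> S j" "x = \<phi> h"
      | i h where "i \<in> {Suc k..<n}" "h \<in> M i" "x = \<phi> h" unfolding Y_def by blast
    then obtain h X where h: "x = \<phi> h" "X \<in> A_pi" "g \<in> X" "h \<in> X" "h \<in> isom" "h (e k) = e k" "h (f k) = f k"
    proof cases
      case 1
      have j: "j \<in> {1..n}" "j \<noteq> k" using 1 by auto
      have "h \<in> fixer (perp {e j, f j})" using S_eq[OF j(1)] 1 by simp
      moreover have "e k \<in> perp {e j, f j}" "f k \<in> perp {e j, f j}" using j k1 by (auto simp: perp_def)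
      ultimately have "h (e k) = e k" "h (f k) = f k" using fixer_fix by blast+
      then show ?thesis using that S_S[OF k1(1) j(1)] S_isom 1 g by blast
    next
      case 2
      have i: "i \<in> {1..<n}" "k \<noteq> i" "k \<noteq> Suc i" using 2 by auto
      have "h (e k) = e k" "h (f k) = f k" using M_fix[OF 2(2) i(1) k1(1)] i by blast+
      then show ?thesis using that M_S[OF i(1) k1(1)] M_isom 2 g by blast
    qed
    have "g \<circ> h = h \<circ> g" using pl.GL_commute GL g h by blast
    then show "x + \<phi> g = \<phi> g + x" using phi_commute h by metis
  qed
  interpret sr: split_rep "(*s)" s "e k" "f k" "Z k" \<pi> "e (Suc k)" "f (Suc k)" \<phi> R
  proof unfold_locales
    fix g h
    show "\<phi> (g \<circ> h) = \<phi> g + \<phi> h" if "g \<in> pl.GL" "h \<in> pl.GL"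
      using that hom[OF A_S[OF k1(1)], of g h] by (simp only: GL)
    show "R (g \<circ> h) = R g + R h" if "g \<in> pl.GR" "h \<in> pl.GR"
      using R_eq[of "R g + R h"] R_mem that by (simp add: pi_add sgen_add)
    show "\<pi> (\<phi> g) = g" if "g \<in> pl.GL" using that sec[OF A_S[OF k1(1)]] by (simp add: GL)
    show "\<pi> (R g) = g" if "g \<in> pl.GR" using that R_mem by simp
    show "\<phi> g + R h = R h + \<phi> g" if "g \<in> pl.GL" "h \<in> pl.GR"
      using that S_R R_mem GL by simp
  qed (use e2 pi_add pi_zero in simp_all)
  have QS: "gen (M k \<union> S k) \<in> A_pi" and QS2: "gen (M k \<union> S (Suc k)) \<in> A_pi"
    using A_MS k k1 by blast+
  have inQ: "x \<in> gen (M k \<union> S k)" if "x \<in> M k \<or> x \<in> S k" for x using that gen_incl by blast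
  have inQ2: "x \<in> gen (M k \<union> S (Suc k))" if "x \<in> M k \<or> x \<in> S (Suc k)" for x using that gen_incl by blast
  have conjQ: "tau u (e (Suc k)) \<in> gen (M k \<union> S k)"
    "\<phi> l + \<phi> ?t = \<phi> (tau u (e (Suc k))) + \<phi> l" if "l \<in> S k" "l (e k) = u" for l u
  proof -
    have "l \<circ> ?t = tau u (e (Suc k)) \<circ> l"
      using isom_tau[of l "e k" "e (Suc k)"] that pl.GL_W[of l "e (Suc k)"] e2 S_isom by (simp add: GL)
    from phi_conj[OF QS _ _ this] show "tau u (e (Suc k)) \<in> gen (M k \<union> S k)"
      "\<phi> l + \<phi> ?t = \<phi> (tau u (e (Suc k))) + \<phi> l" using that tM inQ by blast+
  qed
  have S2_GR: "S (Suc k) \<subseteq> pl.GR" unfolding GR using S_Z[of "Suc k" "Suc k"] k1 by simp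
  have conjQ2: "tau (e k) v \<in> gen (M k \<union> S (Suc k))"
    "\<phi> l + \<phi> ?t = \<phi> (tau (e k) v) + \<phi> l" if "l \<in> S (Suc k)" "l (e (Suc k)) = v" for l v
  proof -
    have "l (e k) = e k" using that S2_GR pl.GR_P[of l "e k"] by auto
    then have "l \<circ> ?t = tau (e k) v \<circ> l"
      using isom_tau[of l "e k" "e (Suc k)"] that S_isom by simp
    from phi_conj[OF QS2 _ _ this] show "tau (e k) v \<in> gen (M k \<union> S (Suc k))"
      "\<phi> l + \<phi> ?t = \<phi> (tau (e k) v) + \<phi> l" using that tM inQ2 by blast+
  qed
  \<comment> \<open>Every generator fixes \<open>e k\<close> and \<open>e (Suc k)\<close>, so it
    commutes with \<open>?t\<close> as an isometry, and it lies with \<open>?t\<close> in a common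
    member.\<close>
  have Y'_comm: "a + \<phi> ?t = \<phi> ?t + a" if a: "a \<in> sgen (Y' (Suc k))" for a
  proof (rule sgen_commute[OF a])
    fix x assume "x \<in> Y' (Suc k)"
    then consider c where "x = \<phi> (tv (e (Suc k)) c)"
      | j h where "j \<in> {Suc (Suc k)..n}" "h \<in> S j" "x = \<phi> h"
      | i h where "i \<in> {Suc k..<n}" "h \<in> M i" "x = \<phi> h" unfolding Y'_def by blast
    then obtain h X where h: "x = \<phi> h" "X \<in> A_pi" "?t \<in> X" "h \<in> X" "h \<in> isom"
      "h (e k) = e k" "h (e (Suc k)) = e (Suc k)"
    proof cases
      case 1
      have "tv (e (Suc k)) c (e k) = e k" "tv (e (Suc k)) c (e (Suc k)) = e (Suc k)"
        using k1 by (simp_all add: tv_def)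
      then show ?thesis using that 1 A_M[OF k] tM M_mem(2)[OF k] tv_isom by blast
    next
      case 2
      have j: "j \<in> {1..n}" "j \<noteq> k" "j \<noteq> Suc k" using 2 by auto
      have "h \<in> fixer (perp {e j, f j})" using S_eq[OF j(1)] 2 by simp
      moreover have "e k \<in> perp {e j, f j}" "e (Suc k) \<in> perp {e j, f j}"
        using j k1 by (auto simp: perp_def)
      ultimately have "h (e k) = e k" "h (e (Suc k)) = e (Suc k)" using fixer_fix by blast+
      then show ?thesis using that M_S[OF k j(1)] S_isom 2 tM by blast
    next
      case 3
      have i: "i \<in> {1..<n}" using 3 by auto
      have "h (e k) = e k" "h (e (Suc k)) = e (Suc k)" using M_fix[OF 3(2) i] k1 by blast+
      then show ?thesis using that M_M[OF k i] M_isom 3 tM by blast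
    qed
    have "h \<circ> ?t = ?t \<circ> h" using isom_tau[OF h(5), of "e k" "e (Suc k)"] h by simp
    then show "x + \<phi> ?t = \<phi> ?t + x" using phi_commute h by metis
  qed
  interpret cs: conj_system "(*s)" s "e k" "f k" "Z k" \<pi> "e (Suc k)" "f (Suc k)" \<phi> R "\<phi> ?t"
  proof unfold_locales
    show "\<pi> (\<phi> ?t) = ?t" using sec[OF A_M[OF k] tM] .
    fix g h assume gh: "g \<in> pl.GL" "h \<in> pl.GR" "tau (g (e k)) (h (e (Suc k))) = ?t"
    then obtain c where c: "c \<noteq> 0" "g (e k) = c *s e k" "h (e (Suc k)) = (1 / c) *s e (Suc k)"
      using pl.tau_eqD[OF pl.GL_P[OF gh(1) pl.P_ef(1)] pl.GR_W[OF gh(2) e2(1)] e2 gh(3)] by blast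
    \<comment> \<open>The diagonal elements \<open>d\<close> and \<open>d2\<close> split off the
      scalars of \<open>g\<close> and \<open>h\<close>. Then \<open>d2\<close> multiplies the second
      argument of \<open>?t\<close> by \<open>1 / c\<close>, and \<open>d\<close> undoes this
      through the first argument, each step within one member.\<close>
    obtain d where d: "d \<in> pl.GL" "d (e k) = c *s e k" using pl.GL_diag[OF c(1)] .
    obtain d2 where d2: "d2 \<in> p2.GL" "d2 (e (Suc k)) = (1 / c) *s e (Suc k)"
      using p2.GL_diag[of "1 / c"] c(1) by auto
    have d2S: "d2 \<in> S (Suc k)" "d2 \<in> pl.GR" using d2 S2_GR GL2 by auto
    obtain d' where d': "d' \<in> pl.GL" "d \<circ> d' = id" "d' \<circ> d = id" using pl.GL_inverse[OF d(1)] .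
    obtain d2' where d2': "d2' \<in> pl.GR" "d2 \<circ> d2' = id" "d2' \<circ> d2 = id" using pl.GR_inverse[OF d2S(2)] .
    have "(d' \<circ> g) (e k) = e k" using d'(3) c(2) d(2) by (metis comp_apply id_apply)
    then obtain a where a: "d' \<circ> g = tv (e k) a" using pl.GL_stab pl.GL_comp d'(1) gh(1) by blast
    have g: "g = d \<circ> tv (e k) a" unfolding a[symmetric] comp_assoc[symmetric] d' by simp
    define h0 where "h0 = d2' \<circ> h"
    have h0: "h0 \<in> pl.GR" unfolding h0_def using pl.GR_comp d2'(1) gh(2) by blast
    have h0e: "h0 (e (Suc k)) = e (Suc k)"
      unfolding h0_def using d2'(3) c(3) d2(2) by (metis comp_apply id_apply)
    have h: "h = d2 \<circ> h0" unfolding h0_def comp_assoc[symmetric] d2' by simp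
    have 1: "\<phi> (tv (e k) a) + \<phi> ?t = \<phi> ?t + \<phi> (tv (e k) a)"
      using isom_tau[OF tv_isom[of "e k" a], of "e k" "e (Suc k)"] k1
      by (intro phi_commute[OF A_M[OF k]] M_mem(1)[OF k] tM) (simp add: tv_def[of "e k" a "e k"] tv_def[of "e k" a "e (Suc k)"])
    have 2: "R h0 + \<phi> ?t = \<phi> ?t + R h0"
      using Y'_comm stab R_mem h0 h0e by simp
    define t' where "t' = tau (e k) ((1 / c) *s e (Suc k))"
    have 3: "\<phi> d2 + \<phi> ?t = \<phi> t' + \<phi> d2" using conjQ2(2)[OF d2S(1) d2(2)] by (simp add: t'_def)
    have "d \<circ> t' = tau (c *s e k) ((1 / c) *s e (Suc k)) \<circ> d"
      using isom_tau[OF pl.GL_isom[OF d(1)], of "e k" "(1 / c) *s e (Suc k)"] d e2 pl.W_closed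
      by (simp add: t'_def pl.GL_W)
    also have "tau (c *s e k) ((1 / c) *s e (Suc k)) = ?t" using c(1) by (simp add: tau_scale)
    finally have "d \<circ> t' = ?t \<circ> d" .
    then have 4: "\<phi> d + \<phi> t' = \<phi> ?t + \<phi> d"
      using phi_conj(2)[OF QS inQ inQ] d GL M_mem(3)[OF k] by (simp add: t'_def)
    have "\<phi> g = \<phi> d + \<phi> (tv (e k) a)" unfolding g using hom[OF A_S[OF k1(1)]] d tvS GL by simp
    moreover have "R h = \<phi> d2 + R h0" unfolding h using sr.R_comp[OF d2S(2) h0] RS d2S by simp
    ultimately have "\<phi> g + R h + \<phi> ?t = \<phi> d + (\<phi> (tv (e k) a) + \<phi> d2) + (R h0 + \<phi> ?t)"
      by (simp add: add.assoc)
    also have "\<phi> (tv (e k) a) + \<phi> d2 = \<phi> d2 + \<phi> (tv (e k) a)"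
      using S_R[OF tvS(1) Sphi[OF d2S(1)]] k1 by simp
    also have "\<phi> d + (\<phi> d2 + \<phi> (tv (e k) a)) + (R h0 + \<phi> ?t)
      = \<phi> d + \<phi> d2 + (\<phi> (tv (e k) a) + \<phi> ?t) + R h0" unfolding 2 by (simp add: add.assoc)
    also have "\<dots> = \<phi> d + (\<phi> d2 + \<phi> ?t) + \<phi> (tv (e k) a) + R h0" unfolding 1 by (simp add: add.assoc)
    also have "\<dots> = (\<phi> d + \<phi> t') + \<phi> d2 + \<phi> (tv (e k) a) + R h0" unfolding 3 by (simp add: add.assoc)
    also have "\<dots> = \<phi> ?t + (\<phi> d + (\<phi> d2 + \<phi> (tv (e k) a)) + R h0)" unfolding 4 by (simp add: add.assoc)
    also have "\<phi> d2 + \<phi> (tv (e k) a) = \<phi> (tv (e k) a) + \<phi> d2"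
      using S_R[OF tvS(1) Sphi[OF d2S(1)]] k1 by simp
    also have "\<phi> d + (\<phi> (tv (e k) a) + \<phi> d2) + R h0 = \<phi> g + R h"
      using \<open>\<phi> g = _\<close> \<open>R h = _\<close> by (simp add: add.assoc)
    finally show "\<phi> g + R h + \<phi> ?t = \<phi> ?t + (\<phi> g + R h)" .
  qed
  \<comment> \<open>The vectors \<open>v\<close> are confined to the plane of
    \<open>e (Suc k)\<close> and \<open>f (Suc k)\<close>, where \<open>S (Suc k)\<close> acts:
    there one member holds all the short root elements involved. \<open>additive_pair_all\<close>
    extends the relation to \<open>W\<close>.\<close>
  have T_right: "cs.T (e k) v = \<phi> (tau (e k) v)" "tau (e k) v \<in> gen (M k \<union> S (Suc k))"
    if v: "v \<in> p2.P" for v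
  proof -
    have "cs.T (e k) v = \<phi> (tau (e k) v) \<and> tau (e k) v \<in> gen (M k \<union> S (Suc k))"
    proof (cases "v = 0")
      case False
      then obtain l where l: "l \<in> S (Suc k)" "l (e (Suc k)) = v" using p2.GL_transitive v GL2 by blast
      have "cs.T (e k) v = R l + \<phi> ?t + - R l" using l S2_GR by (intro cs.T_e_conj) auto
      then show ?thesis using conjQ2[OF l] RS[OF l(1)] by simp
    qed (simp add: A_id[OF QS2])
    then show "cs.T (e k) v = \<phi> (tau (e k) v)" "tau (e k) v \<in> gen (M k \<union> S (Suc k))" by blast+
  qed
  have T_left: "cs.T u (e (Suc k)) = \<phi> (tau u (e (Suc k)))" "tau u (e (Suc k)) \<in> gen (M k \<union> S k)"
    if u: "u \<in> pl.P" for u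
  proof -
    have "cs.T u (e (Suc k)) = \<phi> (tau u (e (Suc k))) \<and> tau u (e (Suc k)) \<in> gen (M k \<union> S k)"
    proof (cases "u = 0")
      case False
      then obtain l where l: "l \<in> S k" "l (e k) = u" using pl.GL_transitive u GL by blast
      have "cs.T u (e (Suc k)) = \<phi> l + \<phi> ?t + - \<phi> l" using l GL by (intro cs.T_e2_conj) auto
      then show ?thesis using conjQ[OF l] by simp
    qed (simp add: A_id[OF QS])
    then show "cs.T u (e (Suc k)) = \<phi> (tau u (e (Suc k)))" "tau u (e (Suc k)) \<in> gen (M k \<union> S k)" by blast+
  qed
  have pair: "cs.additive_pair v v'" if v: "v \<in> p2.P" "v' \<in> p2.P" for v v'
  proof -
    have sv: "s (e k) x = 0" if "x \<in> p2.P" for x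
      using p2.P_cases[OF that] k1 by (metis add_0 mult_zero_right s_add_right s_scale_right basis_s(1,3) n_not_Suc_n)
    have sum: "v + v' \<in> p2.P" using p2.P_closed v by blast
    have "\<phi> (tau (e k) v) + \<phi> (tau (e k) v') = \<phi> (tau (e k) (v + v') \<circ> tv (e k) (s v' v))"
      using hom[OF QS2 T_right(2) T_right(2), of v v'] v tau_add_right[of "e k" v v'] sv by simp
    also have "\<dots> = \<phi> (tau (e k) (v + v')) + \<phi> (tv (e k) (s v' v))"
      using hom[OF QS2 T_right(2)[OF sum] inQ2] M_mem(1)[OF k] by blast
    finally show ?thesis using v sum by (simp add: cs.additive_pair_def T_right(1))
  qed
  have "heisenberg_system (*s) s (e k) (f k) (Z k) \<pi> (e (Suc k)) (f (Suc k)) \<phi> R cs.T"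
  proof (rule cs.heisenberg_systemI)
    show "cs.additive_pair v v'" if "v \<in> pl.W" "v' \<in> pl.W" for v v'
      using large_field _ that
      by (rule cs.additive_pair_all) (intro pair p2.P_closed p2.P_ef)
    show "cs.T u (e (Suc k)) + cs.T u' (e (Suc k))
        = cs.T (u + u') (e (Suc k)) + R (tv (e (Suc k)) (s u' u))"
      if u: "u \<in> pl.P" "u' \<in> pl.P" for u u'
    proof -
      have sum: "u + u' \<in> pl.P" using pl.P_closed u by blast
      have "\<phi> (tau u (e (Suc k))) + \<phi> (tau u' (e (Suc k)))
          = \<phi> (tau (u + u') (e (Suc k)) \<circ> tv (e (Suc k)) (s u' u))"
        using hom[OF QS T_left(2) T_left(2), of u u'] u e2 tau_add_left[of u "e (Suc k)" u'] by simp
      also have "\<dots> = \<phi> (tau (u + u') (e (Suc k))) + \<phi> (tv (e (Suc k)) (s u' u))"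
        using hom[OF QS T_left(2)[OF sum] inQ] M_mem(2)[OF k] by blast
      finally show ?thesis using u sum RS[OF tvS(2)] by (simp add: T_left(1))
    qed
  qed
  then interpret hs: heisenberg_system "(*s)" s "e k" "f k" "Z k" \<pi> "e (Suc k)" "f (Suc k)" \<phi> R cs.T .
  have Y_mono: "sgen (Y (Suc k)) \<subseteq> sgen (Y k)" "sgen (Y (Suc k)) \<subseteq> sgen (Y' k)"
    unfolding Y_def Y'_def by (rule sgen_mono; fastforce)+
  have t_mem: "\<phi> ?t \<in> sgen (Y k)" "\<phi> ?t \<in> sgen (Y' k)"
    unfolding Y_def Y'_def using tM k by (auto intro!: sgen_base imageI)
  have T_mem: "cs.T (e k) w \<in> sgen (Y k) \<and> cs.T (e k) w \<in> sgen (Y' k)" if w: "w \<in> pl.W" for w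
  proof (cases "w = 0")
    case False
    then obtain h where h: "h \<in> pl.GR" "h (e (Suc k)) = w" using pl.GR_transitive e2 w cs.e2_nonzero by blast
    then show ?thesis unfolding cs.T_e_conj[OF h]
      using R_mem(1)[OF h(1)] Y_mono t_mem by (intro conjI sgen_add sgen_minus) blast+
  qed (simp add: sgen_zero)
  have "hs.U \<subseteq> sgen (Y k)" unfolding hs.U_def
  proof (rule sgen_least, intro Un_least image_subsetI)
    show "\<phi> g \<in> sgen (Y k)" if "g \<in> pl.GL" for g
      using that k1 unfolding GL Y_def by (intro sgen_base imageI) auto
    show "R g \<in> sgen (Y k)" if "g \<in> pl.GR" for g using R_mem(1)[OF that] Y_mono by blast
    show "cs.T (e k) w \<in> sgen (Y k)" if "w \<in> pl.W" for w using T_mem that by blast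
  qed
  moreover have RU: "sgen (Y (Suc k)) \<subseteq> hs.U"
    using R_eq im hs.U_R by (metis image_eqI subsetI)
  have "Y k \<subseteq> hs.U"
  proof
    fix x assume "x \<in> Y k"
    then consider j g where "j \<in> {k..n}" "g \<in> S j" "x = \<phi> g"
      | i g where "i \<in> {k..<n}" "g \<in> M i" "x = \<phi> g" unfolding Y_def by blast
    then show "x \<in> hs.U"
    proof cases
      case 1
      show ?thesis
      proof (cases "j = k")
        case True
        then show ?thesis using 1 hs.U_L GL by simp
      next
        case False
        then have "j \<in> {Suc k..n}" using 1 by auto
        then show ?thesis using Sphi 1 RU by blast
      qed
    next
      case 2
      show ?thesis
      proof (cases "i = k")
        case True
        \<comment> \<open>Of the generators in \<open>Y k\<close>, only those from
          \<open>M k\<close> are neither in \<open>L\<close> nor in the previous level; their three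
          factors are values of \<open>L\<close>, \<open>T (e k)\<close> and
          \<open>R\<close>.\<close>
        then obtain a b c where g: "g = tv (e k) a \<circ> tau (e k) (b *s e (Suc k)) \<circ> tv (e (Suc k)) c"
          using M_decomp[OF _ k] 2 by blast
        have "x = \<phi> (tv (e k) a) + \<phi> (tau (e k) (b *s e (Suc k))) + \<phi> (tv (e (Suc k)) c)"
          unfolding 2 g using hom[OF A_M[OF k]] M_mem[OF k] A_comp[OF A_M[OF k]] by simp
        also have "\<phi> (tau (e k) (b *s e (Suc k))) = cs.T (e k) (b *s e (Suc k))"
          using T_right(1) p2.P_closed by simp
        also have "\<phi> (tv (e (Suc k)) c) = R (tv (e (Suc k)) c)" using RS tvS by simp
        also have "\<phi> (tv (e k) a) + cs.T (e k) (b *s e (Suc k)) + R (tv (e (Suc k)) c) \<in> hs.U"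
          using e2 pl.W_closed pl.tv_GR tvS GL by (intro hs.U_add hs.U_L hs.U_T hs.U_R) auto
        finally show ?thesis .
      next
        case False
        then have "i \<in> {Suc k..<n}" using 2 by auto
        then show ?thesis using Mphi 2 RU by blast
      qed
    qed
  qed
  then have "sgen (Y k) \<subseteq> hs.U" unfolding hs.U_def by (rule sgen_least)
  ultimately have U: "sgen (Y k) = hs.U" by blast
  \<comment> \<open>The stabiliser of \<open>e k\<close> is contained in \<open>Q\<close>. Nonzero
    values \<open>T (e k) w\<close> are conjugates of \<open>\<phi> ?t\<close> by elements of
    \<open>R\<close>, so every part of the normal form comes from \<open>Y' k\<close>.\<close>
  have "a \<in> sgen (Y' k)" if a: "a \<in> hs.U" "\<pi> a (e k) = e k" for a
  proof -
    obtain w c h where q: "a = cs.T (e k) w + (\<phi> (tv (e k) c) + R h)" "w \<in> pl.W" "h \<in> pl.GR"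
      using hs.U_stab[OF a] unfolding hs.Q_def by blast
    have "\<phi> (tv (e k) c) \<in> sgen (Y' k)" unfolding Y'_def by (intro sgen_base imageI) blast
    moreover have "R h \<in> sgen (Y' k)" using R_mem(1)[OF q(3)] Y_mono by blast
    ultimately show ?thesis unfolding q(1) using T_mem[OF q(2)] by (intro sgen_add) blast+
  qed
  then show ?thesis unfolding faithful_def U using hs.inj_U hs.pi_U by blast
qed

lemma faithful_1: "faithful 1"
proof -
  have "1 \<le> n" using n by simp
  then show ?thesis
    using faithful_n by (induction rule: inc_induct) (auto intro: faithful_step)
qed

text \<open>Passing to the members generated by two of the groups adds nothing, since
  \<open>\<phi>\<close> is a homomorphism on each of them.\<close>

lemma sgen_A: "sgen (\<phi> ` \<Union>A_pi) = sgen (Y 1)"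
proof
  have Ssub: "j \<in> {1..n} \<Longrightarrow> \<phi> ` S j \<subseteq> sgen (Y 1)" for j
    unfolding Y_def by (auto intro!: sgen_base imageI)
  have Msub: "i \<in> {1..n - 1} \<Longrightarrow> \<phi> ` M i \<subseteq> sgen (Y 1)" for i
    unfolding Y_def by (intro image_subsetI sgen_base imageI) fastforce
  have gen: "\<phi> ` gen H \<subseteq> sgen (Y 1)" if X: "gen H \<in> A_pi" and H: "\<phi> ` H \<subseteq> sgen (Y 1)" for H
  proof (rule image_subsetI)
    fix x assume "x \<in> gen H"
    then show "\<phi> x \<in> sgen (Y 1)"
    proof (induction rule: generate.induct)
      case one
      show ?case unfolding Sp_one phi_id by (rule sgen_zero)
    next
      case (incl h)
      then show ?case using H by blast
    next
      case (inv h)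
      have h: "h \<in> gen H" using inv gen_incl by blast
      obtain h' where h': "h' \<in> gen H" "h \<circ> h' = id" "h' \<circ> h = id" using A_inv X h by blast
      have isom: "x \<in> isom" if "x \<in> gen H" for x using subgroup.subset[OF A_subgroup[OF X]] that by blast
      have "inv\<^bsub>Sp (*s) s\<^esub> h = h'"
        using h' isom h by (intro group.inv_equality[OF group_Sp]) auto
      moreover have "\<phi> h' = - \<phi> h" using hom[OF X h h'(1)] h'(2) by (simp add: minus_unique)
      moreover have "- \<phi> h \<in> sgen (Y 1)" using H inv by (intro sgen_minus) blast
      ultimately show ?case by simp
    next
      case (eng h1 h2)
      show ?case unfolding Sp_mult hom[OF X eng(1,2)] using eng(3,4) by (rule sgen_add)
    qed
  qed
  have "\<phi> ` X \<subseteq> sgen (Y 1)" if "X \<in> A_pi" for X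
    using that unfolding amalgam_pi_def[of "(*s)" s n e f]
  proof (elim UnE CollectE exE conjE)
    fix j l assume "X = gen (S j \<union> S l)" "j \<in> {1..n}" "l \<in> {1..n}"
    then show ?thesis using gen that Ssub by (simp add: image_Un)
  next
    fix i k assume "X = gen (M i \<union> M k)" "i \<in> {1..n - 1}" "k \<in> {1..n - 1}"
    then show ?thesis using gen that Msub by (simp add: image_Un)
  next
    fix i j assume "X = gen (M i \<union> S j)" "i \<in> {1..n - 1}" "j \<in> {1..n}"
    then show ?thesis using gen that Msub Ssub by (simp add: image_Un)
  qed (use Ssub Msub in auto)
  then show "sgen (\<phi> ` \<Union>A_pi) \<subseteq> sgen (Y 1)" by (intro sgen_least) blast
  show "sgen (Y 1) \<subseteq> sgen (\<phi> ` \<Union>A_pi)"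
    unfolding Y_def using A_S A_M by (intro sgen_mono image_mono) blast
qed

end

theorem (in hyperbolic_space) slim_completion:
  assumes "\<not> (finite (UNIV :: 'a set) \<and> card (UNIV :: 'a set) \<le> 2)"
  shows "is_universal_completion (Sp (*s) s) (amalgam_pi (*s) s n e f)"
proof (rule is_universal_completionI[OF group_Sp])
  fix \<phi> :: "('v \<Rightarrow> 'v) \<Rightarrow> 'v perm \<times> (('v \<Rightarrow> 'v) \<times> bool) list set perm"
  assume hom: "\<And>X x y. X \<in> A_pi \<Longrightarrow> x \<in> X \<Longrightarrow> y \<in> X \<Longrightarrow> \<phi> (x \<circ> y) = \<phi> x + \<phi> y"
    and sec: "\<And>x. x \<in> \<Union>A_pi \<Longrightarrow> app (fst (\<phi> x)) = x"
  interpret am: amalgam_map "(*s)" s n e f "app \<circ> fst" \<phi>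
  proof unfold_locales
    show "(app \<circ> fst) (\<phi> x) = x" if "X \<in> A_pi" "x \<in> X" for X x
      using sec[OF UnionI[OF that]] by simp
  qed (use assms hom in \<open>simp_all add: plus_perm.rep_eq zero_perm.rep_eq\<close>)
  have "Z 1 = {}" by (simp add: Z_def)
  then show "inj_on (app \<circ> fst) (sgen (\<phi> ` \<Union>A_pi)) \<and> isom \<subseteq> (app \<circ> fst) ` sgen (\<phi> ` \<Union>A_pi)"
    using am.faithful_1 unfolding am.sgen_A am.faithful_def by (simp add: fixer_def)
qed (simp_all add: A_subgroup isom_bij)

theorem theorem1p1:
  fixes scale :: "'a::field \<Rightarrow> 'v::ab_group_add \<Rightarrow> 'v"
    and s :: "'v \<Rightarrow> 'v \<Rightarrow> 'a"
    and n :: nat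
    and e f :: "nat \<Rightarrow> 'v"
  assumes "vector_space scale"
    and "n \<ge> 2"
    and "bilinear_form scale s"
    and "alternating_form s"
    and "nondegenerate_form s"
    and "hyperbolic_basis scale s n e f"
  shows "(\<not> (finite (UNIV :: 'a set) \<and> card (UNIV :: 'a set) \<le> 2) \<longrightarrow>
            is_universal_completion (Sp scale s) (amalgam_pi scale s n e f))
       \<and> is_universal_completion (Sp scale s) (parabolic_amalgam scale s n e f)"
proof -
  interpret vector_space scale by fact
  interpret hyperbolic_space scale s n e f by unfold_locales fact+
  show ?thesis using slim_completion parabolic_completion by blast
qed

end
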